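(* Let $A$ be a complex $n$-dimensional affine space with a flat Hermitian metric, let $G$ be a Lie group of unitary isometries of $A$, acting on the flat hyperkähler manifold $T^*A\cong A\times\mathbb{C}^n$ with hyperkähler moment map $\mu=(\mu_1,\mu_2,\mu_3):T^*A\to\mathfrak{g}^*\otimes\mathbb{R}^3$, and let $\bar M=\mu^{-1}(0)/G$ be the hyperkähler quotient, with its quotient metric. Let $H$ be a group of isometries of $T^*A$ which preserves $\mu^{-1}(0)$ and normalizes $G$. Then $H$ acts isometrically on the quotient $\bar M$, and the corresponding Killing vector fields on $\bar M$ have linear growth.
   Context: $T^*A\cong A\times\mathbb{C}^n$ is a flat hyperkähler manifold with Kähler forms $\omega_1,\omega_2,\omega_3$, where $\omega^c=\omega_2+i\omega_3$ is the canonical holomorphic symplectic form of the cotangent bundle and $\omega_1$ is the Kähler form induced from the Hermitian metric on $A$. The natural (cotangent) action of $G$ on $T^*A$ preserves $\omega_1,\omega_2,\omega_3$. The moment map for $\mu^c=\mu_2+i\mu_3$ is the natural one for a cotangent lift: for a vector field $Y$ on $A$ generated by $G$, $\mu^c_Y(\theta_x)=\theta_x(Y_x)$; $\mu_1$ is any choice of moment map for the action of $G$ with respect to $\omega_1$ such that $G$ preserves $\mu^{-1}(0)$. Standing assumptions: $\mu^{-1}(0)$ is a smooth submanifold of $T^*A$, $G$ acts on it freely and properly so that $\bar M=\mu^{-1}(0)/G$ is a smooth manifold, and $\bar M$ carries the quotient metric: the inner product on $T_{\bar x}\bar M$ is the restriction of the inner product of $T_x\mu^{-1}(0)$ to the horizontal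 space, i.e. the orthogonal complement in $T_x(\mu^{-1}(0))$ of the tangent space to the $G$-orbit through $x$. This metric is complete. A vector field $Y$ on a Riemannian manifold with distance function $\rho$ has linear growth if there are constants $c',c''$ and a point $x_0$ such that $\Vert Y(x)\Vert\le c'\rho(x_0,x)+c''$ for all $x$. The Killing vector fields on $\bar M$ referred to are those generated by one-parameter subgroups of $H$. *)

theory Defs
  imports "HOL-Analysis.Analysis"
begin

section \<open>Smooth maps and submanifolds of Euclidean spaces\<close>

primrec Ck_on :: "nat \<Rightarrow> 'a::real_normed_vector set \<Rightarrow> ('a \<Rightarrow> 'b::real_normed_vector) \<Rightarrow> bool" where
  "Ck_on 0 S f \<longleftrightarrow> continuous_on S f"
| "Ck_on (Suc k) S f \<longleftrightarrow> (\<forall>x\<in>S. f differentiable (at x)) \<and>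
     (\<forall>v. Ck_on k S (\<lambda>x. frechet_derivative f (at x) v))"

text \<open>Smoothness on an arbitrary set means local extendability to a smooth map on an
  open set of the ambient space.\<close>

definition smooth_on :: "'a::real_normed_vector set \<Rightarrow> ('a \<Rightarrow> 'b::real_normed_vector) \<Rightarrow> bool" where
  "smooth_on S f \<longleftrightarrow> (\<forall>x\<in>S. \<exists>U F. open U \<and> x \<in> U \<and> (\<forall>k. Ck_on k U F) \<and> (\<forall>y\<in>S \<inter> U. F y = f y))"

definition smooth_submanifold :: "'a::euclidean_space set \<Rightarrow> bool" where
  "smooth_submanifold M \<longleftrightarrow> (\<exists>d. \<forall>x\<in>M. \<exists>U V S \<phi> \<psi>.
     open U \<and> x \<in> U \<and> open (V :: 'a set) \<and> subspace S \<and> dim S = d \<and>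
     homeomorphism U V \<phi> \<psi> \<and> smooth_on U \<phi> \<and> smooth_on V \<psi> \<and> \<phi> ` (U \<inter> M) = V \<inter> S)"

definition tangent_space :: "'a::euclidean_space set \<Rightarrow> 'a \<Rightarrow> 'a set" where
  "tangent_space M x = {v. \<exists>c :: real \<Rightarrow> 'a. c 0 = x \<and> range c \<subseteq> M \<and> (c has_vector_derivative v) (at 0)}"

text \<open>The differential of \<open>f\<close> along \<open>M\<close>. Only its values on \<open>tangent_space M x\<close> are meaningful,
  and those are determined by \<open>f\<close> even though a derivative within \<open>M\<close> need not be unique.\<close>

definition differential :: "'a::euclidean_space set \<Rightarrow> ('a \<Rightarrow> 'b::real_normed_vector) \<Rightarrow> 'a \<Rightarrow> 'a \<Rightarrow> 'b" where
  "differential M f x = frechet_derivative f (at x within M)"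


section \<open>Manifolds given by an atlas\<close>

text \<open>A chart is a domain together with a map that is relevant only on that domain. Its image is
  open in a linear subspace of the Euclidean space \<open>'e\<close>, so that the dimension of a manifold
  is not tied to a type. The underlying set of an atlas is the union of the chart domains.\<close>

type_synonym ('p, 'e) chart = "'p set \<times> ('p \<Rightarrow> 'e)"
type_synonym ('p, 'e) atlas = "('p, 'e) chart set"

definition carrier_of :: "('p, 'e) atlas \<Rightarrow> 'p set" where
  "carrier_of \<A> = (\<Union>(U, \<phi>)\<in>\<A>. U)"

definition manifold_topology :: "('p, 'e::euclidean_space) atlas \<Rightarrow> 'p topology" where
  "manifold_topology \<A> = topology_generated_by {U \<inter> \<phi> -` W | U \<phi> W. (U, \<phi>) \<in> \<A> \<and> open W}"

definition smooth_manifold :: "'p set \<Rightarrow> ('p, 'e::euclidean_space) atlas \<Rightarrow> bool" where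
  "smooth_manifold M \<A> \<longleftrightarrow> carrier_of \<A> = M \<and>
     (\<exists>d. \<forall>(U, \<phi>)\<in>\<A>. inj_on \<phi> U \<and>
        (\<exists>S. subspace S \<and> dim S = d \<and> openin (top_of_set S) (\<phi> ` U))) \<and>
     (\<forall>(U, \<phi>)\<in>\<A>. \<forall>(V, \<psi>)\<in>\<A>. openin (top_of_set (\<phi> ` U)) (\<phi> ` (U \<inter> V)) \<and>
        smooth_on (\<phi> ` (U \<inter> V)) (\<psi> \<circ> inv_into U \<phi>)) \<and>
     Hausdorff_space (manifold_topology \<A>) \<and> second_countable (manifold_topology \<A>)"

text \<open>A tangent vector at \<open>p\<close> is the family of its coordinate representations in all charts
  around \<open>p\<close>, extended by \<open>0\<close> to the other charts. \<open>has_velocity \<A> c t V\<close> says that the curve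
  \<open>c\<close> has velocity \<open>V\<close> at time \<open>t\<close>.\<close>

type_synonym ('p, 'e) tvec = "('p, 'e) chart \<Rightarrow> 'e"

definition has_velocity ::
  "('p, 'e::euclidean_space) atlas \<Rightarrow> (real \<Rightarrow> 'p) \<Rightarrow> real \<Rightarrow> ('p, 'e) tvec \<Rightarrow> bool" where
  "has_velocity \<A> c t V \<longleftrightarrow>
     (\<forall>(U, \<phi>)\<in>\<A>. c t \<in> U \<longrightarrow> (\<forall>\<^sub>F s in nhds t. c s \<in> U) \<and>
        ((\<phi> \<circ> c) has_vector_derivative V (U, \<phi>)) (at t)) \<and>
     (\<forall>\<kappa>. \<kappa> \<notin> \<A> \<or> c t \<notin> fst \<kappa> \<longrightarrow> V \<kappa> = 0)"

definition velocity :: "('p, 'e::euclidean_space) atlas \<Rightarrow> (real \<Rightarrow> 'p) \<Rightarrow> real \<Rightarrow> ('p, 'e) tvec" where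
  "velocity \<A> c t = (THE V. has_velocity \<A> c t V)"

definition tangent_vectors :: "('p, 'e::euclidean_space) atlas \<Rightarrow> 'p \<Rightarrow> ('p, 'e) tvec set" where
  "tangent_vectors \<A> p =
     {V. \<exists>c. c 0 = p \<and> range c \<subseteq> carrier_of \<A> \<and> has_velocity \<A> c 0 V}"

definition smooth_map :: "('p, 'e::euclidean_space) atlas \<Rightarrow> ('p \<Rightarrow> 'p) \<Rightarrow> bool" where
  "smooth_map \<A> F \<longleftrightarrow> continuous_map (manifold_topology \<A>) (manifold_topology \<A>) F \<and>
     (\<forall>(U, \<phi>)\<in>\<A>. \<forall>(V, \<psi>)\<in>\<A>. smooth_on (\<phi> ` (U \<inter> F -` V)) (\<psi> \<circ> F \<circ> inv_into U \<phi>))"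

text \<open>The coordinates of the image vector in \<open>(V, \<psi>)\<close> do not depend on the chart chosen at
  \<open>p\<close>.\<close>

definition push_forward ::
  "('p, 'e::euclidean_space) atlas \<Rightarrow> ('p \<Rightarrow> 'p) \<Rightarrow> 'p \<Rightarrow> ('p, 'e) tvec \<Rightarrow> ('p, 'e) tvec" where
  "push_forward \<A> F p X = (\<lambda>(V, \<psi>). if (V, \<psi>) \<in> \<A> \<and> F p \<in> V then
     (let (U, \<phi>) = (SOME \<kappa>. \<kappa> \<in> \<A> \<and> p \<in> fst \<kappa>) in
        differential (\<phi> ` (U \<inter> F -` V)) (\<psi> \<circ> F \<circ> inv_into U \<phi>) (\<phi> p) (X (U, \<phi>)))
     else 0)"


section \<open>Riemannian notions\<close>

text \<open>A Riemannian metric assigns to each point a real-valued form on tangent vectors.\<close>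

type_synonym ('p, 'e) metric = "'p \<Rightarrow> ('p, 'e) tvec \<Rightarrow> ('p, 'e) tvec \<Rightarrow> real"

definition tnorm :: "('p, 'e) metric \<Rightarrow> 'p \<Rightarrow> ('p, 'e) tvec \<Rightarrow> real" where
  "tnorm g p V = sqrt (g p V V)"

definition piecewise_C1_curve :: "('p, 'e::euclidean_space) atlas \<Rightarrow> (real \<Rightarrow> 'p) \<Rightarrow> bool" where
  "piecewise_C1_curve \<A> c \<longleftrightarrow>
     continuous_map (top_of_set {0..1}) (manifold_topology \<A>) c \<and>
     (\<exists>F. finite F \<and> (\<forall>(U, \<phi>)\<in>\<A>. (\<phi> \<circ> c) C1_differentiable_on ({t\<in>{0<..<1}. c t \<in> U} - F)))"

definition curve_length ::
  "('p, 'e::euclidean_space) atlas \<Rightarrow> ('p, 'e) metric \<Rightarrow> (real \<Rightarrow> 'p) \<Rightarrow> ennreal" where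
  "curve_length \<A> g c = (\<integral>\<^sup>+t\<in>{0<..<1}. ennreal (tnorm g (c t) (velocity \<A> c t)) \<partial>lborel)"

text \<open>The distance is \<open>\<infinity>\<close> between points of different connected components.\<close>

definition riem_dist :: "('p, 'e::euclidean_space) atlas \<Rightarrow> ('p, 'e) metric \<Rightarrow> 'p \<Rightarrow> 'p \<Rightarrow> ennreal" where
  "riem_dist \<A> g p q =
     (INF c\<in>{c. piecewise_C1_curve \<A> c \<and> c 0 = p \<and> c 1 = q}. curve_length \<A> g c)"

definition complete_metric :: "('p, 'e::euclidean_space) atlas \<Rightarrow> ('p, 'e) metric \<Rightarrow> bool" where
  "complete_metric \<A> g \<longleftrightarrow> (\<forall>\<sigma> :: nat \<Rightarrow> 'p. range \<sigma> \<subseteq> carrier_of \<A> \<longrightarrow>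
     (\<forall>\<epsilon>>0. \<exists>N. \<forall>m\<ge>N. \<forall>n\<ge>N. riem_dist \<A> g (\<sigma> m) (\<sigma> n) < \<epsilon>) \<longrightarrow>
     (\<exists>p\<in>carrier_of \<A>. (\<lambda>n. riem_dist \<A> g (\<sigma> n) p) \<longlonglongrightarrow> 0))"

definition riemannian_isometry ::
  "('p, 'e::euclidean_space) atlas \<Rightarrow> ('p, 'e) metric \<Rightarrow> ('p \<Rightarrow> 'p) \<Rightarrow> bool" where
  "riemannian_isometry \<A> g F \<longleftrightarrow> bij_betw F (carrier_of \<A>) (carrier_of \<A>) \<and>
     smooth_map \<A> F \<and> smooth_map \<A> (inv_into (carrier_of \<A>) F) \<and>
     (\<forall>p\<in>carrier_of \<A>. \<forall>V\<in>tangent_vectors \<A> p. \<forall>W\<in>tangent_vectors \<A> p.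
        g (F p) (push_forward \<A> F p V) (push_forward \<A> F p W) = g p V W)"

text \<open>Here \<open>H\<close> is a group of transformations of some space under composition, and
  \<open>act\<close> its action on the manifold.\<close>

definition acts_isometrically ::
  "('x \<Rightarrow> 'x) set \<Rightarrow> (('x \<Rightarrow> 'x) \<Rightarrow> 'p \<Rightarrow> 'p) \<Rightarrow> ('p, 'e::euclidean_space) atlas \<Rightarrow> ('p, 'e) metric \<Rightarrow> bool"
  where
  "acts_isometrically H act \<A> g \<longleftrightarrow>
     (\<forall>p\<in>carrier_of \<A>. act id p = p) \<and>
     (\<forall>h\<in>H. \<forall>k\<in>H. \<forall>p\<in>carrier_of \<A>. act (h \<circ> k) p = act h (act k p)) \<and>
     (\<forall>h\<in>H. riemannian_isometry \<A> g (act h))"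

definition linear_growth_on ::
  "'p set \<Rightarrow> ('p, 'e::euclidean_space) atlas \<Rightarrow> ('p, 'e) metric \<Rightarrow> ('p \<Rightarrow> ('p, 'e) tvec) \<Rightarrow> bool" where
  "linear_growth_on C \<A> g Y \<longleftrightarrow> (\<exists>c' c'' :: real. \<exists>x0\<in>C. \<forall>x\<in>C.
     tnorm g x (Y x) \<le> c' * enn2real (riem_dist \<A> g x0 x) + c'')"

text \<open>The requirement is imposed on each connected component, i.e. on each class of points at
  finite distance from each other; on a connected manifold there is just one.\<close>

definition linear_growth ::
  "('p, 'e::euclidean_space) atlas \<Rightarrow> ('p, 'e) metric \<Rightarrow> ('p \<Rightarrow> ('p, 'e) tvec) \<Rightarrow> bool" where
  "linear_growth \<A> g Y \<longleftrightarrow>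
     (\<forall>q\<in>carrier_of \<A>. linear_growth_on {x\<in>carrier_of \<A>. riem_dist \<A> g q x < \<infinity>} \<A> g Y)"


section \<open>Quotients of submanifolds by groups of transformations\<close>

definition orbit :: "('a \<Rightarrow> 'a) set \<Rightarrow> 'a \<Rightarrow> 'a set" where
  "orbit \<Gamma> x = (\<lambda>g. g x) ` \<Gamma>"

text \<open>The smooth structure on the set of orbits for which the projection
  \<open>orbit \<Gamma> : M \<rightarrow> M/\<Gamma>\<close> is a smooth submersion.\<close>

definition quotient_atlas :: "('a::euclidean_space \<Rightarrow> 'a) set \<Rightarrow> 'a set \<Rightarrow> ('a set, 'a) atlas" where
  "quotient_atlas \<Gamma> M = {(U, \<phi>). U \<subseteq> orbit \<Gamma> ` M \<and> inj_on \<phi> U \<and>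
     openin (top_of_set M) (M \<inter> orbit \<Gamma> -` U) \<and>
     smooth_on (M \<inter> orbit \<Gamma> -` U) (\<phi> \<circ> orbit \<Gamma>) \<and>
     (\<exists>S. subspace S \<and> openin (top_of_set S) (\<phi> ` U) \<and>
        (\<forall>x\<in>M \<inter> orbit \<Gamma> -` U. differential M (\<phi> \<circ> orbit \<Gamma>) x ` tangent_space M x = S))}"

definition projection_differential ::
  "('a::euclidean_space \<Rightarrow> 'a) set \<Rightarrow> 'a set \<Rightarrow> 'a \<Rightarrow> 'a \<Rightarrow> ('a set, 'a) tvec" where
  "projection_differential \<Gamma> M x u = (\<lambda>(U, \<phi>).
     if (U, \<phi>) \<in> quotient_atlas \<Gamma> M \<and> orbit \<Gamma> x \<in> U then differential M (\<phi> \<circ> orbit \<Gamma>) x u else 0)"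

definition horizontal_space :: "('a::euclidean_space \<Rightarrow> 'a) set \<Rightarrow> 'a set \<Rightarrow> 'a \<Rightarrow> 'a set" where
  "horizontal_space \<Gamma> M x =
     {u \<in> tangent_space M x. \<forall>v\<in>tangent_space (orbit \<Gamma> x) x. u \<bullet> v = 0}"

definition horizontal_lift ::
  "('a::euclidean_space \<Rightarrow> 'a) set \<Rightarrow> 'a set \<Rightarrow> 'a \<Rightarrow> ('a set, 'a) tvec \<Rightarrow> 'a" where
  "horizontal_lift \<Gamma> M x V =
     (THE u. u \<in> horizontal_space \<Gamma> M x \<and> projection_differential \<Gamma> M x u = V)"

text \<open>When \<open>\<Gamma>\<close> acts by isometries, the choice of the point in the orbit is immaterial.\<close>

definition quotient_metric :: "('a::euclidean_space \<Rightarrow> 'a) set \<Rightarrow> 'a set \<Rightarrow> ('a set, 'a) metric" where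
  "quotient_metric \<Gamma> M p V W = (let x = (SOME x. x \<in> p) in
     horizontal_lift \<Gamma> M x V \<bullet> horizontal_lift \<Gamma> M x W)"


section \<open>Groups of isometries\<close>

definition isometry_group :: "('a::metric_space \<Rightarrow> 'a) set \<Rightarrow> bool" where
  "isometry_group H \<longleftrightarrow> id \<in> H \<and> (\<forall>h\<in>H. \<forall>k\<in>H. h \<circ> k \<in> H) \<and>
     (\<forall>h\<in>H. bij h \<and> inv h \<in> H \<and> (\<forall>x y. dist (h x) (h y) = dist x y))"

definition normalizes :: "('a \<Rightarrow> 'a) set \<Rightarrow> ('a \<Rightarrow> 'a) set \<Rightarrow> bool" where
  "normalizes H \<Gamma> \<longleftrightarrow> (\<forall>h\<in>H. (\<lambda>g. h \<circ> g \<circ> inv h) ` \<Gamma> = \<Gamma>)"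

definition one_parameter_subgroup ::
  "('a::topological_space \<Rightarrow> 'a) set \<Rightarrow> (real \<Rightarrow> 'a \<Rightarrow> 'a) \<Rightarrow> bool" where
  "one_parameter_subgroup H \<gamma> \<longleftrightarrow> range \<gamma> \<subseteq> H \<and> (\<forall>s t. \<gamma> (s + t) = \<gamma> s \<circ> \<gamma> t) \<and>
     (\<forall>x. continuous_on UNIV (\<lambda>t. \<gamma> t x))"


section \<open>The affine Hermitian space and its cotangent bundle\<close>

text \<open>The \<open>n\<close>-dimensional affine space with flat Hermitian metric is \<open>complex^'n\<close> with its standard
  metric and no preferred origin. A pair \<open>(U, b)\<close> encodes the affine map \<open>x \<mapsto> U x + b\<close>.\<close>

type_synonym 'n aff = "((complex^'n)^'n) \<times> (complex^'n)"

definition aff_mult :: "'n::finite aff \<Rightarrow> 'n aff \<Rightarrow> 'n aff" where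
  "aff_mult g h = (fst g ** fst h, fst g *v snd h + snd g)"

definition aff_one :: "'n::finite aff" where
  "aff_one = (mat 1, 0)"

definition aff_action :: "'n::finite aff \<Rightarrow> complex^'n \<Rightarrow> complex^'n" where
  "aff_action g x = fst g *v x + snd g"

definition unitary :: "complex^('n::finite)^'n \<Rightarrow> bool" where
  "unitary U \<longleftrightarrow> (\<chi> i j. cnj (U $ j $ i)) ** U = mat 1"

text \<open>A Lie subgroup of the group of all unitary affine maps. Being an embedded submanifold is no
  restriction for a Lie group that acts properly on some nonempty closed subset of the
  cotangent bundle.\<close>

definition unitary_lie_group :: "'n::finite aff set \<Rightarrow> bool" where
  "unitary_lie_group G \<longleftrightarrow> (\<forall>g\<in>G. unitary (fst g)) \<and> aff_one \<in> G \<and>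
     (\<forall>g\<in>G. \<forall>h\<in>G. aff_mult g h \<in> G) \<and> (\<forall>g\<in>G. \<exists>h\<in>G. aff_mult h g = aff_one) \<and>
     smooth_submanifold G"

definition lie_algebra :: "'n::finite aff set \<Rightarrow> 'n aff set" where
  "lie_algebra G = tangent_space G aff_one"

text \<open>In \<open>(x, \<theta>)\<close> the second component is the complex linear form
  \<open>v \<mapsto> scalar_product \<theta> v\<close> on the tangent space at \<open>x\<close>. The flat metric is the standard
  inner product of the product type.\<close>

type_synonym 'n cot = "(complex^'n) \<times> (complex^'n)"

text \<open>The cotangent lift sends the form \<open>\<theta>\<close> at \<open>x\<close> to the form \<open>v \<mapsto> \<theta> (U\<^sup>-\<^sup>1 v)\<close> at \<open>U x + b\<close>.\<close>

definition cot_action :: "'n::finite aff \<Rightarrow> 'n cot \<Rightarrow> 'n cot" where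
  "cot_action g p = (aff_action g (fst p), transpose (matrix_inv (fst g)) *v snd p)"

definition generated_field ::
  "('n::finite aff \<Rightarrow> 'x \<Rightarrow> 'x::real_normed_vector) \<Rightarrow> 'n aff set \<Rightarrow> 'n aff \<Rightarrow> 'x \<Rightarrow> 'x" where
  "generated_field act G \<xi> x = differential G (\<lambda>g. act g x) aff_one \<xi>"

text \<open>The Kaehler form for multiplication by \<open>\<i>\<close> in the holomorphic coordinates \<open>(x, \<theta>)\<close>.\<close>

definition omega1 :: "'n::finite cot \<Rightarrow> 'n cot \<Rightarrow> real" where
  "omega1 u w = (\<i> *s fst u, \<i> *s snd u) \<bullet> w"

text \<open>An element of the dual Lie algebra is a function that is relevant only on \<open>lie_algebra G\<close>.\<close>

definition moment_map ::
  "'n::finite aff set \<Rightarrow> ('n cot \<Rightarrow> 'n cot \<Rightarrow> real) \<Rightarrow> ('n cot \<Rightarrow> 'n aff \<Rightarrow> real) \<Rightarrow> bool" where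
  "moment_map G \<omega> \<mu> \<longleftrightarrow>
     (\<forall>p. \<forall>\<xi>\<in>lie_algebra G. \<forall>\<eta>\<in>lie_algebra G. \<forall>a b.
        \<mu> p (a *\<^sub>R \<xi> + b *\<^sub>R \<eta>) = a * \<mu> p \<xi> + b * \<mu> p \<eta>) \<and>
     (\<forall>\<xi>\<in>lie_algebra G. \<forall>p.
        ((\<lambda>q. \<mu> q \<xi>) has_derivative (\<lambda>w. \<omega> (generated_field cot_action G \<xi> p) w)) (at p))"

text \<open>\<open>\<theta> \<mapsto> \<theta>(Y)\<close> for the field \<open>Y\<close> generated on the affine space. It satisfies the sign
  convention of \<open>moment_map\<close> for \<open>\<omega>\<^sup>c((u, \<alpha>), (w, \<beta>)) = \<beta>(u) - \<alpha>(w)\<close>.\<close>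

definition canonical_moment :: "'n::finite aff set \<Rightarrow> 'n cot \<Rightarrow> 'n aff \<Rightarrow> complex" where
  "canonical_moment G p \<xi> = scalar_product (snd p) (generated_field aff_action G \<xi> (fst p))"

definition hk_moment ::
  "'n::finite aff set \<Rightarrow> ('n cot \<Rightarrow> 'n aff \<Rightarrow> real) \<Rightarrow> 'n cot \<Rightarrow> 'n aff \<Rightarrow> real \<times> real \<times> real" where
  "hk_moment G \<mu>1 p \<xi> = (\<mu>1 p \<xi>, Re (canonical_moment G p \<xi>), Im (canonical_moment G p \<xi>))"

definition hk_level :: "'n::finite aff set \<Rightarrow> ('n cot \<Rightarrow> 'n aff \<Rightarrow> real) \<Rightarrow> 'n cot set" where
  "hk_level G \<mu>1 = {p. \<forall>\<xi>\<in>lie_algebra G. hk_moment G \<mu>1 p \<xi> = 0}"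

definition free_on :: "'n::finite aff set \<Rightarrow> 'n cot set \<Rightarrow> bool" where
  "free_on G M \<longleftrightarrow> (\<forall>g\<in>G. \<forall>x\<in>M. cot_action g x = x \<longrightarrow> g = aff_one)"

definition proper_on :: "'n::finite aff set \<Rightarrow> 'n cot set \<Rightarrow> bool" where
  "proper_on G M \<longleftrightarrow>
     proper_map (top_of_set (G \<times> M)) (top_of_set (M \<times> M)) (\<lambda>(g, x). (cot_action g x, x))"

text \<open>The hyperkaehler quotient is the orbit set with this atlas and this metric.\<close>

definition hk_atlas ::
  "'n::finite aff set \<Rightarrow> ('n cot \<Rightarrow> 'n aff \<Rightarrow> real) \<Rightarrow> ('n cot set, 'n cot) atlas" where
  "hk_atlas G \<mu>1 = quotient_atlas (cot_action ` G) (hk_level G \<mu>1)"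

definition hk_metric ::
  "'n::finite aff set \<Rightarrow> ('n cot \<Rightarrow> 'n aff \<Rightarrow> real) \<Rightarrow> ('n cot set, 'n cot) metric" where
  "hk_metric G \<mu>1 = quotient_metric (cot_action ` G) (hk_level G \<mu>1)"

end

theory Submission
  imports Defs
begin

text \<open>The flow of a one-parameter group of isometries of Euclidean space has an affine velocity field
\<open>X\<close>, since the isometries are affine; hence \<open>norm (X x) \<le> K * norm x + L\<close>. The Killing field on
the quotient is the projection of \<open>X\<close>, and its norm at an orbit \<open>p\<close> is the norm of the horizontal
part of \<open>X x\<close>, for whichever point \<open>x \<in> p\<close> one likes. So it is enough to find in every orbit \<open>p\<close> a
point whose distance from a fixed point \<open>a\<close> is bounded by the Riemannian distance, in the quotient,
of \<open>p\<close> from the orbit of \<open>a\<close>, up to a constant. As the group acts by isometries, every point of one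
orbit is equally far from another orbit. Therefore this reduces to \<open>setdist_le_riem_dist\<close>: two
orbits, as subsets of Euclidean space, are no farther apart than they are in the quotient.

That inequality is usually obtained by lifting a curve \<open>c\<close> of the quotient horizontally, which
preserves its length. Only a lift to first order is used here. At a time \<open>t\<close> the velocity of \<open>c\<close>
has a horizontal lift \<open>u\<close> at a point \<open>x\<close> of the orbit \<open>c t\<close>, with the same norm, and the orbits
\<open>c s\<close> come within \<open>o(s - t)\<close> of \<open>x + (s - t) u\<close>, because the projection is a submersion
(\<open>submersion_near\<close>, a consequence of Brouwer's fixed point theorem). So the distance of the orbits
\<open>c s\<close> and \<open>c t\<close> is at most \<open>(norm u + o(1)) \<bar>s - t\<bar>\<close>, as stated in \<open>speed_bounds_setdist\<close>, and
\<open>pseudometric_le_speed_integral\<close> integrates this bound along the curve. The limit superior of the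
difference quotients of the distance is a measurable function below the Riemannian speed, which
spares a discussion of the regularity of the speed itself.

An isometry \<open>h\<close> that preserves the submanifold and normalises the group maps orbits to orbits. It
also pulls charts of the quotient back to charts of the quotient (\<open>pullback_chart\<close>), so that the
coordinate expressions of the induced map are transition maps of the atlas, and these are smooth. The
linear part of \<open>h\<close> is orthogonal and takes horizontal vectors to horizontal vectors; hence the
induced map preserves the quotient metric. For this to make sense each tangent vector of the
quotient must have exactly one horizontal lift at each point of its orbit, which means that the
kernel of the differential of the projection is the tangent space of the orbit. This is
\<open>vertical_eq\<close>, again an application of the first order lift.\<close>

section \<open>Smooth maps along curves\<close>

lemma Ck_on_cong:
  assumes "open S" "\<And>x. x \<in> S \<Longrightarrow> f x = g x" "Ck_on k S f"
  shows "Ck_on k S g"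
  using assms(2,3)
proof (induction k arbitrary: f g)
  case 0
  then show ?case by (metis Ck_on.simps(1) continuous_on_cong)
next
  case (Suc k)
  have der: "(g has_derivative frechet_derivative f (at x)) (at x)" if x: "x \<in> S" for x
  proof -
    have "f differentiable (at x)" using Suc.prems(2) x by simp
    then have "(f has_derivative frechet_derivative f (at x)) (at x)"
      by (simp add: frechet_derivative_works)
    then show ?thesis
      by (rule has_derivative_transform_within_open[OF _ assms(1) x]) (use Suc.prems(1) in auto)
  qed
  have eq: "frechet_derivative f (at x) v = frechet_derivative g (at x) v" if "x \<in> S" for x v
    using frechet_derivative_at[OF der[OF that]] by simp
  have "Ck_on k S (\<lambda>x. frechet_derivative g (at x) v)" for v
    by (rule Suc.IH[of "\<lambda>x. frechet_derivative f (at x) v"]) (use eq Suc.prems(2) in auto)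
  then show ?case
    using der by (auto simp: differentiable_def)
qed

lemma smooth_on_cong:
  assumes "\<And>x. x \<in> S \<Longrightarrow> f x = g x" "smooth_on S f"
  shows "smooth_on S g"
  using assms unfolding smooth_on_def by (metis Int_iff)

lemma smooth_on_extension:
  assumes "smooth_on S f" "x \<in> S"
  obtains U F where "open U" "x \<in> U" "\<And>y. y \<in> U \<Longrightarrow> F differentiable (at y)"
    "\<And>y. y \<in> S \<inter> U \<Longrightarrow> F y = f y"
proof -
  obtain U F where *: "open U" "x \<in> U" "\<forall>k. Ck_on k U F" "\<forall>y\<in>S \<inter> U. F y = f y"
    using assms unfolding smooth_on_def by blast
  have "F differentiable (at y)" if "y \<in> U" for y
    using *(3)[rule_format, of "Suc 0"] that by simp
  with * show thesis by (intro that[of U F]) auto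
qed

lemma smooth_on_open_differentiable:
  assumes "smooth_on S f" "open S" "x \<in> S"
  shows "f differentiable (at x)"
proof -
  obtain U F where *: "open U" "x \<in> U" "\<And>y. y \<in> U \<Longrightarrow> F differentiable (at y)"
    "\<And>y. y \<in> S \<inter> U \<Longrightarrow> F y = f y"
    using smooth_on_extension[OF assms(1,3)] by blast
  obtain D where "(F has_derivative D) (at x)" using *(3)[OF *(2)] by (auto simp: differentiable_def)
  then have "(f has_derivative D) (at x)"
    by (rule has_derivative_transform_within_open[of _ _ _ _ "S \<inter> U"]) (use * assms in auto)
  then show ?thesis by (auto simp: differentiable_def)
qed

lemma smooth_on_differentiable_within:
  assumes "smooth_on S f" "x \<in> S"
  shows "f differentiable (at x within S)"
proof -
  obtain U F where *: "open U" "x \<in> U" "\<And>y. y \<in> U \<Longrightarrow> F differentiable (at y)"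
    "\<And>y. y \<in> S \<inter> U \<Longrightarrow> F y = f y"
    using smooth_on_extension[OF assms] by blast
  obtain D where "(F has_derivative D) (at x)" using *(3)[OF *(2)] by (auto simp: differentiable_def)
  then have D: "(F has_derivative D) (at x within S)" by (rule has_derivative_at_withinI)
  have "(f has_derivative D) (at x within S)"
    by (rule has_derivative_transform_eventually[OF D])
       (use * assms in \<open>auto simp: eventually_at_topological\<close>)
  then show ?thesis by (auto simp: differentiable_def)
qed

text \<open>The derivative of \<open>f \<circ> h\<close> in direction \<open>v\<close> is \<open>f' (h x) (L v)\<close>, which is again a
function precomposed with \<open>h\<close>; so the induction never leaves this class of maps.\<close>

lemma Ck_on_comp_affine:
  fixes f :: "'b::real_normed_vector \<Rightarrow> 'c::real_normed_vector"
  assumes "open S" and L: "bounded_linear L" and h: "\<And>y. h y = L y + b" and "Ck_on k S f"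
  shows "Ck_on k (h -` S) (f \<circ> h)"
  using assms(4)
proof (induction k arbitrary: f)
  have hd: "(h has_derivative L) (at x)" for x
    unfolding h by (auto intro!: derivative_eq_intros bounded_linear_imp_has_derivative L)
  then have hc: "continuous_on A h" for A
    by (meson continuous_at_imp_continuous_on has_derivative_continuous)
  {
    case 0
    then show ?case using continuous_on_compose[OF hc, of "h -` S" f] continuous_on_subset[of S f "h ` (h -` S)"]
      by auto
  next
    case (Suc k)
    have der: "((f \<circ> h) has_derivative (frechet_derivative f (at (h x)) \<circ> L)) (at x)"
      if "x \<in> h -` S" for x
    proof -
      have "(f has_derivative frechet_derivative f (at (h x))) (at (h x))"
        using Suc.prems that by (simp add: frechet_derivative_works[symmetric])
      then show ?thesis using diff_chain_at hd by blast
    qed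
    have op: "open (h -` S)" using hc assms(1) by (simp add: open_vimage)
    have ck: "Ck_on k (h -` S) ((\<lambda>y. frechet_derivative f (at y) (L v)) \<circ> h)" for v
      by (rule Suc.IH) (use Suc.prems in auto)
    have eq: "((\<lambda>y. frechet_derivative f (at y) (L v)) \<circ> h) x = frechet_derivative (f \<circ> h) (at x) v"
      if "x \<in> h -` S" for x v
      using frechet_derivative_at[OF der[OF that]] by (metis comp_apply)
    have "Ck_on k (h -` S) (\<lambda>x. frechet_derivative (f \<circ> h) (at x) v)" for v
      by (rule Ck_on_cong[OF op eq ck])
    then show ?case using der unfolding Ck_on.simps(2) differentiable_def by blast
  }
qed

lemma smooth_on_comp_affine:
  assumes L: "bounded_linear L" and h: "\<And>y. h y = L y + b" and "smooth_on S f"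
  shows "smooth_on (h -` S) (f \<circ> h)"
  unfolding smooth_on_def
proof
  fix x assume "x \<in> h -` S"
  then obtain U F where *: "open U" "h x \<in> U" "\<forall>k. Ck_on k U F" "\<forall>y\<in>S \<inter> U. F y = f y"
    using assms(3) unfolding smooth_on_def by blast
  have "continuous_on UNIV h"
    unfolding h by (intro continuous_intros linear_continuous_on L)
  then have "open (h -` U)" using *(1) by (simp add: open_vimage)
  then show "\<exists>U F. open U \<and> x \<in> U \<and> (\<forall>k. Ck_on k U F) \<and> (\<forall>y\<in>h -` S \<inter> U. F y = (f \<circ> h) y)"
    using * Ck_on_comp_affine[OF *(1) L h] by (intro exI[of _ "h -` U"] exI[of _ "F \<circ> h"]) auto
qed

lemma has_vector_derivative_along_curve:
  assumes "(F has_derivative D) (at (c t))" "(c has_vector_derivative v) (at t)"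
  shows "((\<lambda>s. F (c s)) has_vector_derivative D v) (at t)"
proof -
  have "linear D" using assms(1) has_derivative_linear by blast
  then show ?thesis
    using diff_chain_at[of c "\<lambda>s. s *\<^sub>R v" t F D] assms
    by (simp add: has_vector_derivative_def o_def linear_scale)
qed

lemma has_vector_derivative_quotient_limit:
  assumes "(c has_vector_derivative v) (at t)"
  shows "((\<lambda>s. (c s - c t) /\<^sub>R (s - t)) \<longlongrightarrow> v) (at t)"
proof -
  let ?r = "\<lambda>s. (1 / norm (s - t)) *\<^sub>R (c s - (c t + (s - t) *\<^sub>R v))"
  have "(?r \<longlongrightarrow> 0) (at t)"
    using assms unfolding has_vector_derivative_def has_derivative_within by blast
  then have lim: "((\<lambda>s. norm (?r s)) \<longlongrightarrow> 0) (at t)" by (rule tendsto_norm_zero)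
  have "norm (?r s) = norm ((c s - c t) /\<^sub>R (s - t) - v)" if "s \<noteq> t" for s
  proof -
    have "(c s - c t) /\<^sub>R (s - t) - v = (1 / (s - t)) *\<^sub>R (c s - (c t + (s - t) *\<^sub>R v))"
    proof -
      have "(1 / (s - t)) *\<^sub>R (c s - (c t + (s - t) *\<^sub>R v))
          = (1 / (s - t)) *\<^sub>R (c s - c t) - (1 / (s - t)) *\<^sub>R ((s - t) *\<^sub>R v)"
        by (simp only: diff_diff_eq[symmetric] scaleR_right_diff_distrib)
      then show ?thesis using that by (simp add: inverse_eq_divide)
    qed
    then show ?thesis by (simp only: norm_scaleR) simp
  qed
  then have "\<forall>\<^sub>F s in at t. norm (?r s) = norm ((c s - c t) /\<^sub>R (s - t) - v)"
    by (simp add: eventually_at_filter)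
  with lim have "((\<lambda>s. norm ((c s - c t) /\<^sub>R (s - t) - v)) \<longlongrightarrow> 0) (at t)"
    by (rule Lim_transform_eventually)
  then have "((\<lambda>s. (c s - c t) /\<^sub>R (s - t) - v) \<longlongrightarrow> 0) (at t)"
    by (rule tendsto_norm_zero_cancel)
  then show ?thesis by (rule LIM_zero_cancel)
qed

text \<open>Curves in tangent spaces are required to stay in the set for all times. A
curve that does so only near \<open>0\<close> is stopped at \<open>x\<close> whenever it leaves the set.\<close>

lemma curve_into_set:
  fixes c :: "real \<Rightarrow> 'a::real_normed_vector"
  assumes "c 0 = x" "x \<in> S" "\<forall>\<^sub>F s in at 0. c s \<in> S" "(c has_vector_derivative v) (at 0)"
  obtains c' where "c' 0 = x" "range c' \<subseteq> S" "\<forall>\<^sub>F s in nhds 0. c' s = c s"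
    "(c' has_vector_derivative v) (at 0)"
proof -
  define c' where "c' s = (if c s \<in> S then c s else x)" for s
  have ev: "\<forall>\<^sub>F s in nhds 0. c s = c' s"
    using assms by (auto simp: eventually_nhds_conv_at c'_def elim: eventually_mono)
  have "(c' has_vector_derivative v) (at 0)"
    using assms(4) has_vector_derivative_cong_ev[where x=0 and S=UNIV and f=c and g=c'] ev
      assms(1,2)
    by (simp add: c'_def)
  with ev assms show thesis
    by (intro that[of c']) (auto simp: c'_def elim: eventually_mono)
qed

lemma tangent_spaceI:
  assumes "c 0 = x" "x \<in> S" "\<forall>\<^sub>F s in at 0. c s \<in> S" "(c has_vector_derivative v) (at 0)"
  shows "v \<in> tangent_space S x"
  using curve_into_set[OF assms] unfolding tangent_space_def by blast

text \<open>The differential of a function on an arbitrary set is some linear map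
among possibly many; along curves in the set all of them give the same velocity.\<close>

lemma differential_along_curve:
  assumes f: "smooth_on S f" and c: "c 0 = x" "x \<in> S" "\<forall>\<^sub>F s in at 0. c s \<in> S"
    "(c has_vector_derivative v) (at 0)"
  shows "((\<lambda>s. f (c s)) has_vector_derivative differential S f x v) (at 0)"
proof -
  obtain c' where c': "c' 0 = x" "range c' \<subseteq> S" "\<forall>\<^sub>F s in nhds 0. c' s = c s"
    "(c' has_vector_derivative v) (at 0)" using curve_into_set[OF c] by blast
  let ?D = "differential S f x"
  have D: "(f has_derivative ?D) (at x within S)"
    unfolding differential_def using smooth_on_differentiable_within[OF f c(2)]
    by (simp add: frechet_derivative_works)
  then have "(f has_derivative ?D) (at (c' 0) within range c')"
    using c' has_derivative_subset by metis
  moreover have "linear ?D" using D has_derivative_linear by blast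
  ultimately have "((f \<circ> c') has_vector_derivative ?D v) (at 0)"
    using diff_chain_within[of c' "\<lambda>s. s *\<^sub>R v" 0 UNIV f ?D] c'(4)
    by (simp add: has_vector_derivative_def o_def linear_scale)
  moreover have "\<forall>\<^sub>F s in nhds 0. s \<in> UNIV \<longrightarrow> (f \<circ> c') s = f (c s)"
    using c'(3) by (auto elim: eventually_mono)
  ultimately show ?thesis
    using has_vector_derivative_cong_ev[where x=0 and S=UNIV and f="f \<circ> c'" and g="\<lambda>s. f (c s)"] c' c by auto
qed

lemma linear_differential:
  assumes "smooth_on S f" "x \<in> S"
  shows "linear (differential S f x)"
  using smooth_on_differentiable_within[OF assms] has_derivative_linear
  unfolding differential_def frechet_derivative_works by blast

section \<open>Curves in a pseudometric\<close>

text \<open>On a division that is fine for a gauge chosen from the speed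
bound, each interval with tag \<open>t\<close> is covered by the two bounds from its ends to \<open>t\<close>, and \<open>\<delta> a\<close>
grows over it by at most its length times \<open>u t + \<epsilon>\<close>. The sum over the division is a Riemann sum
of \<open>u\<close>.\<close>

lemma tagged_division_estimate:
  fixes \<delta> :: "real \<Rightarrow> real \<Rightarrow> real" and u :: "real \<Rightarrow> real"
  assumes "a \<le> b" and int: "u integrable_on {a..b}"
    and nonneg: "\<And>s t. s \<in> {a..b} \<Longrightarrow> t \<in> {a..b} \<Longrightarrow> 0 \<le> \<delta> s t"
    and refl: "\<delta> a a = 0"
    and sym: "\<And>s t. s \<in> {a..b} \<Longrightarrow> t \<in> {a..b} \<Longrightarrow> \<delta> s t = \<delta> t s"
    and tri: "\<And>r s t. r \<in> {a..b} \<Longrightarrow> s \<in> {a..b} \<Longrightarrow> t \<in> {a..b} \<Longrightarrow> \<delta> r t \<le> \<delta> r s + \<delta> s t"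
    and speed: "\<And>t \<epsilon>. t \<in> {a..b} \<Longrightarrow> 0 < \<epsilon> \<Longrightarrow>
      \<exists>\<eta>>0. \<forall>s\<in>{a..b}. \<bar>s - t\<bar> < \<eta> \<longrightarrow> \<delta> s t \<le> (u t + \<epsilon>) * \<bar>s - t\<bar>"
  shows "\<delta> a b \<le> integral {a..b} u"
proof (rule field_le_epsilon)
  fix e :: real assume "0 < e"
  define \<epsilon> where "\<epsilon> = e / (b - a + 1)"
  have \<epsilon>: "0 < \<epsilon>" using \<open>0 < e\<close> \<open>a \<le> b\<close> by (simp add: \<epsilon>_def)
  have "\<forall>t. \<exists>\<eta>>0. t \<in> {a..b} \<longrightarrow> (\<forall>s\<in>{a..b}. \<bar>s - t\<bar> < \<eta> \<longrightarrow> \<delta> s t \<le> (u t + \<epsilon>) * \<bar>s - t\<bar>)"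
    using speed[OF _ \<epsilon>] by (metis zero_less_one)
  then obtain \<eta> where \<eta>: "\<And>t. 0 < \<eta> t" "\<And>t s. t \<in> {a..b} \<Longrightarrow> s \<in> {a..b} \<Longrightarrow> \<bar>s - t\<bar> < \<eta> t \<Longrightarrow>
      \<delta> s t \<le> (u t + \<epsilon>) * \<bar>s - t\<bar>"
    by metis
  obtain \<gamma> where \<gamma>: "gauge \<gamma>" "\<And>p. p tagged_division_of {a..b} \<Longrightarrow> \<gamma> fine p \<Longrightarrow>
      norm ((\<Sum>(x,k)\<in>p. measure lborel k *\<^sub>R u x) - integral {a..b} u) < \<epsilon>"
    using integrable_integral[OF int] \<epsilon> unfolding has_integral_real by metis
  define \<gamma>' where "\<gamma>' x = \<gamma> x \<inter> ball x (\<eta> x)" for x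
  have "gauge \<gamma>'" unfolding \<gamma>'_def using \<gamma>(1) \<eta>(1)
    by (auto simp: gauge_def)
  then obtain p where p: "p tagged_division_of {a..b}" "\<gamma>' fine p"
    using fine_division_exists_real by blast
  have "\<gamma> fine p" using p(2) by (auto simp: fine_def \<gamma>'_def)
  have "\<delta> a (Sup k) - \<delta> a (Inf k) \<le> measure lborel k *\<^sub>R u x + \<epsilon> * measure lborel k" if xk: "(x,k) \<in> p" for x k
  proof -
    obtain l r where k: "k = {l..r}" using tagged_division_ofD(4)[OF p(1) xk] by auto
    have x: "x \<in> k" and ks: "k \<subseteq> {a..b}" using tagged_division_ofD(2,3)[OF p(1) xk] by auto
    have "k \<subseteq> ball x (\<eta> x)" using p(2) xk by (auto simp: fine_def \<gamma>'_def)
    moreover have lrk: "l \<in> k" "r \<in> k" using x k by auto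
    ultimately have "l \<in> ball x (\<eta> x)" "r \<in> ball x (\<eta> x)" by blast+
    then have lr: "\<bar>l - x\<bar> < \<eta> x" "\<bar>r - x\<bar> < \<eta> x" "l \<le> x" "x \<le> r"
      "l \<in> {a..b}" "r \<in> {a..b}" "x \<in> {a..b}"
      using x lrk ks k unfolding mem_ball dist_real_def by (auto simp: abs_minus_commute)
    have "\<delta> a r \<le> \<delta> a l + \<delta> l r" using lr \<open>a \<le> b\<close> by (intro tri) auto
    also have "\<delta> l r \<le> \<delta> l x + \<delta> x r" using lr by (intro tri)
    also have "\<delta> l x \<le> (u x + \<epsilon>) * (x - l)" using \<eta>(2)[of x l] lr by auto
    also have "\<delta> x r \<le> (u x + \<epsilon>) * (r - x)" using \<eta>(2)[of x r] lr sym[of x r] by auto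
    finally have "\<delta> a r - \<delta> a l \<le> (u x + \<epsilon>) * (r - l)" by (simp add: algebra_simps)
    then show ?thesis using lr k by (simp add: algebra_simps)
  qed
  then have "(\<Sum>(x,k)\<in>p. \<delta> a (Sup k) - \<delta> a (Inf k)) \<le> (\<Sum>(x,k)\<in>p. measure lborel k *\<^sub>R u x + \<epsilon> * measure lborel k)"
    by (intro sum_mono) auto
  also have "\<dots> = (\<Sum>(x,k)\<in>p. measure lborel k *\<^sub>R u x) + \<epsilon> * (\<Sum>(x,k)\<in>p. measure lborel k)"
    by (simp add: sum.distrib case_prod_unfold sum_distrib_left)
  also have "(\<Sum>(x,k)\<in>p. measure lborel k) = b - a"
    using additive_content_tagged_division[of p a b] p(1) \<open>a \<le> b\<close> by simp
  also have "(\<Sum>(x,k)\<in>p. \<delta> a (Sup k) - \<delta> a (Inf k)) = \<delta> a b - \<delta> a a"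
    using additive_tagged_division_1[OF \<open>a \<le> b\<close> p(1)] .
  finally have "\<delta> a b \<le> (\<Sum>(x,k)\<in>p. measure lborel k *\<^sub>R u x) + \<epsilon> * (b - a)" using refl by simp
  also have "\<dots> \<le> integral {a..b} u + \<epsilon> + \<epsilon> * (b - a)"
    using \<gamma>(2)[OF p(1) \<open>\<gamma> fine p\<close>] by (simp add: abs_if split: if_splits)
  also have "\<dots> = integral {a..b} u + e"
  proof -
    have "\<epsilon> * (b - a + 1) = e" using \<open>a \<le> b\<close> by (simp add: \<epsilon>_def)
    then show ?thesis by (simp add: algebra_simps)
  qed
  finally show "\<delta> a b \<le> integral {a..b} u + e" .
qed

text \<open>The limit superior of \<open>\<delta> s t / \<bar>s - t\<bar>\<close> as \<open>s\<close> tends to \<open>t\<close>, over times in the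
open unit interval.\<close>

definition metric_speed :: "(real \<Rightarrow> real \<Rightarrow> real) \<Rightarrow> real \<Rightarrow> ennreal" where
  "metric_speed \<delta> t = (INF n::nat. SUP s\<in>{s\<in>{0<..<1}. 0 < \<bar>s - t\<bar> \<and> \<bar>s - t\<bar> < 1 / Suc n}.
     ennreal (\<delta> s t / \<bar>s - t\<bar>))"

text \<open>For fixed \<open>n\<close> the supremum exceeds \<open>y\<close> at \<open>t\<close> exactly if \<open>t\<close> lies in
one of the open sets of times for which some particular \<open>s\<close> gives a quotient above \<open>y\<close>. So the
supremum is lower semicontinuous, although uncountably many \<open>s\<close> are involved.\<close>

lemma metric_speed_measurable:
  assumes cont: "\<And>s. s \<in> {0<..<1} \<Longrightarrow> continuous_on {0<..<1} (\<delta> s)"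
  shows "(\<lambda>t. metric_speed \<delta> t * indicator {0<..<1} t) \<in> borel_measurable lborel"
proof -
  define Q where "Q n t = (SUP s\<in>{s\<in>{0<..<1}. 0 < \<bar>s - t\<bar> \<and> \<bar>s - t\<bar> < 1 / Suc n}.
     ennreal (\<delta> s t / \<bar>s - t\<bar>))" for n :: nat and t :: real
  have "(\<lambda>t. Q n t * indicator {0<..<1} t) \<in> borel_measurable borel" for n
  proof (rule borel_measurableI_greater)
    fix y :: ennreal
    define O' where "O' s = {t\<in>{0<..<1}. 0 < \<bar>s - t\<bar> \<and> \<bar>s - t\<bar> < 1 / Suc n \<and> y < ennreal (\<delta> s t / \<bar>s - t\<bar>)}" for s
    have "open (O' s)" if s: "s \<in> {0<..<1}" for s
    proof -
      have "continuous_on ({0<..<1} - {s}) (\<lambda>t. ennreal (\<delta> s t / \<bar>s - t\<bar>))"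
        by (intro continuous_on_ennreal continuous_intros continuous_on_subset[OF cont[OF s]]) auto
      then have "open ((\<lambda>t. ennreal (\<delta> s t / \<bar>s - t\<bar>)) -` {y<..} \<inter> ({0<..<1} - {s}))"
        using continuous_on_open_vimage[of "{0<..<1} - {s}" "\<lambda>t. ennreal (\<delta> s t / \<bar>s - t\<bar>)"]
        by (simp add: open_delete)
      then have "open (({0<..<1} - {s}) \<inter> (\<lambda>t. ennreal (\<delta> s t / \<bar>s - t\<bar>)) -` {y<..})"
        by (simp add: Int_commute)
      moreover have "open (ball s (1 / Suc n))" by simp
      ultimately have "open ((({0<..<1} - {s}) \<inter> (\<lambda>t. ennreal (\<delta> s t / \<bar>s - t\<bar>)) -` {y<..}) \<inter> ball s (1 / Suc n))"
        by blast
      moreover have "(({0<..<1} - {s}) \<inter> (\<lambda>t. ennreal (\<delta> s t / \<bar>s - t\<bar>)) -` {y<..}) \<inter> ball s (1 / Suc n) = O' s"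
        by (auto simp: O'_def dist_real_def)
      ultimately show ?thesis by simp
    qed
    then have op: "open (\<Union>s\<in>{0<..<1}. O' s)" by blast
    have "{t \<in> space borel. y < Q n t * indicator {0<..<1} t} = (\<Union>s\<in>{0<..<1}. O' s)"
    proof (intro set_eqI iffI)
      fix t assume "t \<in> {t \<in> space borel. y < Q n t * indicator {0<..<1} t}"
      then have t: "t \<in> {0<..<1}" "y < Q n t" by (cases "t \<in> {0<..<1}"; simp)+
      then show "t \<in> (\<Union>s\<in>{0<..<1}. O' s)"
        by (auto simp: Q_def less_SUP_iff O'_def)
    next
      fix t assume "t \<in> (\<Union>s\<in>{0<..<1}. O' s)"
      then show "t \<in> {t \<in> space borel. y < Q n t * indicator {0<..<1} t}"
        by (auto simp: Q_def less_SUP_iff O'_def)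
    qed
    with op show "{t \<in> space borel. y < Q n t * indicator {0<..<1} t} \<in> sets borel" by simp
  qed
  then have "(\<lambda>t. INF n. Q n t * indicator {0<..<1} t) \<in> borel_measurable borel"
    by (intro borel_measurable_INF) auto
  moreover have "(\<lambda>t. INF n. Q n t * indicator {0<..<1} t) = (\<lambda>t. metric_speed \<delta> t * indicator {0<..<1} t)"
    by (rule ext) (auto simp: metric_speed_def Q_def indicator_def)
  ultimately show ?thesis by simp
qed

lemma metric_speed_le:
  assumes "0 \<le> v" and "\<And>\<epsilon>. 0 < \<epsilon> \<Longrightarrow>
    \<exists>\<eta>>0. \<forall>s\<in>{0<..<1}. \<bar>s - t\<bar> < \<eta> \<longrightarrow> \<delta> s t \<le> (v + \<epsilon>) * \<bar>s - t\<bar>"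
  shows "metric_speed \<delta> t \<le> ennreal v"
proof (rule ennreal_le_epsilon)
  fix \<epsilon> :: real assume "0 < \<epsilon>"
  then obtain \<eta> where \<eta>: "0 < \<eta>" "\<And>s. s \<in> {0<..<1} \<Longrightarrow> \<bar>s - t\<bar> < \<eta> \<Longrightarrow> \<delta> s t \<le> (v + \<epsilon>) * \<bar>s - t\<bar>"
    using assms(2) by meson
  obtain n :: nat where n: "1 / Suc n < \<eta>" using \<eta>(1) nat_approx_posE by blast
  have "metric_speed \<delta> t \<le> (SUP s\<in>{s\<in>{0<..<1}. 0 < \<bar>s - t\<bar> \<and> \<bar>s - t\<bar> < 1 / Suc n}.
     ennreal (\<delta> s t / \<bar>s - t\<bar>))"
    unfolding metric_speed_def by (rule INF_lower) simp
  also have "\<dots> \<le> ennreal (v + \<epsilon>)"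
  proof (rule SUP_least)
    fix s assume "s \<in> {s\<in>{0<..<1}. 0 < \<bar>s - t\<bar> \<and> \<bar>s - t\<bar> < 1 / Suc n}"
    then show "ennreal (\<delta> s t / \<bar>s - t\<bar>) \<le> ennreal (v + \<epsilon>)"
      using \<eta>(2)[of s] n by (intro ennreal_leI) (simp add: divide_le_eq)
  qed
  finally show "metric_speed \<delta> t \<le> ennreal v + ennreal \<epsilon>"
    using \<open>0 < \<epsilon>\<close> assms(1) by (simp add: ennreal_plus)
qed

lemma metric_speed_bound:
  assumes fin: "metric_speed \<delta> t < \<infinity>" and "0 < \<epsilon>" and "\<delta> t t = 0"
  shows "\<exists>\<eta>>0. \<forall>s\<in>{0<..<1}. \<bar>s - t\<bar> < \<eta> \<longrightarrow> \<delta> s t \<le> (enn2real (metric_speed \<delta> t) + \<epsilon>) * \<bar>s - t\<bar>"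
proof -
  have "metric_speed \<delta> t < ennreal (enn2real (metric_speed \<delta> t) + \<epsilon>)"
    using fin \<open>0 < \<epsilon>\<close> by (cases "metric_speed \<delta> t") (auto intro!: ennreal_lessI)
  then obtain n :: nat where n: "(SUP s\<in>{s\<in>{0<..<1}. 0 < \<bar>s - t\<bar> \<and> \<bar>s - t\<bar> < 1 / Suc n}.
     ennreal (\<delta> s t / \<bar>s - t\<bar>)) < ennreal (enn2real (metric_speed \<delta> t) + \<epsilon>)"
    using metric_speed_def[of \<delta> t] INF_less_iff[of _ UNIV] by (metis (no_types, lifting))
  show ?thesis
  proof (intro exI[of _ "1 / Suc n"] conjI ballI impI)
    fix s assume s: "s \<in> {0<..<1}" "\<bar>s - t\<bar> < 1 / Suc n"
    show "\<delta> s t \<le> (enn2real (metric_speed \<delta> t) + \<epsilon>) * \<bar>s - t\<bar>"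
    proof (cases "s = t")
      case True
      then show ?thesis using assms by simp
    next
      case False
      then have "ennreal (\<delta> s t / \<bar>s - t\<bar>) \<le> (SUP s\<in>{s\<in>{0<..<1}. 0 < \<bar>s - t\<bar> \<and> \<bar>s - t\<bar> < 1 / Suc n}.
         ennreal (\<delta> s t / \<bar>s - t\<bar>))"
        using s by (intro SUP_upper) auto
      with n have "ennreal (\<delta> s t / \<bar>s - t\<bar>) < ennreal (enn2real (metric_speed \<delta> t) + \<epsilon>)" by simp
      then have "\<delta> s t / \<bar>s - t\<bar> \<le> enn2real (metric_speed \<delta> t) + \<epsilon>"
        by (meson ennreal_leI linorder_not_less nle_le)
      then show ?thesis using False by (simp add: divide_le_eq)
    qed
  qed simp
qed

text \<open>For \<open>v\<close> that is not measurable the right-hand side is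
a lower integral; the metric speed is a measurable function below \<open>v\<close>. The metric speed
is integrated over intervals that avoid the finite set of exceptional times; continuity
extends the result to their closures, and the triangle inequality joins them.\<close>

lemma pseudometric_le_speed_integral:
  fixes \<delta> :: "real \<Rightarrow> real \<Rightarrow> real" and v :: "real \<Rightarrow> real"
  assumes nonneg: "\<And>s t. s \<in> {0..1} \<Longrightarrow> t \<in> {0..1} \<Longrightarrow> 0 \<le> \<delta> s t"
    and refl: "\<And>s. s \<in> {0..1} \<Longrightarrow> \<delta> s s = 0"
    and sym: "\<And>s t. s \<in> {0..1} \<Longrightarrow> t \<in> {0..1} \<Longrightarrow> \<delta> s t = \<delta> t s"
    and tri: "\<And>r s t. r \<in> {0..1} \<Longrightarrow> s \<in> {0..1} \<Longrightarrow> t \<in> {0..1} \<Longrightarrow> \<delta> r t \<le> \<delta> r s + \<delta> s t"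
    and cont: "\<And>t. t \<in> {0..1} \<Longrightarrow> ((\<lambda>s. \<delta> s t) \<longlongrightarrow> 0) (at t within {0..1})"
    and F: "finite F" and v0: "\<And>t. 0 \<le> v t"
    and speed: "\<And>t \<epsilon>. t \<in> {0<..<1} - F \<Longrightarrow> 0 < \<epsilon> \<Longrightarrow>
      \<exists>\<eta>>0. \<forall>s\<in>{0<..<1}. \<bar>s - t\<bar> < \<eta> \<longrightarrow> \<delta> s t \<le> (v t + \<epsilon>) * \<bar>s - t\<bar>"
  shows "ennreal (\<delta> 0 1) \<le> (\<integral>\<^sup>+t\<in>{0<..<1}. ennreal (v t) \<partial>lborel)"
proof -
  define N where "N a b = (\<integral>\<^sup>+t\<in>{a<..<b}. metric_speed \<delta> t \<partial>lborel)" for a b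
  have contR: "continuous_on {0..1} (\<delta> s)" if s: "s \<in> {0..1}" for s
    unfolding continuous_on_def
  proof
    fix t :: real assume t: "t \<in> {0..1}"
    have "\<forall>\<^sub>F r in at t within {0..1}. norm (\<delta> s r - \<delta> s t) \<le> \<delta> r t"
        unfolding eventually_at_filter
    proof (rule always_eventually, intro allI impI)
      fix r assume "r \<in> {0..1::real}"
      then show "norm (\<delta> s r - \<delta> s t) \<le> \<delta> r t"
        using tri[of s r t] tri[of s t r] sym[of r t] s t by auto
    qed
    then have "((\<lambda>r. \<delta> s r - \<delta> s t) \<longlongrightarrow> 0) (at t within {0..1})"
      by (rule Lim_null_comparison) (rule cont[OF t])
    then show "(\<delta> s \<longlongrightarrow> \<delta> s t) (at t within {0..1})" by (simp add: LIM_zero_iff)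
  qed
  have meas0: "(\<lambda>t. metric_speed \<delta> t * indicator {0<..<1} t) \<in> borel_measurable lborel"
    by (rule metric_speed_measurable) (rule continuous_on_subset[OF contR]; auto)
  have meas: "(\<lambda>t. metric_speed \<delta> t * indicator {a<..<b} t) \<in> borel_measurable lborel"
    if "0 \<le> a" "b \<le> 1" for a b
  proof -
    have "(\<lambda>t. (metric_speed \<delta> t * indicator {0<..<1} t) * indicator {a<..<b} t) \<in> borel_measurable lborel"
      by (rule borel_measurable_times_ennreal[OF meas0]) simp
    moreover have "(\<lambda>t. (metric_speed \<delta> t * indicator {0<..<1} t) * indicator {a<..<b} t)
        = (\<lambda>t. metric_speed \<delta> t * indicator {a<..<b} t)"
      using that by (auto simp: indicator_def fun_eq_iff)
    ultimately show ?thesis by simp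
  qed
  have le_v: "metric_speed \<delta> t \<le> ennreal (v t)" if "t \<in> {0<..<1} - F" for t
    using metric_speed_le[of "v t" t \<delta>] v0 speed[OF that] by blast
  have compact: "ennreal (\<delta> a b) \<le> N a b" if ab: "0 < a" "a \<le> b" "b < 1" "{a..b} \<inter> F = {}" for a b
  proof (cases "N a b < \<infinity>")
    case False
    then show ?thesis by (simp add: less_top[symmetric])
  next
    case True
    have fin: "metric_speed \<delta> t < \<infinity>" if "t \<in> {a..b}" for t
    proof -
      have "t \<in> {0<..<1} - F" using that ab by auto
      then show ?thesis using le_v[of t] by (metis ennreal_less_top infinity_ennreal_def order_le_less_trans)
    qed
    define u where "u t = enn2real (metric_speed \<delta> t)" for t
    have Nu: "N a b = (\<integral>\<^sup>+t. ennreal (u t * indicator {a<..<b} t) \<partial>lborel)"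
      unfolding N_def u_def by (intro nn_integral_cong) (use fin in \<open>auto simp: indicator_def\<close>)
    have mu: "(\<lambda>t. u t * indicator {a<..<b} t) \<in> borel_measurable lborel"
    proof -
      have "(\<lambda>t. enn2real (metric_speed \<delta> t * indicator {a<..<b} t)) \<in> borel_measurable lborel"
        by (rule borel_measurable_enn2real[OF meas]) (use ab in auto)
      moreover have "(\<lambda>t. enn2real (metric_speed \<delta> t * indicator {a<..<b} t)) = (\<lambda>t. u t * indicator {a<..<b} t)"
        by (auto simp: u_def indicator_def)
      ultimately show ?thesis by simp
    qed
    obtain I where I: "N a b = ennreal I" "0 \<le> I" using True by (cases "N a b") auto
    have "((\<lambda>t. u t * indicator {a<..<b} t) has_integral I) UNIV"
      by (rule nn_integral_has_integral) (use mu Nu I in \<open>auto simp: u_def\<close>)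
    then have "((\<lambda>t. if t \<in> {a<..<b} then u t else 0) has_integral I) UNIV"
      by (rule has_integral_cong[THEN iffD1, rotated]) (auto simp: indicator_def)
    then have "(u has_integral I) {a<..<b}" by (simp only: has_integral_restrict_UNIV)
    then have hI: "(u has_integral I) {a..b}" by (simp add: has_integral_Icc_iff_Ioo)
    have "\<delta> a b \<le> integral {a..b} u"
    proof (rule tagged_division_estimate)
      show "u integrable_on {a..b}" using hI by blast
      fix t \<epsilon> :: real assume t: "t \<in> {a..b}" and \<epsilon>: "0 < \<epsilon>"
      show "\<exists>\<eta>>0. \<forall>s\<in>{a..b}. \<bar>s - t\<bar> < \<eta> \<longrightarrow> \<delta> s t \<le> (u t + \<epsilon>) * \<bar>s - t\<bar>"
        using metric_speed_bound[OF fin[OF t] \<epsilon>] refl[of t] t ab unfolding u_def by fastforce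
    qed (use ab in \<open>auto intro!: nonneg refl sym tri\<close>)
    with hI I show ?thesis by (simp add: integral_unique ennreal_leI)
  qed
  have free: "ennreal (\<delta> a b) \<le> N a b" if ab: "0 \<le> a" "a \<le> b" "b \<le> 1" "{a<..<b} \<inter> F = {}" for a b
  proof (cases "a = b")
    case True
    then show ?thesis using refl ab by auto
  next
    case False
    show ?thesis
    proof (rule ennreal_le_epsilon)
      fix e :: real assume e: "0 < e"
      have "\<forall>\<^sub>F s in at a within {0..1}. \<delta> s a < e / 2" "\<forall>\<^sub>F s in at b within {0..1}. \<delta> s b < e / 2"
        using ab e by (intro order_tendstoD(2)[OF cont]; simp)+
      then obtain d1 d2 where d: "0 < d1" "0 < d2"
        "\<And>s. s \<in> {0..1} \<Longrightarrow> s \<noteq> a \<Longrightarrow> \<bar>s - a\<bar> < d1 \<Longrightarrow> \<delta> s a < e / 2"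
        "\<And>s. s \<in> {0..1} \<Longrightarrow> s \<noteq> b \<Longrightarrow> \<bar>s - b\<bar> < d2 \<Longrightarrow> \<delta> s b < e / 2"
        unfolding eventually_at dist_real_def by metis
      define h where "h = min (min d1 d2) (b - a) / 2"
      have h: "0 < h" "h < d1" "h < d2" "2 * h \<le> b - a"
        using d(1,2) False ab by (auto simp: h_def)
      have "\<delta> a b \<le> \<delta> a (a + h) + \<delta> (a + h) b" using h ab by (intro tri) auto
      also have "\<delta> (a + h) b \<le> \<delta> (a + h) (b - h) + \<delta> (b - h) b" using h ab by (intro tri) auto
      also have "\<delta> a (a + h) < e / 2" using d(3)[of "a + h"] sym[of a "a + h"] h ab by auto
      also have "\<delta> (b - h) b < e / 2" using d(4)[of "b - h"] h ab by auto
      finally have "\<delta> a b \<le> \<delta> (a + h) (b - h) + e" by simp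
      then have "ennreal (\<delta> a b) \<le> ennreal (\<delta> (a + h) (b - h)) + ennreal e"
        using nonneg[of "a + h" "b - h"] h ab e
          ennreal_leI[of "\<delta> a b" "\<delta> (a + h) (b - h) + e"] by (simp add: ennreal_plus)
      also have "ennreal (\<delta> (a + h) (b - h)) \<le> N (a + h) (b - h)"
      proof (rule compact)
        have "{a + h..b - h} \<subseteq> {a<..<b}" using h by auto
        then show "{a + h..b - h} \<inter> F = {}" using ab(4) by blast
      qed (use h ab in auto)
      also have "N (a + h) (b - h) \<le> N a b"
        unfolding N_def using h by (intro nn_integral_mono) (auto simp: indicator_def)
      finally show "ennreal (\<delta> a b) \<le> N a b + ennreal e" by (simp add: add_right_mono)
    qed
  qed
  have main: "ennreal (\<delta> a b) \<le> N a b" if "0 \<le> a" "a \<le> b" "b \<le> 1" for a b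
    using that
  proof (induction "card ({a<..<b} \<inter> F)" arbitrary: a b rule: less_induct)
    case less
    show ?case
    proof (cases "{a<..<b} \<inter> F = {}")
      case True
      then show ?thesis using free less.prems by blast
    next
      case False
      then obtain m where m: "m \<in> F" "a < m" "m < b" by auto
      have "card ({a<..<m} \<inter> F) < card ({a<..<b} \<inter> F)" "card ({m<..<b} \<inter> F) < card ({a<..<b} \<inter> F)"
        using m F by (auto intro!: psubset_card_mono)
      then have IH: "ennreal (\<delta> a m) \<le> N a m" "ennreal (\<delta> m b) \<le> N m b"
        using less.hyps less.prems m by auto
      have "\<delta> a b \<le> \<delta> a m + \<delta> m b" using m less.prems by (intro tri) auto
      then have "ennreal (\<delta> a b) \<le> ennreal (\<delta> a m) + ennreal (\<delta> m b)"
        using nonneg[of a m] nonneg[of m b] m less.prems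
          ennreal_leI[of "\<delta> a b" "\<delta> a m + \<delta> m b"] by (simp add: ennreal_plus)
      also have "\<dots> \<le> N a m + N m b" using IH by (rule add_mono)
      also have "\<dots> = (\<integral>\<^sup>+t. metric_speed \<delta> t * indicator {a<..<m} t + metric_speed \<delta> t * indicator {m<..<b} t \<partial>lborel)"
        unfolding N_def using m less.prems by (intro nn_integral_add[symmetric] meas) auto
      also have "\<dots> \<le> N a b"
        unfolding N_def using m by (intro nn_integral_mono) (auto simp: indicator_def)
      finally show ?thesis .
    qed
  qed
  have "ennreal (\<delta> 0 1) \<le> N 0 1" using main by simp
  also have "\<dots> \<le> (\<integral>\<^sup>+t\<in>{0<..<1}. ennreal (v t) \<partial>lborel)"
    unfolding N_def
  proof (rule nn_integral_mono_AE)
    have "AE t in lborel. t \<notin> F"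
      using F finite_imp_null_set_lborel by (intro AE_not_in)
    then show "AE t in lborel. metric_speed \<delta> t * indicator {0<..<1} t \<le> ennreal (v t) * indicator {0<..<1} t"
      by eventually_elim (use le_v in \<open>auto simp: indicator_def\<close>)
  qed
  finally show ?thesis .
qed

section \<open>Submersions to first order\<close>

text \<open>Let \<open>R\<close> be a right inverse of the derivative. To reach the value \<open>f y0 + w\<close>
from \<open>y0 + z\<close>, the correction is sought in the form \<open>R w'\<close>. Up to a small remainder the equation
says \<open>w' = w - f' z\<close>, so \<open>w'\<close> is a fixed point of a map that takes a small ball around
\<open>w - f' z\<close> into itself. Brouwer's theorem provides it from differentiability at the single point \<open>y0\<close>.\<close>

lemma perturbed_submersion_solve:
  fixes f :: "'a::euclidean_space \<Rightarrow> 'b::euclidean_space"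
  assumes S: "subspace S" and T: "subspace T" and r: "0 < r"
    and cont: "continuous_on (ball y0 r) f" and der: "(f has_derivative f') (at y0)"
    and im: "\<And>y. y \<in> ball y0 r \<Longrightarrow> y - y0 \<in> T \<Longrightarrow> f y - f y0 \<in> S"
    and sur: "f' ` T = S"
  obtains C where "0 < C" "\<forall>\<eta>>0. \<exists>\<delta>>0. \<forall>z\<in>T. \<forall>w\<in>S. norm z < \<delta> \<longrightarrow> norm w < \<delta> \<longrightarrow>
    (\<exists>y\<in>ball y0 r. y - y0 \<in> T \<and> f y = f y0 + w \<and>
       norm (y - y0 - z) \<le> C * norm (w - f' z) + \<eta> * (norm z + norm w))"
proof -
  have lin: "linear f'" using der has_derivative_linear by blast
  obtain R where R: "range R \<subseteq> T" "linear R" "\<And>w. w \<in> S \<Longrightarrow> f' (R w) = w"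
    using linear_exists_right_inverse_on[OF lin T] unfolding sur by blast
  obtain A where A: "0 < A" "\<And>z. norm (f' z) \<le> A * norm z" using linear_bounded_pos[OF lin] by blast
  obtain B where B: "0 < B" "\<And>z. norm (R z) \<le> B * norm z" using linear_bounded_pos[OF R(2)] by blast
  show thesis
  proof (rule that[OF B(1)], intro allI impI)
    fix \<eta>0 :: real assume "0 < \<eta>0"
    define \<eta> where "\<eta> = \<eta>0 / B"
    have \<eta>: "0 < \<eta>" using \<open>0 < \<eta>0\<close> B by (simp add: \<eta>_def)
    \<comment> \<open>A point \<open>w'\<close> of the ball around \<open>w - f' z\<close> of radius \<open>\<eta> (norm z + norm w)\<close> leads to a point at distance at most \<open>K (norm z + norm w)\<close> from \<open>y0\<close>.\<close>
    define K where "K = 1 + B * (1 + A + \<eta>)"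
    have K: "0 < K" using A B \<eta> by (simp add: K_def add_pos_pos)
    have "0 < \<eta> / K" using \<eta> K by simp
    then obtain d where d: "0 < d" "\<And>y. norm (y - y0) < d \<Longrightarrow>
        norm (f y - f y0 - f' (y - y0)) \<le> \<eta> / K * norm (y - y0)"
      using der unfolding has_derivative_at_alt by meson
    define \<delta> where "\<delta> = min d r / (2 * K)"
    have \<delta>: "0 < \<delta>" using d r K by (simp add: \<delta>_def)
    show "\<exists>\<delta>>0. \<forall>z\<in>T. \<forall>w\<in>S. norm z < \<delta> \<longrightarrow> norm w < \<delta> \<longrightarrow>
    (\<exists>y\<in>ball y0 r. y - y0 \<in> T \<and> f y = f y0 + w \<and>
       norm (y - y0 - z) \<le> B * norm (w - f' z) + \<eta>0 * (norm z + norm w))"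
    proof (intro exI[of _ \<delta>] conjI \<delta> ballI impI)
      fix z w assume z: "z \<in> T" "norm z < \<delta>" and w: "w \<in> S" "norm w < \<delta>"
      define m where "m = norm z + norm w"
      have m: "0 \<le> m" "K * m < min d r"
      proof -
        have "m < 2 * \<delta>" using z w by (simp add: m_def)
        then have "K * m < K * (2 * \<delta>)" using K by simp
        also have "\<dots> = min d r" using K by (simp add: \<delta>_def)
        finally show "K * m < min d r" .
      qed (simp add: m_def)
      define w0 where "w0 = w - f' z"
      have w0S: "w0 \<in> S" unfolding w0_def by (rule subspace_diff[OF S w(1)]) (use z sur in blast)
      have w0n: "norm w0 \<le> (1 + A) * m"
      proof -
        have "norm w0 \<le> norm w + A * norm z" unfolding w0_def using norm_triangle_ineq4[of w "f' z"] A(2)[of z] by linarith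
        also have "\<dots> \<le> (1 + A) * m" using A(1) by (simp add: m_def algebra_simps)
        finally show ?thesis .
      qed
      define Q where "Q = cball w0 (\<eta> * m) \<inter> S"
      \<comment> \<open>Brouwer is applied to \<open>g\<close> below on \<open>Q\<close>, a ball in \<open>S\<close>; a fixed point of \<open>g\<close> solves the equation.\<close>
      define P where "P w' = y0 + z + R w'" for w'
      have inQ: "w' \<in> S" "norm (w' - w0) \<le> \<eta> * m" "P w' - y0 \<in> T" "norm (P w' - y0) \<le> K * m"
        if "w' \<in> Q" for w'
      proof -
        show S': "w' \<in> S" and n: "norm (w' - w0) \<le> \<eta> * m"
          using that by (auto simp: Q_def dist_norm norm_minus_commute)
        have "z + R w' \<in> T" by (rule subspace_add[OF T z(1)]) (use R(1) in blast)
        then show "P w' - y0 \<in> T" by (simp add: P_def)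
        have "norm w' \<le> norm (w' - w0) + norm w0" using norm_triangle_ineq[of "w' - w0" w0] by simp
        also have "\<dots> \<le> (1 + A + \<eta>) * m" using n w0n by (simp add: algebra_simps)
        finally have n': "norm w' \<le> (1 + A + \<eta>) * m" .
        have "norm (P w' - y0) \<le> norm z + B * norm w'"
          unfolding P_def using norm_triangle_ineq[of z "R w'"] B(2)[of w'] by simp
        also have "\<dots> \<le> m + B * ((1 + A + \<eta>) * m)"
          using n' B(1) by (intro add_mono mult_left_mono) (auto simp: m_def)
        also have "\<dots> = K * m" by (simp add: K_def algebra_simps)
        finally show "norm (P w' - y0) \<le> K * m" .
      qed
      have Pb: "P w' \<in> ball y0 r" if "w' \<in> Q" for w'
        using inQ(4)[OF that] m by (simp add: dist_norm norm_minus_commute)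
      define g where "g w' = w' - (f (P w') - f y0 - w)" for w'
      have rem: "norm (g w' - w0) \<le> \<eta> * m" if "w' \<in> Q" for w'
      proof -
        have "f' (P w' - y0) = f' z + w'"
          using R(3) inQ(1)[OF that] lin by (simp add: P_def linear_add add.assoc)
        then have "g w' - w0 = - (f (P w') - f y0 - f' (P w' - y0))"
          by (simp add: g_def w0_def)
        then have "norm (g w' - w0) = norm (f (P w') - f y0 - f' (P w' - y0))" by (metis norm_minus_cancel)
        also have "\<dots> \<le> \<eta> / K * norm (P w' - y0)" by (rule d(2)) (use inQ(4)[OF that] m in linarith)
        also have "\<dots> \<le> \<eta> / K * (K * m)" using inQ(4)[OF that] \<eta> K by (intro mult_left_mono) auto
        also have "\<dots> = \<eta> * m" using K by simp
        finally show ?thesis .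
      qed
      have gS: "g w' \<in> S" if "w' \<in> Q" for w'
        unfolding g_def using im[OF Pb[OF that] inQ(3)[OF that]] inQ(1)[OF that]
        by (rule subspace_diff[OF S _ subspace_diff[OF S _ w(1)], rotated])
      have "continuous_on Q R" using R(2) by (simp add: linear_continuous_on linear_conv_bounded_linear)
      then have "continuous_on Q P" unfolding P_def by (intro continuous_on_add continuous_on_const)
      then have "continuous_on Q (\<lambda>w'. f (P w'))"
        by (rule continuous_on_compose2[OF cont]) (use Pb in auto)
      then have cg: "continuous_on Q g"
        unfolding g_def by (intro continuous_on_diff continuous_on_id continuous_on_const)
      have gQ: "g \<in> Q \<rightarrow> Q"
        using rem gS by (auto simp: Q_def dist_norm norm_minus_commute)
      have cc: "compact Q" "convex Q" unfolding Q_def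
        using compact_Int_closed[OF compact_cball closed_subspace[OF S]]
          convex_Int[OF convex_cball subspace_imp_convex[OF S]] by auto
      have "w0 \<in> Q" using w0S \<eta> m by (simp add: Q_def)
      then have ne: "Q \<noteq> {}" by auto
      obtain w' where w': "w' \<in> Q" "g w' = w'"
        by (rule brouwer[OF cc ne cg gQ])
      show "\<exists>y\<in>ball y0 r. y - y0 \<in> T \<and> f y = f y0 + w \<and>
         norm (y - y0 - z) \<le> B * norm (w - f' z) + \<eta>0 * (norm z + norm w)"
      proof (intro bexI[of _ "P w'"] conjI Pb inQ w')
        show "f (P w') = f y0 + w" using w'(2) by (simp add: g_def algebra_simps)
        have "norm w' \<le> norm (w' - w0) + norm w0" using norm_triangle_ineq[of "w' - w0" w0] by simp
        then have "norm w' \<le> norm (w - f' z) + \<eta> * m" using inQ(2)[OF w'(1)] by (simp add: w0_def)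
        then have "B * norm w' \<le> B * (norm (w - f' z) + \<eta> * m)" using B by simp
        also have "\<dots> = B * norm (w - f' z) + \<eta>0 * m" using B by (simp add: \<eta>_def algebra_simps)
        finally show "norm (P w' - y0 - z) \<le> B * norm (w - f' z) + \<eta>0 * (norm z + norm w)"
          using B(2)[of w'] by (simp add: P_def m_def)
      qed
    qed
  qed
qed

text \<open>The inverse of a submanifold chart, together with the two mutually
inverse derivatives \<open>P\<close> of the chart and \<open>Q\<close> of the parametrisation.\<close>

lemma submanifold_parametrization:
  fixes M :: "'a::euclidean_space set"
  assumes "smooth_submanifold M" "x \<in> M"
  obtains V T :: "'a set" and \<psi> y0 P Q where "open V" "subspace T" "y0 \<in> V" "y0 \<in> T" "\<psi> y0 = x"
    "\<forall>y\<in>V. \<psi> differentiable (at y)" "\<forall>y\<in>V \<inter> T. \<psi> y \<in> M"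
    "(\<psi> has_derivative Q) (at y0)" "linear P" "\<forall>z. P (Q z) = z" "\<forall>u. Q (P u) = u"
    "tangent_space M x = Q ` T"
proof -
  obtain d where "\<forall>x\<in>M. \<exists>U V S \<phi> \<psi>. open U \<and> x \<in> U \<and> open (V :: 'a set) \<and> subspace S \<and> dim S = d \<and>
     homeomorphism U V \<phi> \<psi> \<and> smooth_on U \<phi> \<and> smooth_on V \<psi> \<and> \<phi> ` (U \<inter> M) = V \<inter> S"
    using assms(1) unfolding smooth_submanifold_def ..
  from this[rule_format, OF assms(2)] obtain U V T \<phi> \<psi>
    where *: "open U" "x \<in> U" "open (V :: 'a set)" "subspace T" "homeomorphism U V \<phi> \<psi>"
      "smooth_on U \<phi>" "smooth_on V \<psi>" "\<phi> ` (U \<inter> M) = V \<inter> T"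
    by (elim exE conjE)
  define y0 where "y0 = \<phi> x"
  have y0: "y0 \<in> V" "y0 \<in> T" using * assms(2) by (auto simp: y0_def)
  have inv: "\<psi> (\<phi> u) = u" if "u \<in> U" for u using *(5) that by (simp add: homeomorphism_def)
  have inv': "\<phi> (\<psi> u) = u" if "u \<in> V" for u using *(5) that by (simp add: homeomorphism_def)
  obtain P where P: "(\<phi> has_derivative P) (at x)"
    using smooth_on_open_differentiable[OF *(6,1,2)] by (auto simp: differentiable_def)
  obtain Q where Q: "(\<psi> has_derivative Q) (at y0)"
    using smooth_on_open_differentiable[OF *(7,3) y0(1)] by (auto simp: differentiable_def)
  have x: "\<psi> y0 = x" using inv *(2) by (simp add: y0_def)
  have "((\<lambda>u. u) has_derivative (\<lambda>u. u)) (at x)" by simp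
  moreover have "((\<psi> \<circ> \<phi>) has_derivative (Q \<circ> P)) (at x)"
    using diff_chain_at[OF P] Q by (simp add: y0_def)
  then have "((\<lambda>u. u) has_derivative (Q \<circ> P)) (at x)"
    by (rule has_derivative_transform_within_open[OF _ *(1,2)]) (simp add: inv)
  ultimately have "Q \<circ> P = (\<lambda>u. u)" using has_derivative_unique by blast
  then have QP: "Q (P u) = u" for u by (metis comp_apply)
  have "((\<phi> \<circ> \<psi>) has_derivative (P \<circ> Q)) (at y0)"
    using diff_chain_at[OF Q] P by (simp add: x)
  then have "((\<lambda>u. u) has_derivative (P \<circ> Q)) (at y0)"
    by (rule has_derivative_transform_within_open[OF _ *(3) y0(1)]) (simp add: inv')
  moreover have "((\<lambda>u. u) has_derivative (\<lambda>u. u)) (at y0)" by simp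
  ultimately have "P \<circ> Q = (\<lambda>u. u)" using has_derivative_unique by blast
  then have PQ: "P (Q u) = u" for u by (metis comp_apply)
  have mem: "\<psi> y \<in> M" if "y \<in> V \<inter> T" for y using that *(8) inv by (metis (no_types, lifting) Int_iff imageE)
  have "tangent_space M x = Q ` T"
  proof (intro equalityI subsetI)
    fix u assume "u \<in> tangent_space M x"
    then obtain c where c: "c 0 = x" "range c \<subseteq> M" "(c has_vector_derivative u) (at 0)"
      by (auto simp: tangent_space_def)
    have d: "((\<lambda>s. \<phi> (c s)) has_vector_derivative P u) (at 0)"
      by (rule has_vector_derivative_along_curve[OF _ c(3)]) (simp add: c P)
    have "(c \<longlongrightarrow> x) (at 0)" using has_vector_derivative_continuous[OF c(3)] c(1) by (simp add: continuous_at)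
    then have "\<forall>\<^sub>F s in at 0. c s \<in> U" using *(1,2) topological_tendstoD by blast
    then have "\<forall>\<^sub>F s in at 0. (\<phi> (c s) - y0) /\<^sub>R (s - 0) \<in> T"
    proof (eventually_elim)
      case (elim s)
      then have "\<phi> (c s) \<in> T" using c(2) *(8) by blast
      then show ?case using y0 *(4) by (intro subspace_scale subspace_diff)
    qed
    moreover have "((\<lambda>s. (\<phi> (c s) - y0) /\<^sub>R (s - 0)) \<longlongrightarrow> P u) (at 0)"
      using has_vector_derivative_quotient_limit[OF d] c by (simp add: y0_def)
    ultimately have "P u \<in> T"
      by (rule Lim_in_closed_set[OF closed_subspace[OF *(4)] _ trivial_limit_at])
    then show "u \<in> Q ` T" using QP by (metis imageI)
  next
    fix u assume "u \<in> Q ` T"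
    then obtain z where z: "z \<in> T" "u = Q z" by auto
    define c where "c s = \<psi> (y0 + s *\<^sub>R z)" for s
    have "((\<lambda>s. y0 + s *\<^sub>R z) has_vector_derivative z) (at 0)"
      by (auto intro!: derivative_eq_intros simp: has_vector_derivative_def)
    then have "(c has_vector_derivative u) (at 0)"
      unfolding c_def z(2) by (rule has_vector_derivative_along_curve[rotated]) (simp add: Q)
    moreover have "((\<lambda>s. y0 + s *\<^sub>R z) \<longlongrightarrow> y0) (at 0)" by (auto intro!: tendsto_eq_intros)
    then have "\<forall>\<^sub>F s in at 0. y0 + s *\<^sub>R z \<in> V" using *(3) y0 topological_tendstoD by blast
    then have "\<forall>\<^sub>F s in at 0. c s \<in> M"
      by eventually_elim (use z y0 *(4) in \<open>auto simp: c_def intro!: mem subspace_add subspace_scale\<close>)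
    ultimately show "u \<in> tangent_space M x"
      by (intro tangent_spaceI[of c]) (auto simp: c_def x assms(2))
  qed
  moreover have "linear P" using P has_derivative_linear by blast
  ultimately show thesis
    using that[OF *(3,4) y0 x _ _ Q] mem smooth_on_open_differentiable[OF *(7,3)] PQ QP by blast
qed

lemma subspace_tangent_space:
  fixes M :: "'a::euclidean_space set"
  assumes "smooth_submanifold M" "x \<in> M"
  shows "subspace (tangent_space M x)"
proof -
  obtain T :: "'a set" and \<psi> y0 Q
    where "subspace T" "(\<psi> has_derivative Q) (at y0)" "tangent_space M x = Q ` T"
    by (rule submanifold_parametrization[OF assms]) (rule that)
  then show ?thesis
    using has_derivative_linear by (metis linear_subspace_image)
qed

text \<open>A quantitative form of the submersion theorem: near \<open>x\<close>, the value \<open>q\<close> is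
attained close to \<open>x + v\<close>, with an error controlled by the failure of \<open>v\<close> to map to \<open>q - g x\<close>
and by a small multiple of the data. With \<open>q\<close> on a curve and \<open>v\<close> a lift of its displacement this
lifts the curve to first order; with \<open>v = 0\<close> it says that \<open>g\<close> is open at \<open>x\<close>.\<close>

lemma submersion_near:
  fixes M :: "'a::euclidean_space set" and g :: "'a \<Rightarrow> 'b::euclidean_space"
  assumes M: "smooth_submanifold M" and W: "openin (top_of_set M) W" and x: "x \<in> W"
    and g: "smooth_on W g" and S: "subspace S" and im: "g ` W \<subseteq> S"
    and sur: "differential W g x ` tangent_space M x = S"
  obtains C where "0 < C" "\<forall>\<eta>>0. \<exists>\<delta>>0. \<forall>v\<in>tangent_space M x. \<forall>q\<in>S.
    norm v < \<delta> \<longrightarrow> norm (q - g x) < \<delta> \<longrightarrow>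
    (\<exists>y\<in>W. g y = q \<and>
       norm (y - x - v) \<le> C * norm (q - g x - differential W g x v) + \<eta> * (norm v + norm (q - g x)))"
proof -
  obtain W' where W': "open W'" "W = M \<inter> W'" using W by (metis openin_open)
  have xM: "x \<in> M" using x W' by simp
  obtain V T :: "'a set" and \<psi> y0 P Q where par: "open V" "subspace T" "y0 \<in> V" "y0 \<in> T" "\<psi> y0 = x"
    and \<psi>d: "\<forall>y\<in>V. \<psi> differentiable (at y)" and \<psi>M: "\<forall>y\<in>V \<inter> T. \<psi> y \<in> M"
    and Q: "(\<psi> has_derivative Q) (at y0)" and P: "linear P" and PQ: "\<forall>z. P (Q z) = z" "\<forall>u. Q (P u) = u"
    and tan: "tangent_space M x = Q ` T"
    by (rule submanifold_parametrization[OF M xM])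
  obtain U G where U: "open U" "x \<in> U" "\<And>y. y \<in> U \<Longrightarrow> G differentiable (at y)"
    "\<And>y. y \<in> W \<inter> U \<Longrightarrow> G y = g y"
    using smooth_on_extension[OF g x] by blast
  obtain G' where G': "(G has_derivative G') (at x)" using U(2,3) by (auto simp: differentiable_def)
  have \<psi>c: "continuous_on V \<psi>"
    using \<psi>d by (simp add: continuous_at_imp_continuous_on differentiable_imp_continuous_within)
  have "open (\<psi> -` (U \<inter> W') \<inter> V)"
    using continuous_on_open_vimage[OF par(1)] \<psi>c U(1) W'(1) by blast
  moreover have "y0 \<in> \<psi> -` (U \<inter> W') \<inter> V" using par U(2) x W' by auto
  ultimately obtain r where r: "0 < r" "ball y0 r \<subseteq> \<psi> -` (U \<inter> W') \<inter> V"
    using openE by blast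
  define f where "f y = G (\<psi> y)" for y
  define f' where "f' z = G' (Q z)" for z
  have inW: "\<psi> y \<in> W" "f y = g (\<psi> y)" if "y \<in> ball y0 r" "y - y0 \<in> T" for y
  proof -
    have "y \<in> T" using subspace_add[OF par(2) that(2) par(4)] by simp
    with that(1) r(2) \<psi>M show "\<psi> y \<in> W" by (auto simp: W'(2))
    with that(1) r(2) U(4) show "f y = g (\<psi> y)" by (auto simp: f_def)
  qed
  have G'u: "G' u = differential W g x u" if u: "u \<in> tangent_space M x" for u
  proof -
    obtain c where c: "c 0 = x" "range c \<subseteq> M" "(c has_vector_derivative u) (at 0)"
      using u unfolding tangent_space_def by blast
    have "(c \<longlongrightarrow> x) (at 0)" using has_vector_derivative_continuous[OF c(3)] c(1) by (simp add: continuous_at)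
    then have "\<forall>\<^sub>F s in at 0. c s \<in> W' \<inter> U"
      by (rule topological_tendstoD) (use W' U x in auto)
    then have ev: "\<forall>\<^sub>F s in at 0. c s \<in> W \<and> G (c s) = g (c s)"
      by eventually_elim (use c(2) W'(2) U(4) in auto)
    have "((\<lambda>s. g (c s)) has_vector_derivative differential W g x u) (at 0)"
      by (rule differential_along_curve[OF g c(1) x _ c(3)]) (use ev in \<open>auto elim: eventually_mono\<close>)
    moreover have "((\<lambda>s. G (c s)) has_vector_derivative G' u) (at 0)"
      by (rule has_vector_derivative_along_curve[OF _ c(3)]) (simp add: c(1) G')
    moreover have "\<forall>\<^sub>F s in nhds 0. G (c s) = g (c s)"
      using ev U(2,4) x c(1) by (auto simp: eventually_nhds_conv_at elim: eventually_mono)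
    then have "((\<lambda>s. G (c s)) has_vector_derivative G' u) (at 0) \<longleftrightarrow>
      ((\<lambda>s. g (c s)) has_vector_derivative G' u) (at 0)"
      using has_vector_derivative_cong_ev[where x=0 and S=UNIV and f="\<lambda>s. G (c s)" and g="\<lambda>s. g (c s)"]
        U(2,4) x c(1) by simp
    ultimately show ?thesis using vector_derivative_unique_at by blast
  qed
  have lQ: "linear Q" using Q has_derivative_linear by blast
  have fT: "f' ` T = S"
    using sur G'u by (simp add: f'_def tan image_image)
  have fd: "(f has_derivative f') (at y0)"
    using diff_chain_at[OF Q, of G G'] G' par(5) unfolding f_def[abs_def] f'_def[abs_def]
    by (simp add: o_def)
  have fc: "continuous_on (ball y0 r) f"
    unfolding f_def
  proof (rule continuous_on_compose2[of U])
    show "continuous_on U G" using U(3)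
      by (simp add: continuous_at_imp_continuous_on differentiable_imp_continuous_within)
    show "continuous_on (ball y0 r) \<psi>" using \<psi>c r(2) continuous_on_subset by blast
  qed (use r in auto)
  have f0: "f y0 = g x" using inW(2)[of y0] r(1) subspace_0[OF par(2)] par(5) by simp
  have fS: "f y - f y0 \<in> S" if "y \<in> ball y0 r" "y - y0 \<in> T" for y
    using inW[OF that] im x unfolding f0 by (intro subspace_diff[OF S]) auto
  obtain C where C: "0 < C" "\<forall>\<eta>>0. \<exists>\<delta>>0. \<forall>z\<in>T. \<forall>w\<in>S. norm z < \<delta> \<longrightarrow> norm w < \<delta> \<longrightarrow>
    (\<exists>y\<in>ball y0 r. y - y0 \<in> T \<and> f y = f y0 + w \<and>
       norm (y - y0 - z) \<le> C * norm (w - f' z) + \<eta> * (norm z + norm w))"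
    by (rule perturbed_submersion_solve[OF S par(2) r(1) fc fd fS fT])
  obtain q where q: "0 < q" "\<And>z. norm (Q z) \<le> q * norm z" using linear_bounded_pos[OF lQ] by blast
  obtain p where p: "0 < p" "\<And>z. norm (P z) \<le> p * norm z" using linear_bounded_pos[OF P] by blast
  have "linear f'" using fd has_derivative_linear by blast
  then obtain a where a: "0 < a" "\<And>z. norm (f' z) \<le> a * norm z" using linear_bounded_pos by blast
  \<comment> \<open>For \<open>\<eta>1 \<le> 1\<close> the displacement from \<open>z\<close> is at most \<open>D (norm z + norm w)\<close>; \<open>\<kappa>\<close> and \<open>\<eta>1\<close> below each account for half of the error \<open>\<eta>\<close>.\<close>
  define D where "D = C * (1 + a) + 1"
  have D: "0 < D" using C(1) a(1) by (simp add: D_def add_pos_pos)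
  show thesis
  proof (rule that[of "q * C"], goal_cases)
    show "0 < q * C" using q C by simp
  next
    case 2
    show ?case
    proof (intro allI impI)
      fix \<eta> :: real assume "0 < \<eta>"
      define \<kappa> where "\<kappa> = \<eta> / (2 * (1 + D) * (1 + p))"
      define \<eta>1 where "\<eta>1 = min 1 (\<eta> / (2 * q * (1 + p)))"
      have \<kappa>: "0 < \<kappa>" and \<eta>1: "0 < \<eta>1" using \<open>0 < \<eta>\<close> D p(1) q(1) by (auto simp: \<kappa>_def \<eta>1_def)
      obtain d where d: "0 < d" "\<And>y. norm (y - y0) < d \<Longrightarrow>
          norm (\<psi> y - \<psi> y0 - Q (y - y0)) \<le> \<kappa> * norm (y - y0)"
        using Q \<kappa> unfolding has_derivative_at_alt by meson
      obtain \<delta>1 where \<delta>1: "0 < \<delta>1" "\<And>z w. z \<in> T \<Longrightarrow> w \<in> S \<Longrightarrow> norm z < \<delta>1 \<Longrightarrow> norm w < \<delta>1 \<Longrightarrow>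
        \<exists>y\<in>ball y0 r. y - y0 \<in> T \<and> f y = f y0 + w \<and>
         norm (y - y0 - z) \<le> C * norm (w - f' z) + \<eta>1 * (norm z + norm w)"
        using C(2)[rule_format, OF \<eta>1] by meson
      define \<delta> where "\<delta> = min (\<delta>1 / (1 + p)) (d / (2 * (1 + D) * (1 + p)))"
      have \<delta>: "0 < \<delta>" using \<delta>1(1) d(1) p(1) D by (simp add: \<delta>_def)
      show "\<exists>\<delta>>0. \<forall>v\<in>tangent_space M x. \<forall>q'\<in>S. norm v < \<delta> \<longrightarrow> norm (q' - g x) < \<delta> \<longrightarrow>
        (\<exists>y\<in>W. g y = q' \<and>
         norm (y - x - v) \<le> q * C * norm (q' - g x - differential W g x v) + \<eta> * (norm v + norm (q' - g x)))"
      proof (intro exI[of _ \<delta>] conjI \<delta> ballI impI)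
        fix v q' assume v: "v \<in> tangent_space M x" "norm v < \<delta>" and q': "q' \<in> S" "norm (q' - g x) < \<delta>"
        define z where "z = P v"
        define w where "w = q' - g x"
        define m where "m = norm v + norm w"
        have m0: "0 \<le> m" by (simp add: m_def)
        have zT: "z \<in> T" using v(1) PQ(1) by (auto simp: z_def tan)
        have Qz: "Q z = v" by (simp add: z_def PQ)
        have wS: "w \<in> S" unfolding w_def by (rule subspace_diff[OF S q'(1)]) (use im x in blast)
        have zn: "norm z \<le> p * norm v" unfolding z_def by (rule p(2))
        have zw: "norm z + norm w \<le> (1 + p) * m"
        proof -
          have "norm z + norm w \<le> p * norm v + norm w" using zn by simp
          also have "\<dots> \<le> (1 + p) * m" using p(1) by (simp add: m_def algebra_simps)
          finally show ?thesis .
        qed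
        have le1: "(1 + p) * \<delta> \<le> \<delta>1"
        proof -
          have "\<delta> \<le> \<delta>1 / (1 + p)" by (simp add: \<delta>_def)
          then show ?thesis using p(1) by (simp add: pos_le_divide_eq mult_ac)
        qed
        have le2: "(1 + D) * ((1 + p) * (2 * \<delta>)) \<le> d"
        proof -
          have "\<delta> \<le> d / (2 * (1 + D) * (1 + p))" by (simp add: \<delta>_def)
          then have "\<delta> * (2 * (1 + D) * (1 + p)) \<le> d" using p(1) D by (subst (asm) pos_le_divide_eq) auto
          then show ?thesis by (simp only: mult_ac)
        qed
        have "norm z < \<delta>1"
        proof -
          have "norm z \<le> p * norm v" by (rule zn)
          also have "\<dots> \<le> (1 + p) * norm v" by (simp add: algebra_simps)
          also have "\<dots> < (1 + p) * \<delta>" using v(2) p(1) by simp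
          finally show ?thesis using le1 by simp
        qed
        moreover have "norm w < \<delta>1"
        proof -
          have "norm w < \<delta>" using q'(2) by (simp add: w_def)
          also have "\<delta> \<le> (1 + p) * \<delta>" using p(1) \<delta> by (simp add: algebra_simps)
          finally show ?thesis using le1 by simp
        qed
        ultimately obtain y where y: "y \<in> ball y0 r" "y - y0 \<in> T" "f y = f y0 + w"
          "norm (y - y0 - z) \<le> C * norm (w - f' z) + \<eta>1 * (norm z + norm w)"
          using \<delta>1(2)[OF zT wS] by blast
        define \<zeta> where "\<zeta> = y - y0 - z"
        have f'z: "f' z = differential W g x v" using G'u[OF v(1)] by (simp add: f'_def Qz)
        have yz: "norm (y - y0) \<le> (1 + D) * ((1 + p) * m)"
        proof -
          have "norm (w - f' z) \<le> norm w + a * norm z"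
            using norm_triangle_ineq4[of w "f' z"] a(2)[of z] by linarith
          also have "\<dots> \<le> (1 + a) * (norm z + norm w)" using a(1) by (simp add: algebra_simps)
          finally have "C * norm (w - f' z) \<le> C * ((1 + a) * (norm z + norm w))" using C(1) by simp
          moreover have "\<eta>1 * (norm z + norm w) \<le> 1 * (norm z + norm w)"
            by (rule mult_right_mono) (auto simp: \<eta>1_def)
          ultimately have "norm \<zeta> \<le> D * (norm z + norm w)"
            using y(4) by (simp add: \<zeta>_def D_def algebra_simps)
          moreover have "norm (y - y0) \<le> norm z + norm \<zeta>"
            using norm_triangle_ineq[of z \<zeta>] by (simp add: \<zeta>_def)
          ultimately have "norm (y - y0) \<le> (1 + D) * (norm z + norm w)"
            using norm_ge_zero[of w] unfolding distrib_right mult_1 by linarith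
          also have "\<dots> \<le> (1 + D) * ((1 + p) * m)" using zw D by (intro mult_left_mono) auto
          finally show ?thesis .
        qed
        have yd: "norm (y - y0) < d"
        proof -
          have "m < 2 * \<delta>" using v(2) q'(2) by (simp add: m_def w_def)
          then have "(1 + D) * ((1 + p) * m) < (1 + D) * ((1 + p) * (2 * \<delta>))"
            using D p(1) by (intro mult_strict_left_mono) auto
          with yz le2 show ?thesis by linarith
        qed
        have "Q (y - y0) = v + Q \<zeta>"
        proof -
          have "y - y0 = z + \<zeta>" by (simp add: \<zeta>_def)
          then show ?thesis using Qz linear_add[OF lQ] by simp
        qed
        then have "\<psi> y - x - v = (\<psi> y - \<psi> y0 - Q (y - y0)) + Q \<zeta>" using par(5) by simp
        then have "norm (\<psi> y - x - v) \<le> norm (\<psi> y - \<psi> y0 - Q (y - y0)) + norm (Q \<zeta>)"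
          by (metis norm_triangle_ineq)
        also have "\<dots> \<le> \<kappa> * ((1 + D) * ((1 + p) * m)) + q * norm \<zeta>"
          using d(2)[OF yd] mult_left_mono[OF yz, of \<kappa>] \<kappa> q(2)[of \<zeta>] by linarith
        also have "\<kappa> * ((1 + D) * ((1 + p) * m)) = \<eta> / 2 * m"
        proof -
          have "0 < 2 * (1 + D) * (1 + p)" using D p(1) by simp
          then have "\<kappa> * (2 * (1 + D) * (1 + p)) = \<eta>"
            unfolding \<kappa>_def by (metis less_irrefl nonzero_divide_eq_eq)
          then show ?thesis by (metis (no_types, lifting) mult.assoc mult.commute nonzero_mult_div_cancel_left times_divide_eq_right zero_neq_numeral)
        qed
        also have "q * norm \<zeta> \<le> q * (C * norm (w - f' z) + \<eta>1 * (norm z + norm w))"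
          using y(4) q(1) by (simp add: \<zeta>_def)
        also have "\<eta>1 * (norm z + norm w) \<le> \<eta> / (2 * q * (1 + p)) * ((1 + p) * m)"
          using zw \<eta>1 by (intro mult_mono) (auto simp: \<eta>1_def)
        also have "\<eta> / (2 * q * (1 + p)) * ((1 + p) * m) = \<eta> / (2 * q) * m"
          using p(1) by simp
        finally have "norm (\<psi> y - x - v) \<le> \<eta> / 2 * m + q * (C * norm (w - f' z) + \<eta> / (2 * q) * m)"
          using q(1) by simp
        also have "\<dots> = q * C * norm (w - f' z) + \<eta> * m"
          using q(1) by (simp add: field_simps)
        finally have "norm (\<psi> y - x - v) \<le> q * C * norm (q' - g x - differential W g x v) + \<eta> * (norm v + norm (q' - g x))"
          by (simp add: f'z w_def m_def)
        moreover have "g (\<psi> y) = q'" using inW(2)[OF y(1,2)] y(3) by (simp add: f0 w_def)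
        ultimately show "\<exists>y\<in>W. g y = q' \<and>
         norm (y - x - v) \<le> q * C * norm (q' - g x - differential W g x v) + \<eta> * (norm v + norm (q' - g x))"
          using inW(1)[OF y(1,2)] by blast
      qed
    qed
  qed
qed

section \<open>The projection onto the orbit space\<close>

text \<open>The points \<open>y\<close> are given for each accuracy separately. A curve that is
differentiable at \<open>0\<close> arises by choosing, for each \<open>s\<close>, a point that is nearest to \<open>x + s u\<close> up to
\<open>s\<^sup>2\<close>; this choice beats all accuracies at once.\<close>

lemma tangent_space_approx:
  assumes "x \<in> A" and approx: "\<And>\<epsilon>. 0 < \<epsilon> \<Longrightarrow>
    \<exists>\<delta>>0. \<forall>s. \<bar>s\<bar> < \<delta> \<longrightarrow> (\<exists>y\<in>A. norm (y - x - s *\<^sub>R u) \<le> \<epsilon> * \<bar>s\<bar>)"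
  shows "u \<in> tangent_space A x"
proof -
  define good where "good s y \<longleftrightarrow> y \<in> A \<and> norm (y - x - s *\<^sub>R u) \<le> infdist (x + s *\<^sub>R u) A + s\<^sup>2" for s :: real and y
  define c where "c s = (if s = 0 then x else SOME y. good s y)" for s :: real
  have dn: "dist (x + s *\<^sub>R u) y = norm (y - x - s *\<^sub>R u)" for s y
    by (simp add: dist_norm norm_minus_commute diff_diff_eq)
  have c: "good s (c s)" if "s \<noteq> 0" for s
  proof -
    have "infdist (x + s *\<^sub>R u) A < infdist (x + s *\<^sub>R u) A + s\<^sup>2" using that by simp
    then have "(INF y\<in>A. dist (x + s *\<^sub>R u) y) < infdist (x + s *\<^sub>R u) A + s\<^sup>2"
      using assms(1) infdist_notempty[of A "x + s *\<^sub>R u"] by (metis empty_iff)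
    from cInf_lessD[OF _ this] assms(1)
    obtain y where "y \<in> A" "dist (x + s *\<^sub>R u) y < infdist (x + s *\<^sub>R u) A + s\<^sup>2"
      by auto
    then have "good s y" by (simp add: good_def dn)
    then show ?thesis using that by (simp add: c_def someI)
  qed
  have "(c has_derivative (\<lambda>s. s *\<^sub>R u)) (at 0)"
    unfolding has_derivative_at_alt
  proof (intro conjI allI impI)
    show "bounded_linear (\<lambda>s. s *\<^sub>R u)" by (rule bounded_linear_scaleR_left)
    fix e :: real assume "0 < e"
    then obtain \<delta> where \<delta>: "0 < \<delta>" "\<And>s. \<bar>s\<bar> < \<delta> \<Longrightarrow> \<exists>y\<in>A. norm (y - x - s *\<^sub>R u) \<le> e / 2 * \<bar>s\<bar>"
      using approx[of "e / 2"] by auto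
    show "\<exists>d>0. \<forall>s. norm (s - 0) < d \<longrightarrow> norm (c s - c 0 - (s - 0) *\<^sub>R u) \<le> e * norm (s - 0)"
    proof (intro exI[of _ "min \<delta> (e / 2)"] conjI allI impI)
      show "0 < min \<delta> (e / 2)" using \<delta> \<open>0 < e\<close> by simp
      fix s :: real assume s: "norm (s - 0) < min \<delta> (e / 2)"
      show "norm (c s - c 0 - (s - 0) *\<^sub>R u) \<le> e * norm (s - 0)"
      proof (cases "s = 0")
        case False
        obtain y where y: "y \<in> A" "norm (y - x - s *\<^sub>R u) \<le> e / 2 * \<bar>s\<bar>" using \<delta>(2)[of s] s by auto
        have "norm (c s - x - s *\<^sub>R u) \<le> infdist (x + s *\<^sub>R u) A + s\<^sup>2"
          using c[OF False] by (simp add: good_def)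
        also have "infdist (x + s *\<^sub>R u) A \<le> e / 2 * \<bar>s\<bar>"
          using infdist_le[OF y(1), of "x + s *\<^sub>R u"] y(2) by (simp add: dn)
        also have "s\<^sup>2 \<le> e / 2 * \<bar>s\<bar>"
          using s mult_right_mono[of "\<bar>s\<bar>" "e / 2" "\<bar>s\<bar>"] by (simp add: power2_eq_square flip: abs_mult)
        finally show ?thesis by (simp add: c_def)
      qed (simp add: c_def)
    qed
  qed
  then show ?thesis
    unfolding tangent_space_def has_vector_derivative_def
    using c assms(1) by (auto intro!: exI[of _ c] simp: c_def good_def)
qed

lemma has_velocity_unique:
  fixes \<A> :: "('a, 'b::euclidean_space) atlas"
  assumes "has_velocity \<A> c t V" "has_velocity \<A> c t W"
  shows "V = W"
proof
  fix \<kappa> :: "('a, 'b) chart"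
  obtain U \<phi> where \<kappa>: "\<kappa> = (U, \<phi>)" by (cases \<kappa>)
  show "V \<kappa> = W \<kappa>"
  proof (cases "\<kappa> \<in> \<A> \<and> c t \<in> U")
    case True
    then have "((\<phi> \<circ> c) has_vector_derivative V \<kappa>) (at t)" "((\<phi> \<circ> c) has_vector_derivative W \<kappa>) (at t)"
      using assms \<kappa> unfolding has_velocity_def by auto
    then show ?thesis using vector_derivative_unique_at by blast
  next
    case False
    then show ?thesis using assms \<kappa> unfolding has_velocity_def by auto
  qed
qed

lemma velocity_eqI: "has_velocity \<A> c t V \<Longrightarrow> velocity \<A> c t = V"
  unfolding velocity_def using has_velocity_unique by blast

lemma has_velocityD:
  assumes "has_velocity \<A> c t V" "(U, \<phi>) \<in> \<A>" "c t \<in> U"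
  shows "\<forall>\<^sub>F s in nhds t. c s \<in> U" "((\<lambda>s. \<phi> (c s)) has_vector_derivative V (U, \<phi>)) (at t)"
  using assms unfolding has_velocity_def by (fastforce simp: o_def)+

lemma has_velocity_shift:
  assumes "has_velocity \<A> c t V"
  shows "has_velocity \<A> (\<lambda>s. c (t + s)) 0 V"
proof -
  have ev: "\<forall>\<^sub>F s in nhds 0. P (t + s)" if "\<forall>\<^sub>F s in nhds t. P s" for P :: "real \<Rightarrow> bool"
  proof -
    have "((\<lambda>s. t + s) \<longlongrightarrow> t) (nhds 0)" by (auto intro!: tendsto_eq_intros filterlim_ident)
    then show ?thesis using that by (simp add: filterlim_iff)
  qed
  have d: "((\<lambda>s. f (t + s)) has_vector_derivative v) (at 0)"
    if "(f has_vector_derivative v) (at t)" for f :: "real \<Rightarrow> 'b" and v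
  proof -
    have "((\<lambda>s::real. t + s) has_vector_derivative 1) (at 0)"
      by (auto intro!: derivative_eq_intros simp: has_vector_derivative_def)
    from vector_diff_chain_at[OF this, of f v] that show ?thesis by (simp add: o_def)
  qed
  show ?thesis
    using assms ev d unfolding has_velocity_def by (fastforce simp: o_def)
qed

lemma differential_open_subset:
  assumes "openin (top_of_set M) W" "x \<in> W"
  shows "differential W f x = differential M f x"
proof -
  obtain O' where W: "open O'" "W = M \<inter> O'"
    using assms(1) by (metis openin_open)
  have "at x within W = at x within M"
    by (rule at_within_nhd[of x O']) (use W assms(2) in auto)
  then show ?thesis by (simp add: differential_def)
qed

locale isometric_quotient =
  fixes \<Gamma> :: "('a::euclidean_space \<Rightarrow> 'a) set" and M :: "'a set"
  assumes group: "isometry_group \<Gamma>"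
    and invariant: "\<forall>g\<in>\<Gamma>. g ` M = M"
    and submanifold: "smooth_submanifold M"
    and manifold: "smooth_manifold (orbit \<Gamma> ` M) (quotient_atlas \<Gamma> M)"
begin

abbreviation "\<pi> \<equiv> orbit \<Gamma>"
abbreviation "\<A> \<equiv> quotient_atlas \<Gamma> M"
abbreviation "d\<pi> \<equiv> projection_differential \<Gamma> M"
abbreviation "horizontal \<equiv> horizontal_space \<Gamma> M"

lemma in_orbit_self: "x \<in> \<pi> x"
  using group unfolding isometry_group_def orbit_def by (metis id_apply image_iff)

lemma orbit_eq: assumes "y \<in> \<pi> x" shows "\<pi> y = \<pi> x"
proof -
  obtain g where g: "g \<in> \<Gamma>" "y = g x" using assms by (auto simp: orbit_def)
  have b: "bij g" "inv g \<in> \<Gamma>" using group g(1) by (auto simp: isometry_group_def)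
  have comp: "a \<circ> b \<in> \<Gamma>" if "a \<in> \<Gamma>" "b \<in> \<Gamma>" for a b using group that by (auto simp: isometry_group_def)
  show ?thesis
  proof (intro equalityI subsetI)
    fix z assume "z \<in> \<pi> y"
    then obtain a where a: "a \<in> \<Gamma>" "z = (a \<circ> g) x" using g by (auto simp: orbit_def)
    then show "z \<in> \<pi> x" using comp[OF a(1) g(1)] unfolding orbit_def by blast
  next
    fix z assume "z \<in> \<pi> x"
    then obtain a where a: "a \<in> \<Gamma>" "z = a x" by (auto simp: orbit_def)
    then have "z = (a \<circ> inv g) y" using g b by (simp add: bij_is_inj)
    then show "z \<in> \<pi> y" using comp[OF a(1) b(2)] unfolding orbit_def by blast
  qed
qed

lemma orbit_subset: "x \<in> M \<Longrightarrow> \<pi> x \<subseteq> M"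
  using invariant by (auto simp: orbit_def)

lemma carrier: "carrier_of \<A> = \<pi> ` M"
  using manifold by (simp add: smooth_manifold_def)

lemma chart_exists:
  assumes "x \<in> M" obtains U \<phi> where "(U, \<phi>) \<in> \<A>" "\<pi> x \<in> U"
proof -
  have "\<pi> x \<in> carrier_of \<A>" using assms carrier by blast
  then show thesis unfolding carrier_of_def using that by auto
qed

lemma chartD:
  assumes "(U, \<phi>) \<in> \<A>"
  shows "U \<subseteq> \<pi> ` M" "inj_on \<phi> U" "openin (top_of_set M) (M \<inter> \<pi> -` U)"
    "smooth_on (M \<inter> \<pi> -` U) (\<phi> \<circ> \<pi>)"
    "\<exists>S. subspace S \<and> openin (top_of_set S) (\<phi> ` U) \<and>
        (\<forall>x\<in>M \<inter> \<pi> -` U. differential M (\<phi> \<circ> \<pi>) x ` tangent_space M x = S)"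
  using assms unfolding quotient_atlas_def by simp_all

lemma transition_smooth:
  assumes "(U, \<phi>) \<in> \<A>" "(V, \<psi>) \<in> \<A>"
  shows "smooth_on (\<phi> ` (U \<inter> V)) (\<psi> \<circ> inv_into U \<phi>)"
proof -
  have "\<forall>(U, \<phi>)\<in>\<A>. \<forall>(V, \<psi>)\<in>\<A>. openin (top_of_set (\<phi> ` U)) (\<phi> ` (U \<inter> V)) \<and>
        smooth_on (\<phi> ` (U \<inter> V)) (\<psi> \<circ> inv_into U \<phi>)"
    using manifold unfolding smooth_manifold_def by blast
  then show ?thesis using assms by fast
qed

lemma d\<pi>_chart: "(U, \<phi>) \<in> \<A> \<Longrightarrow> \<pi> x \<in> U \<Longrightarrow> d\<pi> x u (U, \<phi>) = differential M (\<phi> \<circ> \<pi>) x u"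
  by (simp add: projection_differential_def)

lemma differential_chart_domain:
  assumes "(U, \<phi>) \<in> \<A>" "x \<in> M" "\<pi> x \<in> U"
  shows "differential (M \<inter> \<pi> -` U) f x = differential M f x"
  by (rule differential_open_subset[OF chartD(3)[OF assms(1)]]) (use assms in simp)

lemma eventually_chart_domain:
  assumes "(U, \<phi>) \<in> \<A>" "\<pi> x \<in> U" "c 0 = x" "x \<in> M" "\<forall>\<^sub>F s in at 0. c s \<in> M"
    "(c has_vector_derivative u) (at (0::real))"
  shows "\<forall>\<^sub>F s in nhds 0. c s \<in> M \<inter> \<pi> -` U"
proof -
  obtain W where W: "open W" "M \<inter> \<pi> -` U = M \<inter> W"
    using chartD(3)[OF assms(1)] by (metis openin_open)
  have "(c \<longlongrightarrow> x) (at 0)"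
    using has_vector_derivative_continuous[OF assms(6)] assms(3) by (simp add: continuous_at)
  then have "\<forall>\<^sub>F s in at 0. c s \<in> W" by (rule topological_tendstoD) (use W assms in auto)
  then have "\<forall>\<^sub>F s in at 0. c s \<in> M \<inter> \<pi> -` U"
    using assms(5) by eventually_elim (use W in blast)
  then show ?thesis using assms by (simp add: eventually_nhds_conv_at)
qed

lemma has_velocity_projection:
  assumes "c 0 = x" "x \<in> M" "\<forall>\<^sub>F s in at 0. c s \<in> M" "(c has_vector_derivative u) (at (0::real))"
  shows "has_velocity \<A> (\<lambda>s. \<pi> (c s)) 0 (d\<pi> x u)"
  unfolding has_velocity_def
proof (intro conjI allI impI ballI)
  fix \<kappa> :: "('a set, 'a) chart" assume "\<kappa> \<notin> \<A> \<or> \<pi> (c 0) \<notin> fst \<kappa>"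
  then show "d\<pi> x u \<kappa> = 0" using assms(1)
    by (cases \<kappa>) (auto simp: projection_differential_def)
next
  fix \<kappa> assume \<kappa>: "\<kappa> \<in> \<A>"
  obtain U \<phi> where U: "\<kappa> = (U, \<phi>)" by (cases \<kappa>)
  have "(\<forall>\<^sub>F s in nhds 0. \<pi> (c s) \<in> U) \<and>
      (\<phi> \<circ> (\<lambda>s. \<pi> (c s)) has_vector_derivative d\<pi> x u (U, \<phi>)) (at 0)" if *: "\<pi> (c 0) \<in> U"
  proof
    have UA: "(U, \<phi>) \<in> \<A>" and xU: "\<pi> x \<in> U" using \<kappa> U * assms by auto
    have ev: "\<forall>\<^sub>F s in nhds 0. c s \<in> M \<inter> \<pi> -` U"
      by (rule eventually_chart_domain[OF UA xU assms])
    then show "\<forall>\<^sub>F s in nhds 0. \<pi> (c s) \<in> U" by (auto elim: eventually_mono)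
    have "((\<lambda>s. (\<phi> \<circ> \<pi>) (c s)) has_vector_derivative differential (M \<inter> \<pi> -` U) (\<phi> \<circ> \<pi>) x u) (at 0)"
      by (rule differential_along_curve[OF chartD(4)[OF UA] assms(1) _ _ assms(4)])
        (use ev xU assms in \<open>auto simp: eventually_nhds_conv_at\<close>)
    then show "(\<phi> \<circ> (\<lambda>s. \<pi> (c s)) has_vector_derivative d\<pi> x u (U, \<phi>)) (at 0)"
      by (simp add: differential_chart_domain[OF UA assms(2) xU] d\<pi>_chart[OF UA xU] comp_def)
  qed
  then show "case \<kappa> of (U, \<phi>) \<Rightarrow> \<pi> (c 0) \<in> U \<longrightarrow> (\<forall>\<^sub>F s in nhds 0. \<pi> (c s) \<in> U) \<and>
      (\<phi> \<circ> (\<lambda>s. \<pi> (c s)) has_vector_derivative d\<pi> x u (U, \<phi>)) (at 0)"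
    by (simp add: U)
qed

text \<open>The quantitative submersion property of the projection, read in a chart of the
quotient: an orbit \<open>p\<close> near the orbit of \<open>x\<close> contains a point near \<open>x + v\<close>.\<close>

lemma submersion_at:
  assumes U: "(U, \<phi>) \<in> \<A>" and x: "x \<in> M" "\<pi> x \<in> U"
  obtains C where "0 < C" "\<forall>\<eta>>0. \<exists>\<delta>>0. \<forall>v\<in>tangent_space M x. \<forall>p\<in>U.
    norm v < \<delta> \<longrightarrow> norm (\<phi> p - \<phi> (\<pi> x)) < \<delta> \<longrightarrow>
    (\<exists>y\<in>p. y \<in> M \<and> norm (y - x - v) \<le>
       C * norm (\<phi> p - \<phi> (\<pi> x) - d\<pi> x v (U, \<phi>)) + \<eta> * (norm v + norm (\<phi> p - \<phi> (\<pi> x))))"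
proof -
  obtain S where S: "subspace S" "openin (top_of_set S) (\<phi> ` U)"
    "\<forall>x\<in>M \<inter> \<pi> -` U. differential M (\<phi> \<circ> \<pi>) x ` tangent_space M x = S"
    using chartD(5)[OF U] by blast
  have US: "\<phi> ` U \<subseteq> S" using openin_imp_subset[OF S(2)] .
  have im: "(\<phi> \<circ> \<pi>) ` (M \<inter> \<pi> -` U) \<subseteq> S" using US by auto
  have sur: "differential (M \<inter> \<pi> -` U) (\<phi> \<circ> \<pi>) x ` tangent_space M x = S"
    using S(3) x by (simp add: differential_chart_domain[OF U x])
  have xW: "x \<in> M \<inter> \<pi> -` U" using x by simp
  obtain C where C: "0 < C" "\<forall>\<eta>>0. \<exists>\<delta>>0. \<forall>v\<in>tangent_space M x. \<forall>q\<in>S.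
    norm v < \<delta> \<longrightarrow> norm (q - (\<phi> \<circ> \<pi>) x) < \<delta> \<longrightarrow>
    (\<exists>y\<in>M \<inter> \<pi> -` U. (\<phi> \<circ> \<pi>) y = q \<and>
       norm (y - x - v) \<le> C * norm (q - (\<phi> \<circ> \<pi>) x - differential (M \<inter> \<pi> -` U) (\<phi> \<circ> \<pi>) x v) + \<eta> * (norm v + norm (q - (\<phi> \<circ> \<pi>) x)))"
    by (rule submersion_near[OF submanifold chartD(3)[OF U] xW chartD(4)[OF U] S(1) im sur])
  have eq: "differential (M \<inter> \<pi> -` U) (\<phi> \<circ> \<pi>) x v = d\<pi> x v (U, \<phi>)" for v
    by (simp add: d\<pi>_chart[OF U x(2)] differential_chart_domain[OF U x])
  show thesis
  proof (rule that[OF C(1)], intro allI impI)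
    fix \<eta> :: real assume "0 < \<eta>"
    then obtain \<delta> where \<delta>: "0 < \<delta>" "\<forall>v\<in>tangent_space M x. \<forall>q\<in>S.
      norm v < \<delta> \<longrightarrow> norm (q - \<phi> (\<pi> x)) < \<delta> \<longrightarrow>
      (\<exists>y\<in>M \<inter> \<pi> -` U. \<phi> (\<pi> y) = q \<and>
       norm (y - x - v) \<le> C * norm (q - \<phi> (\<pi> x) - d\<pi> x v (U, \<phi>)) + \<eta> * (norm v + norm (q - \<phi> (\<pi> x))))"
      using C(2) unfolding eq comp_apply by meson
    show "\<exists>\<delta>>0. \<forall>v\<in>tangent_space M x. \<forall>p\<in>U.
    norm v < \<delta> \<longrightarrow> norm (\<phi> p - \<phi> (\<pi> x)) < \<delta> \<longrightarrow>
    (\<exists>y\<in>p. y \<in> M \<and> norm (y - x - v) \<le>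
       C * norm (\<phi> p - \<phi> (\<pi> x) - d\<pi> x v (U, \<phi>)) + \<eta> * (norm v + norm (\<phi> p - \<phi> (\<pi> x))))"
    proof (intro exI[of _ \<delta>] conjI \<delta>(1) ballI impI)
      fix v p assume *: "v \<in> tangent_space M x" "p \<in> U" "norm v < \<delta>" "norm (\<phi> p - \<phi> (\<pi> x)) < \<delta>"
      have "\<phi> p \<in> S" using *(2) US by blast
      from \<delta>(2)[rule_format, OF *(1) this *(3,4)] obtain y where
        y: "y \<in> M" "\<pi> y \<in> U" "\<phi> (\<pi> y) = \<phi> p" "norm (y - x - v) \<le>
        C * norm (\<phi> p - \<phi> (\<pi> x) - d\<pi> x v (U, \<phi>)) + \<eta> * (norm v + norm (\<phi> p - \<phi> (\<pi> x)))"
        by auto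
      have "\<pi> y = p" using inj_onD[OF chartD(2)[OF U] y(3) y(2) *(2)] .
      then show "\<exists>y\<in>p. y \<in> M \<and> norm (y - x - v) \<le>
       C * norm (\<phi> p - \<phi> (\<pi> x) - d\<pi> x v (U, \<phi>)) + \<eta> * (norm v + norm (\<phi> p - \<phi> (\<pi> x)))"
        using y in_orbit_self by blast
    qed
  qed
qed

end

section \<open>Horizontal vectors\<close>

context isometric_quotient begin

lemma linear_d\<pi>:
  assumes U: "(U, \<phi>) \<in> \<A>" and x: "x \<in> M" "\<pi> x \<in> U"
  shows "linear (\<lambda>u. d\<pi> x u (U, \<phi>))"
proof -
  have "linear (differential (M \<inter> \<pi> -` U) (\<phi> \<circ> \<pi>) x)"
    by (rule linear_differential[OF chartD(4)[OF U]]) (use x in simp)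
  then show ?thesis
    by (simp add: d\<pi>_chart[OF U x(2)] differential_chart_domain[OF U x])
qed

text \<open>A vector in the kernel is tangent to the orbit because \<open>submersion_at\<close>, applied to
the orbit \<open>\<pi> x\<close> itself, finds points of this orbit within \<open>o(s)\<close> of \<open>x + s u\<close>.\<close>

lemma vertical_eq:
  assumes U: "(U, \<phi>) \<in> \<A>" and x: "x \<in> M" "\<pi> x \<in> U"
  shows "tangent_space (\<pi> x) x = {u \<in> tangent_space M x. d\<pi> x u (U, \<phi>) = 0}"
proof (intro equalityI subsetI)
  fix u assume "u \<in> tangent_space (\<pi> x) x"
  then obtain c where c: "c 0 = x" "range c \<subseteq> \<pi> x" "(c has_vector_derivative u) (at 0)"
    by (auto simp: tangent_space_def)
  have cM: "range c \<subseteq> M" using c(2) orbit_subset[OF x(1)] by blast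
  have "has_velocity \<A> (\<lambda>s. \<pi> (c s)) 0 (d\<pi> x u)"
    by (rule has_velocity_projection[OF c(1) x(1) _ c(3)]) (rule always_eventually, use cM in blast)
  then have "((\<lambda>s. \<phi> (\<pi> (c s))) has_vector_derivative d\<pi> x u (U, \<phi>)) (at 0)"
    by (rule has_velocityD(2)[OF _ U]) (use c x in simp)
  moreover have "(\<lambda>s. \<phi> (\<pi> (c s))) = (\<lambda>s. \<phi> (\<pi> x))"
    using c(2) orbit_eq by (metis rangeI subsetD)
  ultimately have "((\<lambda>s::real. \<phi> (\<pi> x)) has_vector_derivative d\<pi> x u (U, \<phi>)) (at 0)" by simp
  moreover have "((\<lambda>s::real. \<phi> (\<pi> x)) has_vector_derivative 0) (at 0)" by (rule has_vector_derivative_const)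
  ultimately have "d\<pi> x u (U, \<phi>) = 0" using vector_derivative_unique_at by blast
  moreover have "u \<in> tangent_space M x" using c cM unfolding tangent_space_def by blast
  ultimately show "u \<in> {u \<in> tangent_space M x. d\<pi> x u (U, \<phi>) = 0}" by simp
next
  fix u assume "u \<in> {u \<in> tangent_space M x. d\<pi> x u (U, \<phi>) = 0}"
  then have u: "u \<in> tangent_space M x" "d\<pi> x u (U, \<phi>) = 0" by auto
  have sub: "subspace (tangent_space M x)" by (rule subspace_tangent_space[OF submanifold x(1)])
  obtain C where C: "0 < C" "\<forall>\<eta>>0. \<exists>\<delta>>0. \<forall>v\<in>tangent_space M x. \<forall>p\<in>U.
    norm v < \<delta> \<longrightarrow> norm (\<phi> p - \<phi> (\<pi> x)) < \<delta> \<longrightarrow>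
    (\<exists>y\<in>p. y \<in> M \<and> norm (y - x - v) \<le>
       C * norm (\<phi> p - \<phi> (\<pi> x) - d\<pi> x v (U, \<phi>)) + \<eta> * (norm v + norm (\<phi> p - \<phi> (\<pi> x))))"
    by (rule submersion_at[OF U x])
  have lin: "d\<pi> x (s *\<^sub>R u) (U, \<phi>) = s *\<^sub>R d\<pi> x u (U, \<phi>)" for s
    using linear_scale[OF linear_d\<pi>[OF U x]] .
  show "u \<in> tangent_space (\<pi> x) x"
  proof (rule tangent_space_approx[OF in_orbit_self])
    fix \<epsilon> :: real assume "0 < \<epsilon>"
    define \<eta> where "\<eta> = \<epsilon> / (norm u + 1)"
    have n: "0 < norm u + 1" by (simp add: add_nonneg_pos)
    have \<eta>: "0 < \<eta>" using \<open>0 < \<epsilon>\<close> n by (simp add: \<eta>_def)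
    obtain \<delta> where \<delta>: "0 < \<delta>" "\<And>v p. v \<in> tangent_space M x \<Longrightarrow> p \<in> U \<Longrightarrow>
       norm v < \<delta> \<Longrightarrow> norm (\<phi> p - \<phi> (\<pi> x)) < \<delta> \<Longrightarrow>
      (\<exists>y\<in>p. y \<in> M \<and> norm (y - x - v) \<le>
       C * norm (\<phi> p - \<phi> (\<pi> x) - d\<pi> x v (U, \<phi>)) + \<eta> * (norm v + norm (\<phi> p - \<phi> (\<pi> x))))"
      using C(2) \<eta> by meson
    show "\<exists>\<delta>>0. \<forall>s. \<bar>s\<bar> < \<delta> \<longrightarrow> (\<exists>y\<in>\<pi> x. norm (y - x - s *\<^sub>R u) \<le> \<epsilon> * \<bar>s\<bar>)"
    proof (intro exI[of _ "\<delta> / (norm u + 1)"] conjI allI impI)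
      show "0 < \<delta> / (norm u + 1)" using \<delta>(1) n by simp
      fix s assume s: "\<bar>s\<bar> < \<delta> / (norm u + 1)"
      then have "\<bar>s\<bar> * (norm u + 1) < \<delta>" using n by (simp add: pos_less_divide_eq)
      then have "norm (s *\<^sub>R u) < \<delta>" by (simp add: algebra_simps)
      then obtain y where y: "y \<in> \<pi> x" "norm (y - x - s *\<^sub>R u) \<le> \<eta> * norm (s *\<^sub>R u)"
        using \<delta>(2)[OF subspace_scale[OF sub u(1)] x(2)] \<delta>(1) by (auto simp: lin u(2))
      have "\<eta> * norm (s *\<^sub>R u) = \<eta> * norm u * \<bar>s\<bar>" by simp
      also have "\<dots> \<le> \<epsilon> * \<bar>s\<bar>"
      proof (rule mult_right_mono)
        have "\<eta> * norm u \<le> \<eta> * (norm u + 1)" using \<eta> by simp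
        also have "\<dots> = \<epsilon>" using n unfolding \<eta>_def by (metis less_irrefl nonzero_divide_eq_eq)
        finally show "\<eta> * norm u \<le> \<epsilon>" .
      qed simp
      finally show "\<exists>y\<in>\<pi> x. norm (y - x - s *\<^sub>R u) \<le> \<epsilon> * \<bar>s\<bar>" using y by (intro bexI[of _ y]) auto
    qed
  qed
qed

lemma subspace_vertical:
  assumes x: "x \<in> M" shows "subspace (tangent_space (\<pi> x) x)"
proof -
  obtain U \<phi> where U: "(U, \<phi>) \<in> \<A>" "\<pi> x \<in> U" by (rule chart_exists[OF x])
  have "subspace ({u. d\<pi> x u (U, \<phi>) = 0} \<inter> tangent_space M x)"
    by (intro subspace_inter linear_subspace_kernel linear_d\<pi> subspace_tangent_space submanifold U x)
  moreover have "{u. d\<pi> x u (U, \<phi>) = 0} \<inter> tangent_space M x = tangent_space (\<pi> x) x"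
    using vertical_eq[OF U(1) x U(2)] by blast
  ultimately show ?thesis by simp
qed

lemma d\<pi>_eq_iff:
  assumes x: "x \<in> M" and u: "u \<in> tangent_space M x" "w \<in> tangent_space M x"
  shows "d\<pi> x u = d\<pi> x w \<longleftrightarrow> u - w \<in> tangent_space (\<pi> x) x"
proof -
  have uw: "u - w \<in> tangent_space M x"
    by (rule subspace_diff[OF subspace_tangent_space[OF submanifold x] u])
  have chart: "d\<pi> x u (U, \<phi>) = d\<pi> x w (U, \<phi>) \<longleftrightarrow> u - w \<in> tangent_space (\<pi> x) x"
    if U: "(U, \<phi>) \<in> \<A>" "\<pi> x \<in> U" for U \<phi>
    using vertical_eq[OF U(1) x U(2)] uw linear_diff[OF linear_d\<pi>[OF U(1) x U(2)], of u w] by simp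
  show ?thesis
  proof
    assume "d\<pi> x u = d\<pi> x w"
    then show "u - w \<in> tangent_space (\<pi> x) x" using chart_exists[OF x] chart by metis
  next
    assume *: "u - w \<in> tangent_space (\<pi> x) x"
    show "d\<pi> x u = d\<pi> x w"
    proof
      fix \<kappa> :: "('a set, 'a) chart"
      obtain U \<phi> where \<kappa>: "\<kappa> = (U, \<phi>)" by (cases \<kappa>)
      show "d\<pi> x u \<kappa> = d\<pi> x w \<kappa>"
      proof (cases "(U, \<phi>) \<in> \<A> \<and> \<pi> x \<in> U")
        case True
        then show ?thesis using chart * \<kappa> by blast
      next
        case False
        then show ?thesis by (auto simp: projection_differential_def \<kappa>)
      qed
    qed
  qed
qed

lemma horizontal_part:
  assumes x: "x \<in> M" and u: "u \<in> tangent_space M x"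
  obtains h where "h \<in> horizontal x" "d\<pi> x h = d\<pi> x u" "norm h \<le> norm u"
proof -
  have sub: "subspace (tangent_space (\<pi> x) x)" by (rule subspace_vertical[OF x])
  obtain y z where yz: "y \<in> span (tangent_space (\<pi> x) x)"
    "\<And>w. w \<in> span (tangent_space (\<pi> x) x) \<Longrightarrow> orthogonal z w" "u = y + z"
    using orthogonal_subspace_decomp_exists[of "tangent_space (\<pi> x) x" u] by blast
  have y: "y \<in> tangent_space (\<pi> x) x" using yz(1) sub by (metis span_eq_iff)
  obtain U \<phi> where U: "(U, \<phi>) \<in> \<A>" "\<pi> x \<in> U" by (rule chart_exists[OF x])
  have yM: "y \<in> tangent_space M x" using y vertical_eq[OF U(1) x U(2)] by simp
  have zM: "z \<in> tangent_space M x"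
    using subspace_diff[OF subspace_tangent_space[OF submanifold x] u yM] yz(3) by simp
  show thesis
  proof
    show "z \<in> horizontal x"
      using zM yz(2) by (auto simp: horizontal_space_def orthogonal_def span_base)
    have "u - z \<in> tangent_space (\<pi> x) x" using y yz(3) by simp
    then show "d\<pi> x z = d\<pi> x u" using d\<pi>_eq_iff[OF x u zM] by simp
    have "(norm u)\<^sup>2 = (norm y)\<^sup>2 + (norm z)\<^sup>2"
      unfolding yz(3) by (rule norm_add_Pythagorean) (use yz(1,2) in \<open>simp add: orthogonal_commute\<close>)
    then have "(norm z)\<^sup>2 \<le> (norm u)\<^sup>2" by simp
    then show "norm z \<le> norm u" by (rule power2_le_imp_le) simp
  qed
qed

lemma horizontal_tangent: "u \<in> horizontal x \<Longrightarrow> u \<in> tangent_space M x"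
  by (simp add: horizontal_space_def)

lemma horizontal_unique:
  assumes x: "x \<in> M" and "u \<in> horizontal x" "w \<in> horizontal x" "d\<pi> x u = d\<pi> x w"
  shows "u = w"
proof -
  have "u - w \<in> tangent_space (\<pi> x) x"
    using d\<pi>_eq_iff[OF x] assms horizontal_tangent by blast
  then have "u \<bullet> (u - w) = 0" "w \<bullet> (u - w) = 0" using assms by (auto simp: horizontal_space_def)
  then have "(u - w) \<bullet> (u - w) = 0" by (simp add: inner_diff_left)
  then show ?thesis by simp
qed

lemma horizontal_lift_eq:
  assumes "x \<in> M" "u \<in> horizontal x"
  shows "horizontal_lift \<Gamma> M x (d\<pi> x u) = u"
  unfolding horizontal_lift_def using horizontal_unique[OF assms(1)] assms(2) by (intro the_equality) auto

text \<open>In one chart \<open>(U, \<phi>)\<close> at the orbit of \<open>x\<close> the velocity lies in the image of the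
differential, so some horizontal \<open>u\<close> has the right coordinates there. In any other chart the
coordinates of both vectors arise from those in \<open>(U, \<phi>)\<close> by the derivative of the transition map.\<close>

lemma velocity_horizontal:
  assumes V: "has_velocity \<A> c t V" and x: "x \<in> M" "\<pi> x = c t"
  obtains u where "u \<in> horizontal x" "V = d\<pi> x u"
proof -
  obtain U \<phi> where U: "(U, \<phi>) \<in> \<A>" "\<pi> x \<in> U" by (rule chart_exists[OF x(1)])
  define a where "a s = \<phi> (c (t + s))" for s
  define w where "w = V (U, \<phi>)"
  have V0: "has_velocity \<A> (\<lambda>s. c (t + s)) 0 V" by (rule has_velocity_shift[OF V])
  have aU: "\<forall>\<^sub>F s in nhds 0. c (t + s) \<in> U" and a: "(a has_vector_derivative w) (at 0)"
    using has_velocityD[OF V0 U(1)] U(2) x(2) unfolding a_def w_def by auto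
  obtain S where S: "subspace S" "openin (top_of_set S) (\<phi> ` U)"
    "\<forall>x\<in>M \<inter> \<pi> -` U. differential M (\<phi> \<circ> \<pi>) x ` tangent_space M x = S"
    using chartD(5)[OF U(1)] by blast
  have US: "\<phi> ` U \<subseteq> S" using openin_imp_subset[OF S(2)] .
  have "w \<in> S"
  proof (rule Lim_in_closed_set[OF closed_subspace[OF S(1)] _ trivial_limit_at])
    show "((\<lambda>s. (a s - a 0) /\<^sub>R (s - 0)) \<longlongrightarrow> w) (at 0)"
      by (rule has_vector_derivative_quotient_limit[OF a])
    have a0: "a 0 \<in> S" using US U(2) x(2) by (auto simp: a_def)
    have "\<forall>\<^sub>F s in at 0. c (t + s) \<in> U" using aU by (simp add: eventually_nhds_conv_at)
    then show "\<forall>\<^sub>F s in at 0. (a s - a 0) /\<^sub>R (s - 0) \<in> S"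
    proof eventually_elim
      case (elim s)
      then have "a s \<in> S" using US by (auto simp: a_def)
      then show ?case by (intro subspace_scale[OF S(1)] subspace_diff[OF S(1)] a0)
    qed
  qed
  then have "w \<in> differential M (\<phi> \<circ> \<pi>) x ` tangent_space M x" using S(3) x U by simp
  then obtain u0 where u0: "u0 \<in> tangent_space M x" "w = d\<pi> x u0 (U, \<phi>)"
    using d\<pi>_chart[OF U] by auto
  obtain u where u: "u \<in> horizontal x" "d\<pi> x u = d\<pi> x u0"
    using horizontal_part[OF x(1) u0(1)] by metis
  have "u \<in> tangent_space M x" using u(1) horizontal_tangent by blast
  then obtain m where m: "m 0 = x" "range m \<subseteq> M" "(m has_vector_derivative u) (at 0)"
    by (auto simp: tangent_space_def)
  have W: "has_velocity \<A> (\<lambda>s. \<pi> (m s)) 0 (d\<pi> x u)"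
    by (rule has_velocity_projection[OF m(1) x(1) _ m(3)]) (rule always_eventually, use m(2) in blast)
  define b where "b s = \<phi> (\<pi> (m s))" for s
  have bU: "\<forall>\<^sub>F s in nhds 0. \<pi> (m s) \<in> U" and b: "(b has_vector_derivative w) (at 0)"
    using has_velocityD[OF W U(1)] U(2) m(1) u(2) u0(2) unfolding b_def by auto
  have inv: "inv_into U \<phi> (\<phi> p) = p" if "p \<in> U" for p
    using chartD(2)[OF U(1)] that by (rule inv_into_f_f)
  have "V = d\<pi> x u"
  proof
    fix \<kappa> :: "('a set, 'a) chart"
    obtain U' \<psi> where \<kappa>: "\<kappa> = (U', \<psi>)" by (cases \<kappa>)
    show "V \<kappa> = d\<pi> x u \<kappa>"
    proof (cases "(U', \<psi>) \<in> \<A> \<and> \<pi> x \<in> U'")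
      case False
      then show ?thesis using V x(2) unfolding has_velocity_def projection_differential_def \<kappa> by auto
    next
      case True
      then have U': "(U', \<psi>) \<in> \<A>" "\<pi> x \<in> U'" by auto
      let ?T = "\<psi> \<circ> inv_into U \<phi>" let ?S = "\<phi> ` (U \<inter> U')"
      have both: "((\<lambda>s. \<psi> (q s)) has_vector_derivative differential ?S ?T (\<phi> (\<pi> x)) w) (at 0)"
        if q: "\<forall>\<^sub>F s in nhds 0. q s \<in> U" "\<forall>\<^sub>F s in nhds 0. q s \<in> U'" "q 0 = \<pi> x"
          "((\<lambda>s. \<phi> (q s)) has_vector_derivative w) (at 0)" for q :: "real \<Rightarrow> 'a set"
      proof -
        have "\<forall>\<^sub>F s in nhds 0. \<phi> (q s) \<in> ?S" using q(1,2) by eventually_elim auto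
        then have evS: "\<forall>\<^sub>F s in at 0. \<phi> (q s) \<in> ?S" by (simp add: eventually_nhds_conv_at)
        have d: "((\<lambda>s. ?T (\<phi> (q s))) has_vector_derivative differential ?S ?T (\<phi> (\<pi> x)) w) (at 0)"
          by (rule differential_along_curve[OF transition_smooth[OF U(1) U'(1)] _ _ evS q(4)])
            (use q(3) U(2) U'(2) in auto)
        have "\<forall>\<^sub>F s in nhds 0. s \<in> UNIV \<longrightarrow> ?T (\<phi> (q s)) = \<psi> (q s)"
          using q(1) by eventually_elim (simp add: inv)
        from has_vector_derivative_cong_ev[OF this] show ?thesis
          using d q(3) U(2) by (simp add: inv)
      qed
      have "((\<lambda>s. \<psi> (c (t + s))) has_vector_derivative differential ?S ?T (\<phi> (\<pi> x)) w) (at 0)"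
        by (rule both) (use has_velocityD(1)[OF V0 U'(1)] aU a[unfolded a_def[abs_def]] x(2) U'(2) in auto)
      moreover have "((\<lambda>s. \<psi> (c (t + s))) has_vector_derivative V (U', \<psi>)) (at 0)"
        by (rule has_velocityD(2)[OF V0 U'(1)]) (use x(2) U'(2) in simp)
      moreover have "((\<lambda>s. \<psi> (\<pi> (m s))) has_vector_derivative differential ?S ?T (\<phi> (\<pi> x)) w) (at 0)"
        by (rule both) (use has_velocityD(1)[OF W U'(1)] bU b[unfolded b_def[abs_def]] m(1) U'(2) in auto)
      moreover have "((\<lambda>s. \<psi> (\<pi> (m s))) has_vector_derivative d\<pi> x u (U', \<psi>)) (at 0)"
        by (rule has_velocityD(2)[OF W U'(1)]) (use m(1) U'(2) in simp)
      ultimately show ?thesis using vector_derivative_unique_at \<kappa> by metis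
    qed
  qed
  with u(1) show thesis by (rule that)
qed

lemma tangent_vectors_horizontal:
  assumes "V \<in> tangent_vectors \<A> (\<pi> x)" "x \<in> M"
  obtains u where "u \<in> horizontal x" "V = d\<pi> x u"
  using assms velocity_horizontal unfolding tangent_vectors_def by (smt (verit) mem_Collect_eq)

end

section \<open>Isometries that normalise the group\<close>

lemma topspace_manifold_topology:
  fixes \<A> :: "('p, 'e::euclidean_space) atlas"
  shows "topspace (manifold_topology \<A>) = carrier_of \<A>"
proof (intro equalityI subsetI)
  fix p assume "p \<in> topspace (manifold_topology \<A>)"
  then show "p \<in> carrier_of \<A>"
    unfolding manifold_topology_def topology_generated_by_topspace carrier_of_def by auto
next
  fix p assume "p \<in> carrier_of \<A>"
  then obtain U \<phi> where U: "(U, \<phi>) \<in> \<A>" "p \<in> U" by (auto simp: carrier_of_def)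
  have "U \<in> {U \<inter> \<phi> -` W | U \<phi> W. (U, \<phi>) \<in> \<A> \<and> open W}"
    using U(1) by (intro CollectI exI[of _ U] exI[of _ \<phi>] exI[of _ UNIV]) simp
  with U(2) show "p \<in> topspace (manifold_topology \<A>)"
    unfolding manifold_topology_def topology_generated_by_topspace by (rule UnionI[rotated])
qed

lemma smooth_map_cong:
  assumes "\<And>p. p \<in> carrier_of \<A> \<Longrightarrow> F p = G p" "smooth_map \<A> F"
  shows "smooth_map \<A> G"
  unfolding smooth_map_def
proof
  show "continuous_map (manifold_topology \<A>) (manifold_topology \<A>) G"
    by (rule continuous_map_eq[of _ _ F]) (use assms in \<open>auto simp: smooth_map_def topspace_manifold_topology\<close>)
  show "\<forall>(U, \<phi>)\<in>\<A>. \<forall>(V, \<psi>)\<in>\<A>. smooth_on (\<phi> ` (U \<inter> G -` V)) (\<psi> \<circ> G \<circ> inv_into U \<phi>)"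
  proof (clarify)
    fix U \<phi> V \<psi> assume UV: "(U, \<phi>) \<in> \<A>" "(V, \<psi>) \<in> \<A>"
    have U: "F p = G p" if "p \<in> U" for p
      using UV(1) that assms(1) unfolding carrier_of_def by blast
    have "smooth_on (\<phi> ` (U \<inter> F -` V)) (\<psi> \<circ> F \<circ> inv_into U \<phi>)"
      using assms(2) UV unfolding smooth_map_def by fast
    moreover have "U \<inter> F -` V = U \<inter> G -` V" using U by auto
    ultimately have "smooth_on (\<phi> ` (U \<inter> G -` V)) (\<psi> \<circ> F \<circ> inv_into U \<phi>)" by simp
    then show "smooth_on (\<phi> ` (U \<inter> G -` V)) (\<psi> \<circ> G \<circ> inv_into U \<phi>)"
      by (rule smooth_on_cong[rotated]) (auto simp: U inv_into_into)
  qed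
qed

definition linear_part :: "('a::real_vector \<Rightarrow> 'a) \<Rightarrow> 'a \<Rightarrow> 'a" where
  "linear_part k v = k v - k 0"

lemma orthogonal_linear_part:
  fixes k :: "'a::euclidean_space \<Rightarrow> 'a"
  assumes "\<And>x y. dist (k x) (k y) = dist x y"
  shows "orthogonal_transformation (linear_part k)"
  unfolding orthogonal_transformation_isometry linear_part_def using assms by (simp add: dist_norm)

text \<open>The linear part of \<open>k\<close> plays the role of the derivative of \<open>k\<close> at every point. The
elements of \<open>\<Gamma>\<close> themselves satisfy these assumptions, which yields the independence of the
quotient metric from the representative.\<close>

locale quotient_symmetry = isometric_quotient +
  fixes k :: "'a \<Rightarrow> 'a"
  assumes bij: "bij k" and iso: "\<And>x y. dist (k x) (k y) = dist x y"
    and level: "k ` M = M" and normal: "(\<lambda>g. k \<circ> g \<circ> inv k) ` \<Gamma> = \<Gamma>"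
begin

abbreviation "L \<equiv> linear_part k"

lemma orthogonal_L: "orthogonal_transformation L"
  by (rule orthogonal_linear_part[OF iso])

lemma eq_linear_part: "k y = L y + k 0"
  by (simp add: linear_part_def)

lemma linear_L: "linear L"
  using orthogonal_L orthogonal_transformation_linear by blast

lemma inv_cancel: "k (inv k y) = y" "inv k (k y) = y"
  using bij by (simp_all add: bij_is_surj surj_f_inv_f bij_is_inj)

lemma linear_part_inverse: "L (linear_part (inv k) v) = v"
proof -
  have "L (linear_part (inv k) v) = L (inv k v) - L (inv k 0)"
    using linear_diff[OF linear_L] by (simp add: linear_part_def[of "inv k"])
  also have "\<dots> = v" by (simp add: linear_part_def inv_cancel)
  finally show ?thesis .
qed

lemma inverse_symmetry: "quotient_symmetry \<Gamma> M (inv k)"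
proof unfold_locales
  show "bij (inv k)" using bij by (rule bij_imp_bij_inv)
  show "dist (inv k x) (inv k y) = dist x y" for x y
    using iso[of "inv k x" "inv k y"] bij by (simp add: bij_is_surj surj_f_inv_f)
  show "inv k ` M = M"
    using level bij by (metis bij_is_inj image_inv_f_f)
  have "(\<lambda>g. inv k \<circ> g \<circ> inv (inv k)) ` (\<lambda>g. k \<circ> g \<circ> inv k) ` \<Gamma> = \<Gamma>"
  proof -
    have "inv k \<circ> (k \<circ> g \<circ> inv k) \<circ> inv (inv k) = g" for g
      using bij by (auto simp: fun_eq_iff inv_inv_eq bij_is_inj)
    then show ?thesis by (simp add: image_image)
  qed
  then show "(\<lambda>g. inv k \<circ> g \<circ> inv (inv k)) ` \<Gamma> = \<Gamma>" by (simp add: normal)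
qed

lemma image_orbit: "k ` \<pi> x = \<pi> (k x)"
proof (intro equalityI subsetI)
  fix y assume "y \<in> k ` \<pi> x"
  then obtain g where g: "g \<in> \<Gamma>" "y = k (g x)" by (auto simp: orbit_def)
  then have "y = (k \<circ> g \<circ> inv k) (k x)" using bij by (simp add: bij_is_inj)
  moreover have "k \<circ> g \<circ> inv k \<in> \<Gamma>" using g(1) normal by blast
  ultimately show "y \<in> \<pi> (k x)" unfolding orbit_def by blast
next
  fix y assume "y \<in> \<pi> (k x)"
  then obtain g where g: "g \<in> \<Gamma>" "y = g (k x)" by (auto simp: orbit_def)
  then obtain g' where g': "g' \<in> \<Gamma>" "g = k \<circ> g' \<circ> inv k" using normal by blast
  then have "y = k (g' x)" using g(2) bij by (simp add: bij_is_inj)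
  then show "y \<in> k ` \<pi> x" using g'(1) by (auto simp: orbit_def)
qed

lemma mem_level_iff: "k x \<in> M \<longleftrightarrow> x \<in> M"
  using level bij by (metis bij_is_inj inj_image_mem_iff)

lemma curve_image:
  assumes "(c has_vector_derivative u) (at t)"
  shows "((\<lambda>s. k (c s)) has_vector_derivative L u) (at t)"
proof -
  have "(k has_derivative L) (at y)" for y
  proof -
    have "((\<lambda>y. L y + k 0) has_derivative L) (at y)"
      using linear_L by (auto intro!: derivative_eq_intros linear_imp_has_derivative)
    then show ?thesis by (simp add: linear_part_def)
  qed
  then show ?thesis using assms by (rule has_vector_derivative_along_curve)
qed

lemma tangent_space_image:
  assumes "k ` A = B" "u \<in> tangent_space A x"
  shows "L u \<in> tangent_space B (k x)"
  using assms curve_image unfolding tangent_space_def by fast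

lemma horizontal_image:
  assumes u: "u \<in> horizontal x"
  shows "L u \<in> horizontal (k x)"
proof -
  interpret I: quotient_symmetry \<Gamma> M "inv k" by (rule inverse_symmetry)
  note kk = inv_cancel
  have "L u \<bullet> v = 0" if v: "v \<in> tangent_space (\<pi> (k x)) (k x)" for v
  proof -
    have "inv k ` \<pi> (k x) = \<pi> x" using I.image_orbit[of "k x"] kk by simp
    then have "I.L v \<in> tangent_space (\<pi> x) x" using I.tangent_space_image[OF _ v] kk by simp
    then have "u \<bullet> I.L v = 0" using u by (simp add: horizontal_space_def)
    moreover have "L (I.L v) = v" by (rule linear_part_inverse)
    ultimately show ?thesis
      using orthogonal_L unfolding orthogonal_transformation_def by metis
  qed
  moreover have "L u \<in> tangent_space M (k x)"
    using tangent_space_image[OF level] u by (simp add: horizontal_space_def)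
  ultimately show ?thesis by (simp add: horizontal_space_def)
qed

lemma has_velocity_image:
  assumes "c 0 = x" "x \<in> M" "\<forall>\<^sub>F s in at 0. c s \<in> M" "(c has_vector_derivative u) (at (0::real))"
  shows "has_velocity \<A> (\<lambda>s. k ` \<pi> (c s)) 0 (d\<pi> (k x) (L u))"
  unfolding image_orbit
  by (rule has_velocity_projection[OF _ _ _ curve_image[OF assms(4)]])
    (use assms in \<open>auto simp: mem_level_iff\<close>)

text \<open>The atlas of the quotient consists of all charts for which the projection is a
submersion, a property that \<open>k\<close> respects.\<close>

lemma pullback_chart:
  assumes V: "(V, \<psi>) \<in> \<A>"
  shows "({p \<in> \<pi> ` M. k ` p \<in> V}, \<lambda>p. \<psi> (k ` p)) \<in> \<A>"
proof -
  let ?V = "{p \<in> \<pi> ` M. k ` p \<in> V}" and ?\<psi> = "\<lambda>p. \<psi> (k ` p)"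
  let ?D = "M \<inter> \<pi> -` V"
  interpret I: quotient_symmetry \<Gamma> M "inv k" by (rule inverse_symmetry)
  note kk = inv_cancel
  have kc: "continuous_on UNIV k"
    unfolding continuous_on_iff iso by blast
  have dom: "M \<inter> \<pi> -` ?V = k -` ?D" by (auto simp: image_orbit mem_level_iff)
  have fn: "?\<psi> \<circ> \<pi> = (\<psi> \<circ> \<pi>) \<circ> k" by (simp add: fun_eq_iff image_orbit)
  have sm: "smooth_on (k -` ?D) (?\<psi> \<circ> \<pi>)"
    unfolding fn using linear_L
    by (intro smooth_on_comp_affine[OF _ eq_linear_part chartD(4)[OF V]]) (simp add: linear_conv_bounded_linear)
  have op: "openin (top_of_set M) (k -` ?D)"
  proof -
    obtain W where W: "open W" "?D = M \<inter> W" using chartD(3)[OF V] by (metis openin_open)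
    have "k -` ?D = M \<inter> k -` W" unfolding W(2) by (auto simp: mem_level_iff)
    then show ?thesis using open_vimage[OF W(1) kc] by (simp add: openin_open_Int)
  qed
  have img: "?\<psi> ` ?V = \<psi> ` V"
  proof -
    have "V \<subseteq> (\<lambda>p. k ` p) ` ?V"
    proof
      fix p assume p: "p \<in> V"
      then obtain m where m: "m \<in> M" "p = \<pi> m" using chartD(1)[OF V] by blast
      have "p = k ` \<pi> (inv k m)" using m(2) by (simp add: image_orbit kk)
      then show "p \<in> (\<lambda>p. k ` p) ` ?V" using p m(1) I.mem_level_iff by blast
    qed
    then show ?thesis by auto
  qed
  obtain S where S: "subspace S" "openin (top_of_set S) (\<psi> ` V)"
    "\<forall>x\<in>?D. differential M (\<psi> \<circ> \<pi>) x ` tangent_space M x = S"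
    using chartD(5)[OF V] by blast
  have onto: "differential M (?\<psi> \<circ> \<pi>) x ` tangent_space M x = S" if x: "x \<in> k -` ?D" for x
  proof -
    have xM: "x \<in> M" "\<pi> (k x) \<in> V" using x mem_level_iff by auto
    have d: "differential M (?\<psi> \<circ> \<pi>) x u = differential M (\<psi> \<circ> \<pi>) (k x) (L u)"
      if u: "u \<in> tangent_space M x" for u
    proof -
      obtain c where c: "c 0 = x" "range c \<subseteq> M" "(c has_vector_derivative u) (at 0)"
        using u by (auto simp: tangent_space_def)
      have ev: "\<forall>\<^sub>F s in at 0. c s \<in> M" by (rule always_eventually) (use c(2) in blast)
      note vel = has_velocity_image[OF c(1) xM(1) ev c(3)]
      have k0: "k ` \<pi> (c 0) \<in> V" using xM c(1) by (simp add: image_orbit)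
      have "\<forall>\<^sub>F s in at 0. k ` \<pi> (c s) \<in> V"
        using has_velocityD(1)[OF vel V k0] by (simp add: eventually_nhds_conv_at)
      with ev have "\<forall>\<^sub>F s in at 0. c s \<in> k -` ?D"
        by eventually_elim (simp add: image_orbit mem_level_iff)
      then have "((\<lambda>s. (?\<psi> \<circ> \<pi>) (c s)) has_vector_derivative differential (k -` ?D) (?\<psi> \<circ> \<pi>) x u) (at 0)"
        by (rule differential_along_curve[OF sm c(1) x _ c(3)])
      moreover have "((\<lambda>s. \<psi> (k ` \<pi> (c s))) has_vector_derivative d\<pi> (k x) (L u) (V, \<psi>)) (at 0)"
        by (rule has_velocityD(2)[OF vel V k0])
      ultimately have "differential (k -` ?D) (?\<psi> \<circ> \<pi>) x u = d\<pi> (k x) (L u) (V, \<psi>)"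
        using vector_derivative_unique_at by (simp add: comp_def)
      then show ?thesis
        by (simp only: differential_open_subset[OF op x] d\<pi>_chart[OF V xM(2)])
    qed
    have "tangent_space M (k x) = L ` tangent_space M x"
    proof (intro equalityI subsetI)
      fix v assume v: "v \<in> tangent_space M (k x)"
      have "I.L v \<in> tangent_space M x" using I.tangent_space_image[OF I.level v] kk by simp
      moreover have "L (I.L v) = v" by (rule linear_part_inverse)
      ultimately show "v \<in> L ` tangent_space M x" by (metis imageI)
    qed (use tangent_space_image[OF level] in blast)
    then have "differential M (?\<psi> \<circ> \<pi>) x ` tangent_space M x
        = differential M (\<psi> \<circ> \<pi>) (k x) ` tangent_space M (k x)"
      by (simp add: image_image d cong: image_cong)
    also have "\<dots> = S" using S(3) x by simp
    finally show ?thesis .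
  qed
  have inj: "inj_on ?\<psi> ?V"
  proof (rule inj_onI)
    fix p q assume *: "p \<in> ?V" "q \<in> ?V" "\<psi> (k ` p) = \<psi> (k ` q)"
    then have "k ` p = k ` q" using inj_onD[OF chartD(2)[OF V]] by blast
    then show "p = q" using bij by (simp add: bij_is_inj inj_image_eq_iff)
  qed
  show ?thesis
    unfolding quotient_atlas_def mem_Collect_eq case_prod_conv dom img
    using inj op sm S(1,2) onto by blast
qed

text \<open>In charts \<open>(U, \<phi>)\<close> and \<open>(V, \<psi>)\<close> the map induced by \<open>k\<close> is the transition from \<open>(U, \<phi>)\<close>
to the pullback of \<open>(V, \<psi>)\<close>, and the atlas is a smooth atlas.\<close>

lemma smooth_map_image: "smooth_map \<A> ((`) k)"
  unfolding smooth_map_def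
proof
  have kinj: "inj k" using bij by (rule bij_is_inj)
  have im: "k ` p \<in> carrier_of \<A>" if "p \<in> carrier_of \<A>" for p
    using that by (auto simp: carrier image_orbit mem_level_iff)
  show "continuous_map (manifold_topology \<A>) (manifold_topology \<A>) ((`) k)"
    unfolding manifold_topology_def[of \<A>]
  proof (rule continuous_on_generated_topo)
    fix B assume "B \<in> {U \<inter> \<phi> -` W | U \<phi> W. (U, \<phi>) \<in> \<A> \<and> open W}"
    then obtain U \<phi> W where B: "B = U \<inter> \<phi> -` W" "(U, \<phi>) \<in> \<A>" "open W" by blast
    let ?U = "{p \<in> \<pi> ` M. k ` p \<in> U}" and ?\<phi> = "\<lambda>p. \<phi> (k ` p)"
    have "?U \<inter> ?\<phi> -` W \<in> {U \<inter> \<phi> -` W | U \<phi> W. (U, \<phi>) \<in> \<A> \<and> open W}"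
      using pullback_chart[OF B(2)] B(3) by blast
    then have "openin (manifold_topology \<A>) (?U \<inter> ?\<phi> -` W)"
      unfolding manifold_topology_def by (rule topology_generated_by_Basis)
    moreover have "?U \<inter> ?\<phi> -` W = (`) k -` B \<inter> topspace (manifold_topology \<A>)"
      by (auto simp: B(1) topspace_manifold_topology carrier)
    ultimately show "openin (topology_generated_by {U \<inter> \<phi> -` W |U \<phi> W. (U, \<phi>) \<in> \<A> \<and> open W})
          ((`) k -` B \<inter> topspace (topology_generated_by {U \<inter> \<phi> -` W |U \<phi> W. (U, \<phi>) \<in> \<A> \<and> open W}))"
      by (simp add: manifold_topology_def)
  next
    have "(`) k ` topspace (manifold_topology \<A>) \<subseteq> topspace (manifold_topology \<A>)"
      using im by (auto simp: topspace_manifold_topology)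
    then show "(`) k ` topspace (topology_generated_by {U \<inter> \<phi> -` W |U \<phi> W. (U, \<phi>) \<in> \<A> \<and> open W})
        \<subseteq> \<Union>{U \<inter> \<phi> -` W |U \<phi> W. (U, \<phi>) \<in> \<A> \<and> open W}"
      unfolding manifold_topology_def topology_generated_by_topspace .
  qed
  show "\<forall>(U, \<phi>)\<in>\<A>. \<forall>(V, \<psi>)\<in>\<A>. smooth_on (\<phi> ` (U \<inter> (`) k -` V)) (\<psi> \<circ> (`) k \<circ> inv_into U \<phi>)"
  proof (clarify)
    fix U \<phi> V \<psi> assume U: "(U, \<phi>) \<in> \<A>" and V: "(V, \<psi>) \<in> \<A>"
    have "U \<inter> {p \<in> \<pi> ` M. k ` p \<in> V} = U \<inter> (`) k -` V" using chartD(1)[OF U] by auto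
    then show "smooth_on (\<phi> ` (U \<inter> (`) k -` V)) (\<psi> \<circ> (`) k \<circ> inv_into U \<phi>)"
      using transition_smooth[OF U pullback_chart[OF V]] by (simp add: comp_def)
  qed
qed

lemma push_forward_d\<pi>:
  assumes x: "x \<in> M" and u: "u \<in> tangent_space M x"
  shows "push_forward \<A> ((`) k) (\<pi> x) (d\<pi> x u) = d\<pi> (k x) (L u)"
proof
  fix \<kappa> :: "('a set, 'a) chart"
  obtain V \<psi> where \<kappa>: "\<kappa> = (V, \<psi>)" by (cases \<kappa>)
  show "push_forward \<A> ((`) k) (\<pi> x) (d\<pi> x u) \<kappa> = d\<pi> (k x) (L u) \<kappa>"
  proof (cases "(V, \<psi>) \<in> \<A> \<and> \<pi> (k x) \<in> V")
    case False
    then show ?thesis by (auto simp: push_forward_def projection_differential_def \<kappa> image_orbit)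
  next
    case True
    then have V: "(V, \<psi>) \<in> \<A>" "\<pi> (k x) \<in> V" by auto
    define \<kappa>' where "\<kappa>' = (SOME \<kappa>. \<kappa> \<in> \<A> \<and> \<pi> x \<in> fst \<kappa>)"
    obtain U \<phi> where U': "\<kappa>' = (U, \<phi>)" by (cases \<kappa>')
    have "\<exists>\<kappa>. \<kappa> \<in> \<A> \<and> \<pi> x \<in> fst \<kappa>" using chart_exists[OF x] by (metis fst_conv)
    then have "\<kappa>' \<in> \<A> \<and> \<pi> x \<in> fst \<kappa>'" unfolding \<kappa>'_def by (rule someI_ex)
    then have U: "(U, \<phi>) \<in> \<A>" "\<pi> x \<in> U" by (auto simp: U')
    let ?S = "\<phi> ` (U \<inter> (`) k -` V)" and ?T = "\<psi> \<circ> (`) k \<circ> inv_into U \<phi>"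
    have "push_forward \<A> ((`) k) (\<pi> x) (d\<pi> x u) \<kappa> = differential ?S ?T (\<phi> (\<pi> x)) (d\<pi> x u (U, \<phi>))"
      using V unfolding push_forward_def \<kappa> \<kappa>'_def[symmetric] U' by (simp add: image_orbit)
    also have "\<dots> = d\<pi> (k x) (L u) (V, \<psi>)"
    proof -
      obtain c where c: "c 0 = x" "range c \<subseteq> M" "(c has_vector_derivative u) (at 0)"
        using u by (auto simp: tangent_space_def)
      have ev: "\<forall>\<^sub>F s in at 0. c s \<in> M" by (rule always_eventually) (use c(2) in blast)
      note vel = has_velocity_image[OF c(1) x ev c(3)]
      note vel0 = has_velocity_projection[OF c(1) x ev c(3)]
      have c0: "k ` \<pi> (c 0) \<in> V" "\<pi> (c 0) \<in> U" using V(2) U(2) c(1) by (simp_all add: image_orbit)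
      have evU: "\<forall>\<^sub>F s in nhds 0. \<pi> (c s) \<in> U" by (rule has_velocityD(1)[OF vel0 U(1) c0(2)])
      have evV: "\<forall>\<^sub>F s in nhds 0. k ` \<pi> (c s) \<in> V" by (rule has_velocityD(1)[OF vel V(1) c0(1)])
      have inv: "inv_into U \<phi> (\<phi> p) = p" if "p \<in> U" for p
        using chartD(2)[OF U(1)] that by (rule inv_into_f_f)
      have "\<forall>\<^sub>F s in nhds 0. \<phi> (\<pi> (c s)) \<in> ?S" using evU evV by eventually_elim auto
      then have evS: "\<forall>\<^sub>F s in at 0. \<phi> (\<pi> (c s)) \<in> ?S" by (simp add: eventually_nhds_conv_at)
      have sm: "smooth_on ?S ?T" using smooth_map_image U(1) V(1) unfolding smooth_map_def by fast
      have "((\<lambda>s. ?T (\<phi> (\<pi> (c s)))) has_vector_derivative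
          differential ?S ?T (\<phi> (\<pi> x)) (d\<pi> x u (U, \<phi>))) (at 0)"
        by (rule differential_along_curve[OF sm _ _ evS has_velocityD(2)[OF vel0 U(1) c0(2)]])
          (use c(1) c0 in auto)
      moreover have "\<forall>\<^sub>F s in nhds 0. s \<in> UNIV \<longrightarrow> ?T (\<phi> (\<pi> (c s))) = \<psi> (k ` \<pi> (c s))"
        using evU by eventually_elim (simp add: inv)
      from has_vector_derivative_cong_ev[OF this] have
        "((\<lambda>s. ?T (\<phi> (\<pi> (c s)))) has_vector_derivative v) (at 0)
          = ((\<lambda>s. \<psi> (k ` \<pi> (c s))) has_vector_derivative v) (at 0)" for v
        using c0(2) by (simp add: inv)
      ultimately have "((\<lambda>s. \<psi> (k ` \<pi> (c s))) has_vector_derivative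
          differential ?S ?T (\<phi> (\<pi> x)) (d\<pi> x u (U, \<phi>))) (at 0)" by blast
      moreover have "((\<lambda>s. \<psi> (k ` \<pi> (c s))) has_vector_derivative d\<pi> (k x) (L u) (V, \<psi>)) (at 0)"
        by (rule has_velocityD(2)[OF vel V(1) c0(1)])
      ultimately show ?thesis by (rule vector_derivative_unique_at)
    qed
    finally show ?thesis by (simp add: \<kappa>)
  qed
qed

end

lemma (in isometric_quotient) group_symmetry:
  assumes k: "k \<in> \<Gamma>" shows "quotient_symmetry \<Gamma> M k"
proof unfold_locales
  have G: "a \<circ> b \<in> \<Gamma>" "bij a" "inv a \<in> \<Gamma>" if "a \<in> \<Gamma>" "b \<in> \<Gamma>" for a b
    using group that by (auto simp: isometry_group_def)
  show "bij k" using G(2) k by blast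
  show "dist (k x) (k y) = dist x y" for x y using group k by (auto simp: isometry_group_def)
  show "k ` M = M" using invariant k by blast
  show "(\<lambda>g. k \<circ> g \<circ> inv k) ` \<Gamma> = \<Gamma>"
  proof (intro equalityI subsetI)
    fix a assume "a \<in> (\<lambda>g. k \<circ> g \<circ> inv k) ` \<Gamma>"
    then obtain g where g: "g \<in> \<Gamma>" "a = k \<circ> g \<circ> inv k" by auto
    then show "a \<in> \<Gamma>" using G(1)[OF G(1)[OF k g(1)] G(3)[OF k k]] by simp
  next
    fix a assume a: "a \<in> \<Gamma>"
    have "a = k \<circ> (inv k \<circ> a \<circ> k) \<circ> inv k"
      using G(2)[OF k k] by (auto simp: fun_eq_iff bij_is_surj surj_f_inv_f)
    moreover have "inv k \<circ> a \<circ> k \<in> \<Gamma>" by (rule G(1)[OF G(1)[OF G(3)[OF k k] a] k])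
    ultimately show "a \<in> (\<lambda>g. k \<circ> g \<circ> inv k) ` \<Gamma>" by blast
  qed
qed

text \<open>Moving a curve by an element of \<open>\<Gamma>\<close> does not change its projection.\<close>

lemma (in isometric_quotient) d\<pi>_group:
  assumes k: "k \<in> \<Gamma>" and x: "x \<in> M" and u: "u \<in> tangent_space M x"
  shows "d\<pi> (k x) (linear_part k u) = d\<pi> x u"
proof -
  interpret K: quotient_symmetry \<Gamma> M k by (rule group_symmetry[OF k])
  obtain c where c: "c 0 = x" "range c \<subseteq> M" "(c has_vector_derivative u) (at 0)"
    using u by (auto simp: tangent_space_def)
  have ev: "\<forall>\<^sub>F s in at 0. c s \<in> M" by (rule always_eventually) (use c(2) in blast)
  have "k ` \<pi> y = \<pi> y" for y
    unfolding K.image_orbit using k by (intro orbit_eq) (auto simp: orbit_def)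
  then have "has_velocity \<A> (\<lambda>s. \<pi> (c s)) 0 (d\<pi> (k x) (linear_part k u))"
    using K.has_velocity_image[OF c(1) x ev c(3)] by simp
  then show ?thesis
    by (rule has_velocity_unique) (rule has_velocity_projection[OF c(1) x ev c(3)])
qed

text \<open>The metric is defined at an arbitrarily chosen point \<open>y\<close> of the orbit. If \<open>y = k x\<close>
then the linear part of \<open>k\<close> transports horizontal lifts from \<open>x\<close> to \<open>y\<close> and preserves inner
products.\<close>

lemma (in isometric_quotient) quotient_metric_eq:
  assumes x: "x \<in> M" and u: "u \<in> horizontal x" "w \<in> horizontal x"
  shows "quotient_metric \<Gamma> M (\<pi> x) (d\<pi> x u) (d\<pi> x w) = u \<bullet> w"
proof -
  define y where "y = (SOME y. y \<in> \<pi> x)"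
  have "y \<in> \<pi> x" unfolding y_def using in_orbit_self by (rule someI)
  then obtain k where k: "k \<in> \<Gamma>" "y = k x" by (auto simp: orbit_def)
  interpret K: quotient_symmetry \<Gamma> M k by (rule group_symmetry[OF k(1)])
  have lift: "horizontal_lift \<Gamma> M y (d\<pi> x v) = linear_part k v" if v: "v \<in> horizontal x" for v
    using horizontal_lift_eq[OF _ K.horizontal_image[OF v]] d\<pi>_group[OF k(1) x horizontal_tangent[OF v]]
      k(2) x K.mem_level_iff by simp
  have "quotient_metric \<Gamma> M (\<pi> x) (d\<pi> x u) (d\<pi> x w) = linear_part k u \<bullet> linear_part k w"
    unfolding quotient_metric_def Let_def y_def[symmetric] by (simp add: lift u)
  then show ?thesis using K.orthogonal_L by (simp add: orthogonal_transformation_def)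
qed

lemma (in quotient_symmetry) isometry_image:
  "riemannian_isometry \<A> (quotient_metric \<Gamma> M) ((`) k)"
  unfolding riemannian_isometry_def
proof (intro conjI ballI)
  interpret I: quotient_symmetry \<Gamma> M "inv k" by (rule inverse_symmetry)
  note kk = inv_cancel
  have inj: "inj_on ((`) k) (carrier_of \<A>)"
    by (rule inj_onI) (simp add: inj_image_eq_iff[OF bij_is_inj[OF bij]])
  have onto: "k ` (inv k ` p) = p" for p by (simp add: image_image kk)
  have mem: "inv k ` p \<in> carrier_of \<A>" if "p \<in> carrier_of \<A>" for p
    using that by (auto simp: carrier I.image_orbit I.mem_level_iff)
  have "k ` p \<in> carrier_of \<A>" if "p \<in> carrier_of \<A>" for p
    using that by (auto simp: carrier image_orbit mem_level_iff)
  then have "(`) k ` carrier_of \<A> = carrier_of \<A>"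
    using mem onto by (metis (no_types, lifting) image_eqI image_subset_iff subsetI subset_antisym)
  with inj show "bij_betw ((`) k) (carrier_of \<A>) (carrier_of \<A>)" by (simp add: bij_betw_def)
  show "smooth_map \<A> ((`) k)" by (rule smooth_map_image)
  have "inv k ` p = inv_into (carrier_of \<A>) ((`) k) p" if "p \<in> carrier_of \<A>" for p
    using inv_into_f_f[OF inj mem[OF that]] by (simp add: onto)
  then show "smooth_map \<A> (inv_into (carrier_of \<A>) ((`) k))"
    by (rule smooth_map_cong[OF _ I.smooth_map_image])
  fix p V W assume p: "p \<in> carrier_of \<A>" and VW: "V \<in> tangent_vectors \<A> p" "W \<in> tangent_vectors \<A> p"
  obtain x where x: "x \<in> M" "p = \<pi> x" using p by (auto simp: carrier)
  obtain u where u: "u \<in> horizontal x" "V = d\<pi> x u"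
    using tangent_vectors_horizontal[OF _ x(1)] VW(1) x(2) by blast
  obtain w where w: "w \<in> horizontal x" "W = d\<pi> x w"
    using tangent_vectors_horizontal[OF _ x(1)] VW(2) x(2) by blast
  have "quotient_metric \<Gamma> M (k ` p) (push_forward \<A> ((`) k) p V) (push_forward \<A> ((`) k) p W)
      = quotient_metric \<Gamma> M (\<pi> (k x)) (d\<pi> (k x) (L u)) (d\<pi> (k x) (L w))"
    unfolding x(2) u(2) w(2) image_orbit
    by (simp add: push_forward_d\<pi> x(1) horizontal_tangent u(1) w(1))
  also have "\<dots> = L u \<bullet> L w"
    by (rule quotient_metric_eq) (use x(1) u(1) w(1) mem_level_iff horizontal_image in auto)
  also have "\<dots> = u \<bullet> w" using orthogonal_L by (simp add: orthogonal_transformation_def)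
  also have "\<dots> = quotient_metric \<Gamma> M p V W"
    unfolding x(2) u(2) w(2) by (rule quotient_metric_eq[symmetric, OF x(1) u(1) w(1)])
  finally show "quotient_metric \<Gamma> M (k ` p) (push_forward \<A> ((`) k) p V) (push_forward \<A> ((`) k) p W)
      = quotient_metric \<Gamma> M p V W" .
qed

section \<open>The distance between orbits\<close>

context isometric_quotient begin

text \<open>A nearly shortest segment between the two orbits can be moved by an element
of \<open>\<Gamma>\<close> so that it starts at the given point \<open>x\<close>.\<close>

lemma setdist_orbit_attained:
  assumes "setdist (\<pi> x) (\<pi> y) < b"
  obtains z where "z \<in> \<pi> y" "dist x z < b"
proof -
  have ne: "\<pi> x \<noteq> {}" "\<pi> y \<noteq> {}" using in_orbit_self by blast+
  obtain a z where az: "a \<in> \<pi> x" "z \<in> \<pi> y" "dist a z < b"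
    using setdist_ltE[OF assms ne] by blast
  obtain g where g: "g \<in> \<Gamma>" "a = g x" using az(1) by (auto simp: orbit_def)
  have i: "bij g" "inv g \<in> \<Gamma>" and d: "dist (g u) (g v) = dist u v" for u v
    using group g(1) by (auto simp: isometry_group_def)
  have gz: "g (inv g z) = z" using i(1) by (simp add: bij_is_surj surj_f_inv_f)
  show thesis
  proof
    have "inv g z \<in> \<pi> z" using i(2) by (auto simp: orbit_def)
    then show "inv g z \<in> \<pi> y" using orbit_eq[OF az(2)] by simp
    show "dist x (inv g z) < b" using az(3) d[of x "inv g z"] by (simp add: g(2) gz)
  qed
qed

lemma setdist_orbit_triangle: "setdist (\<pi> x) (\<pi> z) \<le> setdist (\<pi> x) (\<pi> y) + setdist (\<pi> y) (\<pi> z)"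
proof (rule field_le_epsilon)
  fix e :: real assume "0 < e"
  obtain y' where y': "y' \<in> \<pi> y" "dist x y' < setdist (\<pi> x) (\<pi> y) + e / 2"
    using setdist_orbit_attained[of x y "setdist (\<pi> x) (\<pi> y) + e / 2"] \<open>0 < e\<close> by auto
  have eq: "\<pi> y' = \<pi> y" by (rule orbit_eq[OF y'(1)])
  obtain z' where z': "z' \<in> \<pi> z" "dist y' z' < setdist (\<pi> y) (\<pi> z) + e / 2"
    using setdist_orbit_attained[of y' z "setdist (\<pi> y) (\<pi> z) + e / 2"] \<open>0 < e\<close> eq by auto
  have "setdist (\<pi> x) (\<pi> z) \<le> dist x z'" by (rule setdist_le_dist[OF in_orbit_self z'(1)])
  also have "\<dots> \<le> dist x y' + dist y' z'" by (rule dist_triangle)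
  finally show "setdist (\<pi> x) (\<pi> z) \<le> setdist (\<pi> x) (\<pi> y) + setdist (\<pi> y) (\<pi> z) + e"
    using y'(2) z'(2) by simp
qed

lemma orbits_close_in_chart:
  assumes U: "(U, \<phi>) \<in> \<A>" and x: "x \<in> M" "\<pi> x \<in> U" and "0 < \<epsilon>"
  obtains r where "0 < r" "\<forall>p\<in>U. dist (\<phi> p) (\<phi> (\<pi> x)) < r \<longrightarrow> setdist p (\<pi> x) < \<epsilon>"
proof -
  obtain C where C: "0 < C" "\<forall>\<eta>>0. \<exists>\<delta>>0. \<forall>v\<in>tangent_space M x. \<forall>p\<in>U.
    norm v < \<delta> \<longrightarrow> norm (\<phi> p - \<phi> (\<pi> x)) < \<delta> \<longrightarrow>
    (\<exists>y\<in>p. y \<in> M \<and> norm (y - x - v) \<le>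
       C * norm (\<phi> p - \<phi> (\<pi> x) - d\<pi> x v (U, \<phi>)) + \<eta> * (norm v + norm (\<phi> p - \<phi> (\<pi> x))))"
    by (rule submersion_at[OF U x])
  obtain \<delta> where \<delta>: "0 < \<delta>" "\<forall>v\<in>tangent_space M x. \<forall>p\<in>U.
    norm v < \<delta> \<longrightarrow> norm (\<phi> p - \<phi> (\<pi> x)) < \<delta> \<longrightarrow>
    (\<exists>y\<in>p. y \<in> M \<and> norm (y - x - v) \<le>
       C * norm (\<phi> p - \<phi> (\<pi> x) - d\<pi> x v (U, \<phi>)) + 1 * (norm v + norm (\<phi> p - \<phi> (\<pi> x))))"
    using C(2)[rule_format, OF zero_less_one] by (elim exE conjE)
  have 0: "0 \<in> tangent_space M x" by (rule subspace_0[OF subspace_tangent_space[OF submanifold x(1)]])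
  have d0: "d\<pi> x 0 (U, \<phi>) = 0" using linear_0[OF linear_d\<pi>[OF U x]] .
  show thesis
  proof (rule that[of "min \<delta> (\<epsilon> / (C + 1))"], goal_cases)
    case 1
    show ?case using \<delta>(1) C(1) \<open>0 < \<epsilon>\<close> by simp
  next
    case 2
    show ?case
    proof (intro ballI impI)
      fix p assume p: "p \<in> U" "dist (\<phi> p) (\<phi> (\<pi> x)) < min \<delta> (\<epsilon> / (C + 1))"
      then have "norm (\<phi> p - \<phi> (\<pi> x)) < \<delta>" by (simp add: dist_norm)
      with \<delta>(2)[rule_format, OF 0 p(1)] \<delta>(1) obtain y where y: "y \<in> p"
        "norm (y - x) \<le> C * norm (\<phi> p - \<phi> (\<pi> x)) + norm (\<phi> p - \<phi> (\<pi> x))"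
        by (auto simp: d0)
      have "setdist p (\<pi> x) \<le> dist y x" by (rule setdist_le_dist[OF y(1) in_orbit_self])
      also have "\<dots> \<le> (C + 1) * norm (\<phi> p - \<phi> (\<pi> x))" using y(2) by (simp add: dist_norm algebra_simps)
      also have "\<dots> < \<epsilon>"
      proof -
        have "norm (\<phi> p - \<phi> (\<pi> x)) < \<epsilon> / (C + 1)" using p(2) by (simp add: dist_norm)
        then show ?thesis using C(1) by (simp add: pos_less_divide_eq mult.commute)
      qed
      finally show "setdist p (\<pi> x) < \<epsilon>" .
    qed
  qed
qed

lemma eventually_chart_ball:
  assumes c: "continuous_map (top_of_set A) (manifold_topology \<A>) c" and t: "t \<in> (A :: real set)"
    and U: "(U, \<phi>) \<in> \<A>" "c t \<in> U" and "0 < r"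
  shows "\<forall>\<^sub>F s in at t within A. c s \<in> U \<and> dist (\<phi> (c s)) (\<phi> (c t)) < r"
proof -
  let ?N = "U \<inter> \<phi> -` ball (\<phi> (c t)) r"
  have "?N \<in> {U \<inter> \<phi> -` W | U \<phi> W. (U, \<phi>) \<in> \<A> \<and> open W}" using U(1) by blast
  then have "openin (manifold_topology \<A>) ?N"
    unfolding manifold_topology_def by (rule topology_generated_by_Basis)
  then have "openin (top_of_set A) {s \<in> topspace (top_of_set A). c s \<in> ?N}"
    by (rule openin_continuous_map_preimage[OF c])
  then have "\<exists>T. open T \<and> {s \<in> A. c s \<in> ?N} = A \<inter> T"
    unfolding openin_open topspace_euclidean_subtopology .
  then obtain T where T: "open T" "{s \<in> A. c s \<in> ?N} = A \<inter> T" by (elim exE conjE)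
  have "t \<in> {s \<in> A. c s \<in> ?N}" using t U(2) \<open>0 < r\<close> by simp
  then have "t \<in> T" unfolding T(2) by simp
  then show ?thesis
    unfolding eventually_at_topological using T(1) \<open>t \<in> T\<close>
  proof (intro exI[of _ T] conjI ballI impI)
    fix s assume "s \<in> T" "s \<in> A"
    then have "s \<in> {s \<in> A. c s \<in> ?N}" using T(2) by blast
    then show "c s \<in> U" "dist (\<phi> (c s)) (\<phi> (c t)) < r" by (auto simp: dist_commute)
  qed
qed

lemma tnorm_quotient:
  assumes "x \<in> M" "u \<in> horizontal x"
  shows "tnorm (quotient_metric \<Gamma> M) (\<pi> x) (d\<pi> x u) = norm u"
  by (simp add: tnorm_def quotient_metric_eq assms norm_eq_sqrt_inner)

lemma tnorm_nonneg: "0 \<le> tnorm (quotient_metric \<Gamma> M) p V"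
  by (simp add: tnorm_def quotient_metric_def Let_def)

text \<open>This is the first order horizontal lift. With \<open>u\<close> the horizontal lift of the
velocity, \<open>submersion_at\<close> puts a point of the orbit \<open>c s\<close> within \<open>\<epsilon> \<bar>s - t\<bar>\<close> of \<open>x + (s - t) u\<close>.\<close>

lemma speed_bounds_setdist:
  assumes V: "has_velocity \<A> c t V" and x: "x \<in> M" "c t = \<pi> x" and "0 < \<epsilon>"
  obtains \<delta> where "0 < \<delta>" "\<forall>s. \<bar>s - t\<bar> < \<delta> \<longrightarrow>
    setdist (c s) (c t) \<le> (tnorm (quotient_metric \<Gamma> M) (c t) V + \<epsilon>) * \<bar>s - t\<bar>"
proof -
  obtain u where u: "u \<in> horizontal x" "V = d\<pi> x u"
    using velocity_horizontal[OF V x(1) x(2)[symmetric]] by blast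
  have tn: "tnorm (quotient_metric \<Gamma> M) (c t) V = norm u"
    unfolding u(2) x(2) by (rule tnorm_quotient[OF x(1) u(1)])
  obtain U \<phi> where U: "(U, \<phi>) \<in> \<A>" "\<pi> x \<in> U" by (rule chart_exists[OF x(1)])
  have ctU: "c t \<in> U" using U(2) x(2) by simp
  define w where "w = d\<pi> x u (U, \<phi>)"
  obtain C where C: "0 < C" "\<forall>\<eta>>0. \<exists>\<delta>>0. \<forall>v\<in>tangent_space M x. \<forall>p\<in>U.
    norm v < \<delta> \<longrightarrow> norm (\<phi> p - \<phi> (\<pi> x)) < \<delta> \<longrightarrow>
    (\<exists>y\<in>p. y \<in> M \<and> norm (y - x - v) \<le>
       C * norm (\<phi> p - \<phi> (\<pi> x) - d\<pi> x v (U, \<phi>)) + \<eta> * (norm v + norm (\<phi> p - \<phi> (\<pi> x))))"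
    by (rule submersion_at[OF U(1) x(1) U(2)])
  define \<kappa> where "\<kappa> = min 1 (\<epsilon> / (2 * C))"
  \<comment> \<open>The data \<open>v = (s - t) u\<close> and \<open>\<phi> (c s) - \<phi> (c t)\<close> of the lift have total size at most \<open>K \<bar>s - t\<bar>\<close>.\<close>
  define K where "K = norm u + norm w + 1"
  define \<eta> where "\<eta> = \<epsilon> / (2 * K)"
  have K: "0 < K" by (simp add: K_def add_nonneg_pos)
  have \<kappa>: "0 < \<kappa>" "\<kappa> \<le> 1" "C * \<kappa> \<le> \<epsilon> / 2"
  proof -
    have "\<kappa> \<le> \<epsilon> / (2 * C)" by (simp add: \<kappa>_def)
    then have "\<kappa> * (2 * C) \<le> \<epsilon>" using C(1) by (subst (asm) pos_le_divide_eq) auto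
    then show "C * \<kappa> \<le> \<epsilon> / 2" by (simp add: mult_ac)
  qed (use C(1) \<open>0 < \<epsilon>\<close> in \<open>auto simp: \<kappa>_def\<close>)
  have \<eta>: "0 < \<eta>" "\<eta> * K = \<epsilon> / 2" using K \<open>0 < \<epsilon>\<close> by (auto simp: \<eta>_def)
  obtain \<delta>1 where \<delta>1: "0 < \<delta>1" "\<forall>v\<in>tangent_space M x. \<forall>p\<in>U.
    norm v < \<delta>1 \<longrightarrow> norm (\<phi> p - \<phi> (\<pi> x)) < \<delta>1 \<longrightarrow>
    (\<exists>y\<in>p. y \<in> M \<and> norm (y - x - v) \<le>
       C * norm (\<phi> p - \<phi> (\<pi> x) - d\<pi> x v (U, \<phi>)) + \<eta> * (norm v + norm (\<phi> p - \<phi> (\<pi> x))))"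
    using C(2)[rule_format, OF \<eta>(1)] by (elim exE conjE)
  have dc: "((\<lambda>s. \<phi> (c s)) has_vector_derivative w) (at t)"
    using has_velocityD(2)[OF V U(1) ctU] by (simp add: w_def u(2))
  obtain \<delta>2 where \<delta>2: "0 < \<delta>2" "\<And>s. \<bar>s - t\<bar> < \<delta>2 \<Longrightarrow>
      norm (\<phi> (c s) - \<phi> (c t) - (s - t) *\<^sub>R w) \<le> \<kappa> * \<bar>s - t\<bar>"
    using dc \<kappa>(1) unfolding has_vector_derivative_def has_derivative_at_alt real_norm_def by meson
  obtain \<delta>3 where \<delta>3: "0 < \<delta>3" "\<And>s. \<bar>s - t\<bar> < \<delta>3 \<Longrightarrow> c s \<in> U"
    using has_velocityD(1)[OF V U(1) ctU] unfolding eventually_nhds_metric dist_real_def by blast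
  have lin: "d\<pi> x (r *\<^sub>R u) (U, \<phi>) = r *\<^sub>R w" for r
    unfolding w_def using linear_scale[OF linear_d\<pi>[OF U(1) x(1) U(2)]] .
  have sub: "subspace (tangent_space M x)" by (rule subspace_tangent_space[OF submanifold x(1)])
  show thesis
  proof (rule that[of "min (min \<delta>2 \<delta>3) (\<delta>1 / K)"], goal_cases)
    case 1
    show ?case using \<delta>1(1) \<delta>2(1) \<delta>3(1) K by simp
  next
    case 2
    show ?case
    proof (intro allI impI)
      fix s assume s: "\<bar>s - t\<bar> < min (min \<delta>2 \<delta>3) (\<delta>1 / K)"
      define h where "h = \<bar>s - t\<bar>"
      have h: "0 \<le> h" "h * K < \<delta>1"
        using s K by (auto simp: h_def pos_less_divide_eq)
      have e1: "norm (\<phi> (c s) - \<phi> (c t) - (s - t) *\<^sub>R w) \<le> \<kappa> * h"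
        using \<delta>2(2) s by (simp add: h_def)
      have "norm (\<phi> (c s) - \<phi> (c t)) \<le> norm (\<phi> (c s) - \<phi> (c t) - (s - t) *\<^sub>R w) + norm ((s - t) *\<^sub>R w)"
        by (metis diff_add_cancel norm_triangle_ineq)
      also have "\<dots> \<le> \<kappa> * h + h * norm w" using e1 by (simp add: h_def)
      also have "\<dots> \<le> (1 + norm w) * h"
        using mult_right_mono[OF \<kappa>(2) h(1)] by (simp add: algebra_simps)
      finally have e2: "norm (\<phi> (c s) - \<phi> (c t)) \<le> (1 + norm w) * h" .
      have nu: "norm ((s - t) *\<^sub>R u) = h * norm u" by (simp add: h_def)
      have hK: "h * norm u + (1 + norm w) * h = K * h" by (simp add: K_def algebra_simps)
      have pos: "0 \<le> (1 + norm w) * h" "0 \<le> h * norm u" using h(1) by simp_all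
      have Kh: "K * h < \<delta>1" using h(2) by (simp only: mult.commute)
      have "norm ((s - t) *\<^sub>R u) < \<delta>1"
        unfolding nu using hK pos Kh by linarith
      moreover have "norm (\<phi> (c s) - \<phi> (\<pi> x)) < \<delta>1"
        using e2 hK pos Kh unfolding x(2)[symmetric] by linarith
      moreover have "c s \<in> U" using \<delta>3(2) s by simp
      moreover have "(s - t) *\<^sub>R u \<in> tangent_space M x"
        by (rule subspace_scale[OF sub horizontal_tangent[OF u(1)]])
      ultimately obtain y where y: "y \<in> c s" "norm (y - x - (s - t) *\<^sub>R u) \<le>
          C * norm (\<phi> (c s) - \<phi> (c t) - (s - t) *\<^sub>R w)
          + \<eta> * (norm ((s - t) *\<^sub>R u) + norm (\<phi> (c s) - \<phi> (c t)))"
        using \<delta>1(2) unfolding x(2) lin[symmetric] by meson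
      have "setdist (c s) (c t) \<le> dist y x"
        using y(1) in_orbit_self x(2) by (intro setdist_le_dist) auto
      also have "\<dots> \<le> norm (y - x - (s - t) *\<^sub>R u) + norm ((s - t) *\<^sub>R u)"
        unfolding dist_norm by (metis diff_add_cancel norm_triangle_ineq)
      also have "norm (y - x - (s - t) *\<^sub>R u) \<le> C * (\<kappa> * h) + \<eta> * (K * h)"
      proof -
        have "C * norm (\<phi> (c s) - \<phi> (c t) - (s - t) *\<^sub>R w) \<le> C * (\<kappa> * h)"
          using e1 C(1) by simp
        moreover have "\<eta> * (norm ((s - t) *\<^sub>R u) + norm (\<phi> (c s) - \<phi> (c t))) \<le> \<eta> * (K * h)"
        proof (rule mult_left_mono)
          show "norm ((s - t) *\<^sub>R u) + norm (\<phi> (c s) - \<phi> (c t)) \<le> K * h"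
            unfolding nu using e2 hK by linarith
        qed (use \<eta>(1) in simp)
        ultimately show ?thesis using y(2) by linarith
      qed
      also have "C * (\<kappa> * h) + \<eta> * (K * h) = (C * \<kappa>) * h + (\<eta> * K) * h" by (simp only: mult.assoc)
      also have "\<dots> \<le> \<epsilon> / 2 * h + \<epsilon> / 2 * h"
        using mult_right_mono[OF \<kappa>(3) h(1)] by (simp add: \<eta>(2))
      also have "norm ((s - t) *\<^sub>R u) = norm u * h" unfolding nu by (rule mult.commute)
      finally show "setdist (c s) (c t) \<le> (tnorm (quotient_metric \<Gamma> M) (c t) V + \<epsilon>) * \<bar>s - t\<bar>"
        by (simp add: tn h_def algebra_simps)
    qed
  qed
qed

lemma setdist_le_curve_length:
  assumes c: "piecewise_C1_curve \<A> c"
  shows "ennreal (setdist (c 0) (c 1)) \<le> curve_length \<A> (quotient_metric \<Gamma> M) c"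
proof -
  have cont: "continuous_map (top_of_set {0..1}) (manifold_topology \<A>) c"
    using c by (simp add: piecewise_C1_curve_def)
  obtain F where F: "finite F"
    "\<forall>(U, \<phi>)\<in>\<A>. (\<phi> \<circ> c) C1_differentiable_on ({t\<in>{0<..<1}. c t \<in> U} - F)"
    using c unfolding piecewise_C1_curve_def by blast
  have rep: "\<exists>x\<in>M. c t = \<pi> x" if "t \<in> {0..1}" for t
  proof -
    have "c t \<in> topspace (manifold_topology \<A>)"
      using continuous_map_image_subset_topspace[OF cont] that by auto
    then show ?thesis by (auto simp: topspace_manifold_topology carrier)
  qed
  show ?thesis
    unfolding curve_length_def
  proof (rule pseudometric_le_speed_integral[where F = F and \<delta> = "\<lambda>s t. setdist (c s) (c t)"])
    show "setdist (c s) (c s) = 0" for s by (rule setdist_refl)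
    show "setdist (c s) (c t) = setdist (c t) (c s)" for s t by (rule setdist_sym)
    show "setdist (c r) (c t) \<le> setdist (c r) (c s) + setdist (c s) (c t)"
      if "r \<in> {0..1}" "s \<in> {0..1}" "t \<in> {0..1}" for r s t
      using rep that setdist_orbit_triangle by metis
    show "((\<lambda>s. setdist (c s) (c t)) \<longlongrightarrow> 0) (at t within {0..1})" if t: "t \<in> {0..1}" for t
    proof (rule tendstoI)
      fix e :: real assume "0 < e"
      obtain x where x: "x \<in> M" "c t = \<pi> x" using rep t by blast
      obtain U \<phi> where U: "(U, \<phi>) \<in> \<A>" "\<pi> x \<in> U" by (rule chart_exists[OF x(1)])
      obtain r where r: "0 < r" "\<forall>p\<in>U. dist (\<phi> p) (\<phi> (\<pi> x)) < r \<longrightarrow> setdist p (\<pi> x) < e"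
        by (rule orbits_close_in_chart[OF U(1) x(1) U(2) \<open>0 < e\<close>])
      have "\<forall>\<^sub>F s in at t within {0..1}. c s \<in> U \<and> dist (\<phi> (c s)) (\<phi> (c t)) < r"
        by (rule eventually_chart_ball[OF cont t U(1) _ r(1)]) (simp add: x(2) U(2))
      then show "\<forall>\<^sub>F s in at t within {0..1}. dist (setdist (c s) (c t)) 0 < e"
        by eventually_elim (use r(2) x(2) in auto)
    qed
    show "finite F" by (rule F(1))
    show "0 \<le> tnorm (quotient_metric \<Gamma> M) (c t) (velocity \<A> c t)" for t by (rule tnorm_nonneg)
    fix t \<epsilon> :: real assume t: "t \<in> {0<..<1} - F" and \<epsilon>: "0 < \<epsilon>"
    obtain x where x: "x \<in> M" "c t = \<pi> x" using rep[of t] t by auto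
    \<comment> \<open>The velocity exists outside \<open>F\<close>, so that the description operator in \<open>velocity\<close> denotes it.\<close>
    define V where "V = (\<lambda>(U, \<phi>). if (U, \<phi>) \<in> \<A> \<and> c t \<in> U then vector_derivative (\<phi> \<circ> c) (at t) else 0)"
    have "has_velocity \<A> c t V"
      unfolding has_velocity_def
    proof (intro conjI allI impI)
      fix \<kappa> :: "('a set, 'a) chart" assume "\<kappa> \<notin> \<A> \<or> c t \<notin> fst \<kappa>"
      then show "V \<kappa> = 0" by (cases \<kappa>) (auto simp: V_def)
    next
      show "\<forall>(U, \<phi>)\<in>\<A>. c t \<in> U \<longrightarrow> (\<forall>\<^sub>F s in nhds t. c s \<in> U) \<and>
        (\<phi> \<circ> c has_vector_derivative V (U, \<phi>)) (at t)"
      proof (clarify)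
        fix U \<phi> assume U: "(U, \<phi>) \<in> \<A>" "c t \<in> U"
        have "\<forall>\<^sub>F s in at t within {0..1}. c s \<in> U \<and> dist (\<phi> (c s)) (\<phi> (c t)) < 1"
          by (rule eventually_chart_ball[OF cont _ U]) (use t in auto)
        moreover have "at t within {0..1} = at t" using t by (simp add: at_within_Icc_at)
        ultimately have "\<forall>\<^sub>F s in at t. c s \<in> U" by (auto elim: eventually_mono)
        then have ev: "\<forall>\<^sub>F s in nhds t. c s \<in> U" using U(2) by (simp add: eventually_nhds_conv_at)
        have "(\<phi> \<circ> c) C1_differentiable_on ({t\<in>{0<..<1}. c t \<in> U} - F)" using F(2) U(1) by fast
        then have "(\<phi> \<circ> c) differentiable (at t)"
          unfolding C1_differentiable_on_eq using t U(2) by simp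
        then have "(\<phi> \<circ> c has_vector_derivative V (U, \<phi>)) (at t)"
          using U by (simp add: V_def vector_derivative_works)
        with ev show "(\<forall>\<^sub>F s in nhds t. c s \<in> U) \<and> (\<phi> \<circ> c has_vector_derivative V (U, \<phi>)) (at t)" ..
      qed
    qed
    then have V: "has_velocity \<A> c t (velocity \<A> c t)" by (simp add: velocity_eqI)
    obtain \<delta> where "0 < \<delta>" "\<forall>s. \<bar>s - t\<bar> < \<delta> \<longrightarrow>
      setdist (c s) (c t) \<le> (tnorm (quotient_metric \<Gamma> M) (c t) (velocity \<A> c t) + \<epsilon>) * \<bar>s - t\<bar>"
      by (rule speed_bounds_setdist[OF V x \<epsilon>])
    then show "\<exists>\<eta>>0. \<forall>s\<in>{0<..<1}. \<bar>s - t\<bar> < \<eta> \<longrightarrow>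
      setdist (c s) (c t) \<le> (tnorm (quotient_metric \<Gamma> M) (c t) (velocity \<A> c t) + \<epsilon>) * \<bar>s - t\<bar>"
      by blast
  qed simp
qed

lemma setdist_le_riem_dist: "ennreal (setdist p q) \<le> riem_dist \<A> (quotient_metric \<Gamma> M) p q"
  unfolding riem_dist_def using setdist_le_curve_length by (intro INF_greatest) blast

text \<open>The constant curve has length \<open>0\<close>; this makes every point a member of its own
component, as a base point for the growth estimate.\<close>

lemma riem_dist_refl_finite:
  assumes "p \<in> carrier_of \<A>"
  shows "riem_dist \<A> (quotient_metric \<Gamma> M) p p < \<infinity>"
proof -
  obtain x where x: "x \<in> M" "p = \<pi> x" using assms by (auto simp: carrier)
  have const: "has_velocity \<A> (\<lambda>_. p) t (\<lambda>_. 0)" for t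
    unfolding has_velocity_def by (auto simp: o_def)
  have "has_velocity \<A> (\<lambda>_. p) 0 (d\<pi> x 0)"
    unfolding x(2) by (rule has_velocity_projection[of "\<lambda>_. x"]) (use x(1) in auto)
  then have d0: "d\<pi> x 0 = (\<lambda>_. 0)" using has_velocity_unique[OF _ const] by blast
  have "0 \<in> horizontal x"
    using subspace_0[OF subspace_tangent_space[OF submanifold x(1)]] by (simp add: horizontal_space_def)
  then have "tnorm (quotient_metric \<Gamma> M) p (\<lambda>_. 0) = 0"
    using tnorm_quotient[OF x(1), of 0] by (simp add: d0 x(2))
  then have "curve_length \<A> (quotient_metric \<Gamma> M) (\<lambda>_. p) = 0"
    by (simp add: curve_length_def velocity_eqI[OF const])
  moreover have "piecewise_C1_curve \<A> (\<lambda>_. p)"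
    unfolding piecewise_C1_curve_def using assms
    by (auto simp: topspace_manifold_topology o_def intro!: exI[of _ "{}"])
  ultimately have "riem_dist \<A> (quotient_metric \<Gamma> M) p p \<le> 0"
    unfolding riem_dist_def by (intro INF_lower2[of "\<lambda>_. p"]) auto
  then show ?thesis by (simp add: le_less_trans)
qed

end

section \<open>One-parameter groups of isometries\<close>

text \<open>Differentiability in time is deduced below from continuity, as for any continuous
one-parameter group of matrices.\<close>

locale isometric_flow =
  fixes \<gamma> :: "real \<Rightarrow> 'a::euclidean_space \<Rightarrow> 'a"
  assumes iso: "\<And>t x y. dist (\<gamma> t x) (\<gamma> t y) = dist x y"
    and flow: "\<And>s t x. \<gamma> (s + t) x = \<gamma> s (\<gamma> t x)"
    and flow0: "\<And>x. \<gamma> 0 x = x"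
    and cont: "\<And>x. continuous_on UNIV (\<lambda>t. \<gamma> t x)"
begin

lemma linear_flow_part: "linear (linear_part (\<gamma> t))"
  using orthogonal_linear_part[OF iso] orthogonal_transformation_linear by blast

lemma flow_affine: "\<gamma> t x = linear_part (\<gamma> t) x + \<gamma> t 0"
  by (simp add: linear_part_def)

text \<open>Since \<open>\<gamma> t\<close> is affine it commutes with averages over \<open>[0, h]\<close>, so that
\<open>\<gamma> t\<close> of the average is the average over \<open>[t, t + h]\<close>. This depends differentiably on \<open>t\<close> by the
fundamental theorem of calculus.\<close>

lemma differentiable_average:
  assumes h: "0 < h" "h < 1"
  shows "(\<lambda>t. \<gamma> t ((1 / h) *\<^sub>R integral {0..h} (\<lambda>s. \<gamma> s x))) differentiable (at 0)"
proof -
  define f where "f s = \<gamma> s x" for s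
  have fc: "continuous_on S f" for S
    unfolding f_def[abs_def] using cont continuous_on_subset by blast
  \<comment> \<open>The lower limit \<open>-2\<close> leaves room for negative times, as the derivative at \<open>0\<close> is two-sided.\<close>
  define P where "P u = integral {-2..u} f" for u
  have P: "(P has_vector_derivative f u) (at u)" if "\<bar>u\<bar> < 2" for u
  proof -
    have "(P has_vector_derivative f u) (at u within {-2..2})"
      unfolding P_def[abs_def] by (rule integral_has_vector_derivative[OF fc]) (use that in auto)
    then show ?thesis using that by (simp add: at_within_Icc_at)
  qed
  have avg: "\<gamma> t ((1 / h) *\<^sub>R integral {0..h} f) = (1 / h) *\<^sub>R (P (h + t) - P t)" if t: "\<bar>t\<bar> < 1" for t
  proof -
    let ?L = "linear_part (\<gamma> t)"
    have bl: "bounded_linear ?L" using linear_flow_part by (simp add: linear_conv_bounded_linear)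
    have fi: "f integrable_on {a..b}" for a b by (rule integrable_continuous_interval[OF fc])
    have Li: "(?L \<circ> f) integrable_on {0..h}" by (rule integrable_linear[OF fi bl])
    have "(f \<circ> (\<lambda>s. s + t)) = (\<lambda>s. (?L \<circ> f) s + \<gamma> t 0)"
    proof
      fix s
      have "f (s + t) = \<gamma> t (f s)" unfolding f_def using flow[of t s x] by (simp add: add.commute)
      then show "(f \<circ> (\<lambda>s. s + t)) s = (?L \<circ> f) s + \<gamma> t 0" using flow_affine[of t "f s"] by simp
    qed
    then have "integral {0 + t..h + t} f = integral {0..h} (\<lambda>s. (?L \<circ> f) s + \<gamma> t 0)"
      using integral_shift[where f=f and a=0 and b=h and c=t, OF fc] by simp
    also have "\<dots> = integral {0..h} (?L \<circ> f) + integral {0..h} (\<lambda>s. \<gamma> t 0)"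
      by (rule integral_add[OF Li integrable_const_ivl])
    also have "\<dots> = ?L (integral {0..h} f) + h *\<^sub>R \<gamma> t 0"
      using integral_linear[OF fi bl] h by simp
    finally have "(1 / h) *\<^sub>R integral {t..h + t} f = ?L ((1 / h) *\<^sub>R integral {0..h} f) + \<gamma> t 0"
      using h linear_scale[OF linear_flow_part] by (simp add: scaleR_add_right)
    also have "\<dots> = \<gamma> t ((1 / h) *\<^sub>R integral {0..h} f)" by (rule flow_affine[symmetric])
    also have "integral {t..h + t} f = P (h + t) - P t"
      using Henstock_Kurzweil_Integration.integral_combine[of "-2" t "h + t" f] fi t h by (simp add: P_def algebra_simps)
    finally show ?thesis by simp
  qed
  have "((\<lambda>t. P (h + t)) has_vector_derivative f h) (at 0)"
  proof -
    have "((\<lambda>t::real. h + t) has_vector_derivative 1) (at 0)"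
      by (auto intro!: derivative_eq_intros simp: has_vector_derivative_def)
    from vector_diff_chain_at[OF this, of P "f h"] P[of h] h show ?thesis by (simp add: o_def)
  qed
  then have "((\<lambda>t. (1 / h) *\<^sub>R (P (h + t) - P t)) has_vector_derivative (1 / h) *\<^sub>R (f h - f 0)) (at 0)"
    by (intro bounded_linear.has_vector_derivative[OF bounded_linear_scaleR_right]
        has_vector_derivative_diff P) simp_all
  then have "((\<lambda>t. (1 / h) *\<^sub>R (P (h + t) - P t)) has_derivative (\<lambda>t. t *\<^sub>R ((1 / h) *\<^sub>R (f h - f 0)))) (at 0)"
    by (simp add: has_vector_derivative_def)
  then have "((\<lambda>t. \<gamma> t ((1 / h) *\<^sub>R integral {0..h} f)) has_derivative (\<lambda>t. t *\<^sub>R ((1 / h) *\<^sub>R (f h - f 0)))) (at 0)"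
    by (rule has_derivative_transform_within_open[of _ _ _ _ "{-1<..<1}"]) (use avg in auto)
  then show ?thesis unfolding f_def differentiable_def by blast
qed

lemma average_tendsto: "((\<lambda>h. (1 / h) *\<^sub>R integral {0..h} (\<lambda>s. \<gamma> s x)) \<longlongrightarrow> x) (at_right 0)"
proof -
  define f where "f s = \<gamma> s x" for s
  have fc: "continuous_on S f" for S
    unfolding f_def[abs_def] using cont continuous_on_subset by blast
  define P where "P u = integral {-2..u} f" for u
  have "(P has_vector_derivative f 0) (at 0 within {-2..2})"
    unfolding P_def[abs_def] by (rule integral_has_vector_derivative[OF fc]) auto
  then have "(P has_vector_derivative f 0) (at 0)" by (simp add: at_within_Icc_at)
  then have "((\<lambda>h. (P h - P 0) /\<^sub>R (h - 0)) \<longlongrightarrow> f 0) (at 0)"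
    by (rule has_vector_derivative_quotient_limit)
  then have "((\<lambda>h. (P h - P 0) /\<^sub>R (h - 0)) \<longlongrightarrow> f 0) (at_right 0)"
    by (rule tendsto_within_subset) simp
  moreover have "\<forall>\<^sub>F h in at_right 0. (P h - P 0) /\<^sub>R (h - 0) = (1 / h) *\<^sub>R integral {0..h} f"
  proof (rule eventually_at_rightI[of 0 1])
    fix h :: real assume "h \<in> {0<..<1}"
    then have "integral {-2..0} f + integral {0..h} f = integral {-2..h} f"
      by (intro Henstock_Kurzweil_Integration.integral_combine integrable_continuous_interval fc) auto
    then have "P h - P 0 = integral {0..h} f" unfolding P_def by (metis add_diff_cancel_left')
    then show "(P h - P 0) /\<^sub>R (h - 0) = (1 / h) *\<^sub>R integral {0..h} f"
      by (simp add: inverse_eq_divide)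
  qed simp
  ultimately have "((\<lambda>h. (1 / h) *\<^sub>R integral {0..h} f) \<longlongrightarrow> f 0) (at_right 0)"
    by (rule Lim_transform_eventually)
  then show ?thesis unfolding f_def[abs_def] flow0 .
qed

text \<open>The points at which the flow is differentiable form an affine subspace, which
is closed, and averages of orbits lie in it and converge to any given point.\<close>

lemma flow_differentiable: "(\<lambda>t. \<gamma> t x) differentiable (at 0)"
proof -
  define D where "D = {x. (\<lambda>t. \<gamma> t x) differentiable (at 0)}"
  have "affine D"
    unfolding affine_def
  proof (intro ballI allI impI)
    fix x y u v assume xy: "x \<in> D" "y \<in> D" and uv: "u + v = (1::real)"
    have "\<gamma> t (u *\<^sub>R x + v *\<^sub>R y) = u *\<^sub>R \<gamma> t x + v *\<^sub>R \<gamma> t y" for t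
    proof -
      have "\<gamma> t (u *\<^sub>R x + v *\<^sub>R y) = u *\<^sub>R linear_part (\<gamma> t) x + v *\<^sub>R linear_part (\<gamma> t) y + (u + v) *\<^sub>R \<gamma> t 0"
        using linear_flow_part[of t] uv by (subst flow_affine) (simp add: linear_add linear_scale)
      then show ?thesis by (simp add: linear_part_def algebra_simps)
    qed
    then show "u *\<^sub>R x + v *\<^sub>R y \<in> D"
      using xy by (auto simp: D_def intro!: derivative_intros)
  qed
  then have "closed D" using closed_affine_hull[of D] affine_hull_eq[of D] by metis
  moreover have "\<forall>\<^sub>F h in at_right 0. (1 / h) *\<^sub>R integral {0..h} (\<lambda>s. \<gamma> s x) \<in> D"
    by (rule eventually_at_rightI[of 0 1]) (use differentiable_average in \<open>auto simp: D_def\<close>)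
  ultimately have "x \<in> D"
    using Lim_in_closed_set[OF _ _ trivial_limit_at_right_real average_tendsto] by blast
  then show ?thesis by (simp add: D_def)
qed

definition generator :: "'a \<Rightarrow> 'a" where
  "generator x = vector_derivative (\<lambda>t. \<gamma> t x) (at 0)"

lemma has_generator: "((\<lambda>t. \<gamma> t x) has_vector_derivative generator x) (at 0)"
  unfolding generator_def using flow_differentiable vector_derivative_works by blast

lemma generator_growth:
  obtains K where "0 \<le> K" "\<And>x. norm (generator x) \<le> K * norm x + norm (generator 0)"
proof -
  define B where "B x = generator x - generator 0" for x
  have B: "((\<lambda>t. linear_part (\<gamma> t) x) has_vector_derivative B x) (at 0)" for x
    unfolding linear_part_def[abs_def] B_def by (intro has_vector_derivative_diff has_generator)
  have "linear B"
  proof (rule linearI)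
    fix x y and r :: real
    have "((\<lambda>t. linear_part (\<gamma> t) x + linear_part (\<gamma> t) y) has_vector_derivative B x + B y) (at 0)"
      by (intro has_vector_derivative_add B)
    then have "((\<lambda>t. linear_part (\<gamma> t) (x + y)) has_vector_derivative B x + B y) (at 0)"
      by (simp add: linear_add[OF linear_flow_part])
    then show "B (x + y) = B x + B y" using B vector_derivative_unique_at by blast
    have "((\<lambda>t. r *\<^sub>R linear_part (\<gamma> t) x) has_vector_derivative r *\<^sub>R B x) (at 0)"
      by (rule bounded_linear.has_vector_derivative[OF bounded_linear_scaleR_right B])
    then have "((\<lambda>t. linear_part (\<gamma> t) (r *\<^sub>R x)) has_vector_derivative r *\<^sub>R B x) (at 0)"
      by (simp add: linear_scale[OF linear_flow_part])
    then show "B (r *\<^sub>R x) = r *\<^sub>R B x" using B vector_derivative_unique_at by blast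
  qed
  then obtain K where K: "0 < K" "\<And>x. norm (B x) \<le> K * norm x" using linear_bounded_pos by blast
  show thesis
  proof
    show "0 \<le> K" using K by simp
    fix x
    have "norm (generator x) \<le> norm (B x) + norm (generator 0)"
      unfolding B_def by (metis diff_add_cancel norm_triangle_ineq)
    then show "norm (generator x) \<le> K * norm x + norm (generator 0)" using K(2)[of x] by simp
  qed
qed

end

section \<open>Killing fields on the quotient\<close>

text \<open>The vector \<open>d\<pi> x (generator x)\<close> is the velocity of the curve of orbits
\<open>\<gamma> t ` \<pi> x\<close>, so it is the same for all \<open>x\<close> in one orbit, and the bound by the norm of the generator
may be evaluated at the point of the orbit that is closest to the base point up to \<open>1\<close>.\<close>

lemma (in isometric_quotient) flow_velocity_linear_growth:
  assumes sym: "\<And>t. quotient_symmetry \<Gamma> M (\<gamma> t)"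
    and flow: "\<And>s t. \<gamma> (s + t) = \<gamma> s \<circ> \<gamma> t"
    and cont: "\<And>x. continuous_on UNIV (\<lambda>t. \<gamma> t x)"
  obtains Y where "\<forall>p\<in>carrier_of \<A>. has_velocity \<A> (\<lambda>t. \<gamma> t ` p) 0 (Y p)"
    "linear_growth \<A> (quotient_metric \<Gamma> M) Y"
proof -
  have inj: "inj (\<gamma> 0)" using quotient_symmetry.bij[OF sym] bij_is_inj by blast
  have "\<gamma> 0 (\<gamma> 0 x) = \<gamma> 0 x" for x using flow[of 0 0] by (metis add_0 comp_apply)
  then have flow0: "\<gamma> 0 x = x" for x using inj by (metis injD)
  interpret F: isometric_flow \<gamma>
  proof
    show "dist (\<gamma> t x) (\<gamma> t y) = dist x y" for t x y by (rule quotient_symmetry.iso[OF sym])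
    show "\<gamma> (s + t) x = \<gamma> s (\<gamma> t x)" for s t x using flow by simp
  qed (use flow0 cont in auto)
  define Y where "Y p = d\<pi> (SOME x. x \<in> p) (F.generator (SOME x. x \<in> p))" for p
  have vel: "has_velocity \<A> (\<lambda>t. \<gamma> t ` \<pi> x) 0 (d\<pi> x (F.generator x))" if x: "x \<in> M" for x
  proof -
    have "\<forall>\<^sub>F t in at 0. \<gamma> t x \<in> M"
      using quotient_symmetry.mem_level_iff[OF sym] x by (intro always_eventually) simp
    then show ?thesis
      using has_velocity_projection[OF flow0 x _ F.has_generator] quotient_symmetry.image_orbit[OF sym]
      by simp
  qed
  have Y: "Y (\<pi> x) = d\<pi> x (F.generator x)" if x: "x \<in> M" for x
  proof -
    define y where "y = (SOME y. y \<in> \<pi> x)"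
    have y: "y \<in> \<pi> x" unfolding y_def using in_orbit_self by (rule someI)
    have "has_velocity \<A> (\<lambda>t. \<gamma> t ` \<pi> x) 0 (d\<pi> y (F.generator y))"
      using vel[of y] y orbit_subset[OF x] orbit_eq[OF y] by auto
    then show ?thesis unfolding Y_def y_def[symmetric] by (rule has_velocity_unique) (rule vel[OF x])
  qed
  have bound: "tnorm (quotient_metric \<Gamma> M) (\<pi> x) (Y (\<pi> x)) \<le> norm (F.generator x)" if x: "x \<in> M" for x
  proof -
    have ev: "\<forall>\<^sub>F t in at 0. \<gamma> t x \<in> M"
      using quotient_symmetry.mem_level_iff[OF sym] x by (intro always_eventually) simp
    have "F.generator x \<in> tangent_space M x"
      by (rule tangent_spaceI[OF flow0 x ev F.has_generator])
    then obtain h where h: "h \<in> horizontal x" "d\<pi> x h = d\<pi> x (F.generator x)" "norm h \<le> norm (F.generator x)"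
      by (rule horizontal_part[OF x])
    then show ?thesis using tnorm_quotient[OF x h(1)] Y[OF x] by simp
  qed
  obtain K where K: "0 \<le> K" "\<And>x. norm (F.generator x) \<le> K * norm x + norm (F.generator 0)"
    by (rule F.generator_growth) blast
  show thesis
  proof
    show "\<forall>p\<in>carrier_of \<A>. has_velocity \<A> (\<lambda>t. \<gamma> t ` p) 0 (Y p)"
      using vel Y by (auto simp: carrier)
    show "linear_growth \<A> (quotient_metric \<Gamma> M) Y"
      unfolding linear_growth_def
    proof
      fix q assume q: "q \<in> carrier_of \<A>"
      then obtain a where a: "a \<in> M" "q = \<pi> a" by (auto simp: carrier)
      let ?\<rho> = "riem_dist \<A> (quotient_metric \<Gamma> M)"
      show "linear_growth_on {x \<in> carrier_of \<A>. ?\<rho> q x < \<infinity>} \<A> (quotient_metric \<Gamma> M) Y"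
        unfolding linear_growth_on_def
      proof (intro exI bexI ballI)
        show "q \<in> {x \<in> carrier_of \<A>. ?\<rho> q x < \<infinity>}" using q riem_dist_refl_finite by simp
        fix p assume "p \<in> {x \<in> carrier_of \<A>. ?\<rho> q x < \<infinity>}"
        then obtain b where b: "b \<in> M" "p = \<pi> b" and fin: "?\<rho> q p < \<infinity>" by (auto simp: carrier)
        define r where "r = enn2real (?\<rho> q p)"
        have "ennreal (setdist q p) \<le> ennreal r"
          using setdist_le_riem_dist[of q p] fin by (simp add: r_def)
        then have sd: "setdist q p \<le> r" by (simp add: r_def ennreal_le_iff)
        obtain y where y: "y \<in> \<pi> b" "dist a y < setdist q p + 1"
          using setdist_orbit_attained[of a b "setdist q p + 1"] a(2) b(2) by auto
        have yM: "y \<in> M" and py: "p = \<pi> y" using y(1) b orbit_subset orbit_eq by auto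
        have "norm y \<le> norm a + dist a y"
          unfolding dist_norm using norm_triangle_ineq4[of a "a - y"] by simp
        then have ny: "norm y \<le> norm a + 1 + r" using y(2) sd by simp
        have "tnorm (quotient_metric \<Gamma> M) p (Y p) \<le> K * norm y + norm (F.generator 0)"
          unfolding py using bound[OF yM] K(2)[of y] by simp
        also have "\<dots> \<le> K * (norm a + 1 + r) + norm (F.generator 0)"
          using mult_left_mono[OF ny K(1)] by simp
        also have "\<dots> = K * r + (K * (norm a + 1) + norm (F.generator 0))"
          by (simp add: algebra_simps)
        finally show "tnorm (quotient_metric \<Gamma> M) p (Y p) \<le> K * enn2real (?\<rho> q p) + (K * (norm a + 1) + norm (F.generator 0))"
          by (simp add: r_def)
      qed
    qed
  qed
qed

section \<open>The unitary cotangent action\<close>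

lemma unitary_inverse:
  fixes U :: "complex^('n::finite)^'n"
  assumes "unitary U"
  shows "matrix_inv U = (\<chi> i j. cnj (U $ j $ i))"
proof -
  have 1: "(\<chi> i j. cnj (U $ j $ i)) ** U = mat 1" using assms by (simp add: unitary_def)
  then have 2: "U ** (\<chi> i j. cnj (U $ j $ i)) = mat 1" by (simp add: matrix_left_right_inverse)
  have "\<exists>A. U ** A = mat 1 \<and> A ** U = mat 1" using 1 2 by blast
  then have "U ** matrix_inv U = mat 1 \<and> matrix_inv U ** U = mat 1"
    unfolding matrix_inv_def by (rule someI_ex)
  then have "U ** matrix_inv U = mat 1" ..
  then show ?thesis using 1 by (metis matrix_mul_assoc matrix_mul_lid matrix_mul_rid)
qed

text \<open>For unitary \<open>U\<close> this is the transposed inverse, by which the cotangent lift acts on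
covectors.\<close>

definition conj_matrix :: "complex^'n^'n \<Rightarrow> complex^('n::finite)^'n" where
  "conj_matrix U = (\<chi> i j. cnj (U $ i $ j))"

lemma cot_action_unitary:
  assumes "unitary (fst g)"
  shows "cot_action g p = (fst g *v fst p + snd g, conj_matrix (fst g) *v snd p)"
  by (simp add: cot_action_def aff_action_def unitary_inverse[OF assms] transpose_def conj_matrix_def)

lemma conj_matrix_mult: "conj_matrix (U ** V) = conj_matrix U ** conj_matrix V"
  by (simp add: conj_matrix_def matrix_matrix_mult_def vec_eq_iff)

lemma unitary_mult:
  assumes "unitary U" "unitary V"
  shows "unitary (U ** V)"
proof -
  define adj :: "complex^'a^'a \<Rightarrow> complex^'a^'a" where "adj U = (\<chi> i j. cnj (U $ j $ i))" for U
  have u: "unitary W \<longleftrightarrow> adj W ** W = mat 1" for W by (simp add: unitary_def adj_def)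
  have "adj (U ** V) = adj V ** adj U"
    by (simp add: adj_def matrix_matrix_mult_def vec_eq_iff mult.commute)
  then have "adj (U ** V) ** (U ** V) = adj V ** (adj U ** U) ** V" by (simp add: matrix_mul_assoc)
  then show ?thesis using assms by (simp add: u)
qed

lemma norm_unitary_mult:
  fixes U :: "complex^('n::finite)^'n"
  assumes "unitary U"
  shows "norm (U *v x) = norm x"
proof -
  have cinner: "complex_of_real ((norm y)\<^sup>2) = (\<Sum>i\<in>UNIV. cnj (y $ i) * y $ i)" for y :: "complex^'n"
  proof -
    have "(norm y)\<^sup>2 = (\<Sum>i\<in>UNIV. (norm (y $ i))\<^sup>2)"
      by (simp add: norm_vec_def L2_set_def sum_nonneg)
    then show ?thesis
      by (simp only: of_real_sum complex_norm_square) (simp add: mult.commute)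
  qed
  have uu: "(\<Sum>i\<in>UNIV. cnj (U $ i $ j) * U $ i $ k) = (if j = k then 1 else 0)" for j k
    using assms by (simp add: unitary_def matrix_matrix_mult_def mat_def vec_eq_iff)
  have "complex_of_real ((norm (U *v x))\<^sup>2)
      = (\<Sum>i\<in>UNIV. (\<Sum>j\<in>UNIV. cnj (U $ i $ j) * cnj (x $ j)) * (\<Sum>k\<in>UNIV. U $ i $ k * x $ k))"
    unfolding cinner by (simp add: matrix_vector_mult_def)
  also have "\<dots> = (\<Sum>i\<in>UNIV. \<Sum>j\<in>UNIV. \<Sum>k\<in>UNIV. (cnj (U $ i $ j) * U $ i $ k) * (cnj (x $ j) * x $ k))"
    by (simp only: sum_product) (simp only: mult_ac)
  also have "\<dots> = (\<Sum>j\<in>UNIV. \<Sum>i\<in>UNIV. \<Sum>k\<in>UNIV. (cnj (U $ i $ j) * U $ i $ k) * (cnj (x $ j) * x $ k))"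
    by (rule sum.swap)
  also have "\<dots> = (\<Sum>j\<in>UNIV. \<Sum>k\<in>UNIV. \<Sum>i\<in>UNIV. (cnj (U $ i $ j) * U $ i $ k) * (cnj (x $ j) * x $ k))"
    by (rule sum.cong[OF refl sum.swap])
  also have "\<dots> = (\<Sum>j\<in>UNIV. \<Sum>k\<in>UNIV. (if j = k then 1 else 0) * (cnj (x $ j) * x $ k))"
    by (simp only: sum_distrib_right[symmetric] uu)
  also have "\<dots> = (\<Sum>j\<in>UNIV. \<Sum>k\<in>UNIV. if j = k then cnj (x $ j) * x $ k else 0)"
    by (intro sum.cong refl) simp
  also have "\<dots> = complex_of_real ((norm x)\<^sup>2)"
    unfolding cinner by simp
  finally have "(norm (U *v x))\<^sup>2 = (norm x)\<^sup>2" using of_real_eq_iff by blast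
  then show ?thesis by simp
qed

lemma unitary_conj_matrix:
  assumes "unitary U" shows "unitary (conj_matrix U)"
proof -
  have "(\<Sum>k\<in>UNIV. U $ k $ i * cnj (U $ k $ j)) = (if i = j then 1 else 0)" for i j
  proof -
    have "(\<Sum>k\<in>UNIV. cnj (U $ k $ i) * U $ k $ j) = (if i = j then 1 else 0)"
      using assms by (simp add: unitary_def matrix_matrix_mult_def mat_def vec_eq_iff)
    then have "cnj (\<Sum>k\<in>UNIV. cnj (U $ k $ i) * U $ k $ j) = (if i = j then 1 else 0)" by simp
    then show ?thesis by (simp add: mult.commute)
  qed
  then show ?thesis
    by (simp add: unitary_def conj_matrix_def matrix_matrix_mult_def mat_def vec_eq_iff)
qed

lemma dist_cot_action:
  assumes "unitary (fst g)"
  shows "dist (cot_action g p) (cot_action g q) = dist p q"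
proof -
  have "cot_action g p - cot_action g q = (fst g *v (fst p - fst q), conj_matrix (fst g) *v (snd p - snd q))"
    by (simp add: cot_action_unitary[OF assms] matrix_vector_mult_diff_distrib)
  then show ?thesis
    by (simp add: dist_norm norm_Pair norm_unitary_mult assms unitary_conj_matrix)
       (simp add: norm_prod_def)
qed

lemma cot_action_mult:
  assumes "unitary (fst g)" "unitary (fst h)"
  shows "cot_action (aff_mult g h) = cot_action g \<circ> cot_action h"
proof
  fix p
  have "unitary (fst (aff_mult g h))" using unitary_mult[OF assms] by (simp add: aff_mult_def)
  then show "cot_action (aff_mult g h) p = (cot_action g \<circ> cot_action h) p"
    using assms by (simp add: cot_action_unitary aff_mult_def conj_matrix_mult
        matrix_vector_mul_assoc matrix_vector_right_distrib)
qed

lemma cot_action_one: "cot_action aff_one = (id :: 'n::finite cot \<Rightarrow> 'n cot)"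
proof -
  have "(\<chi> i j. cnj ((mat 1 :: complex^'n^'n) $ j $ i)) = mat 1" "conj_matrix (mat 1 :: complex^'n^'n) = mat 1"
    by (auto simp: conj_matrix_def mat_def vec_eq_iff)
  moreover from this(1) have "unitary (mat 1 :: complex^'n^'n)" by (simp add: unitary_def)
  ultimately have "unitary (mat 1 :: complex^'n^'n)" "conj_matrix (mat 1 :: complex^'n^'n) = mat 1"
    by blast+
  then show ?thesis by (auto simp: fun_eq_iff aff_one_def cot_action_unitary)
qed

lemma isometry_group_cot_action:
  assumes G: "unitary_lie_group G"
  shows "isometry_group (cot_action ` G)"
proof -
  have u: "unitary (fst g)" if "g \<in> G" for g using G that by (simp add: unitary_lie_group_def)
  have mult: "aff_mult g h \<in> G" if "g \<in> G" "h \<in> G" for g h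
    using G that by (simp add: unitary_lie_group_def)
  have left: "\<exists>h\<in>G. cot_action h \<circ> cot_action g = id" if g: "g \<in> G" for g
  proof -
    obtain h where "h \<in> G" "aff_mult h g = aff_one" using G g unfolding unitary_lie_group_def by blast
    then show ?thesis using cot_action_mult[OF u u, of h g] g cot_action_one by metis
  qed
  have two: "\<exists>h\<in>G. cot_action h \<circ> cot_action g = id \<and> cot_action g \<circ> cot_action h = id" if g: "g \<in> G" for g
  proof -
    obtain h where h: "h \<in> G" "cot_action h \<circ> cot_action g = id" using left g by blast
    obtain k where k: "k \<in> G" "cot_action k \<circ> cot_action h = id" using left h(1) by blast
    have "cot_action k = cot_action k \<circ> (cot_action h \<circ> cot_action g)" by (simp add: h(2))
    also have "\<dots> = cot_action g" using k(2) by (simp add: comp_assoc[symmetric])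
    finally show ?thesis using h k by auto
  qed
  show ?thesis
    unfolding isometry_group_def
  proof (intro conjI ballI allI)
    have "aff_one \<in> G" using G by (simp add: unitary_lie_group_def)
    then show "id \<in> cot_action ` G" using cot_action_one by (metis image_eqI)
    show "h \<circ> k \<in> cot_action ` G" if "h \<in> cot_action ` G" "k \<in> cot_action ` G" for h k
      using that mult cot_action_mult[OF u u] by (metis (no_types, lifting) image_iff)
    fix f assume "f \<in> cot_action ` G"
    then obtain g where g: "g \<in> G" "f = cot_action g" by blast
    obtain h where h: "h \<in> G" "cot_action h \<circ> f = id" "f \<circ> cot_action h = id" using two g by metis
    show "bij f" using h(2,3) o_bij by blast
    have "inv f = cot_action h" using h(2,3) inv_unique_comp by blast
    then show "inv f \<in> cot_action ` G" using h(1) by blast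
    show "dist (f x) (f y) = dist x y" for x y using dist_cot_action[OF u[OF g(1)]] g(2) by simp
  qed
qed

theorem proposition5:
  fixes G :: "'n::finite aff set"
    and \<mu>1 :: "'n cot \<Rightarrow> 'n aff \<Rightarrow> real"
    and H :: "('n cot \<Rightarrow> 'n cot) set"
  assumes "unitary_lie_group G"
    and "moment_map G omega1 \<mu>1"
    and "\<forall>g\<in>G. cot_action g ` hk_level G \<mu>1 = hk_level G \<mu>1"
    and "smooth_submanifold (hk_level G \<mu>1)"
    and "free_on G (hk_level G \<mu>1)"
    and "proper_on G (hk_level G \<mu>1)"
    and "smooth_manifold (orbit (cot_action ` G) ` hk_level G \<mu>1) (hk_atlas G \<mu>1)"
    and "complete_metric (hk_atlas G \<mu>1) (hk_metric G \<mu>1)"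
    and "isometry_group H"
    and "\<forall>h\<in>H. h ` hk_level G \<mu>1 = hk_level G \<mu>1"
    and "normalizes H (cot_action ` G)"
  shows "(\<forall>h\<in>H. \<forall>x\<in>hk_level G \<mu>1. h ` orbit (cot_action ` G) x = orbit (cot_action ` G) (h x)) \<and>
    acts_isometrically H (\<lambda>h p. h ` p) (hk_atlas G \<mu>1) (hk_metric G \<mu>1) \<and>
    (\<forall>\<gamma>. one_parameter_subgroup H \<gamma> \<longrightarrow>
      (\<exists>Y. (\<forall>p\<in>carrier_of (hk_atlas G \<mu>1). has_velocity (hk_atlas G \<mu>1) (\<lambda>t. \<gamma> t ` p) 0 (Y p)) \<and>
           linear_growth (hk_atlas G \<mu>1) (hk_metric G \<mu>1) Y))"
proof -
  interpret Q: isometric_quotient "cot_action ` G" "hk_level G \<mu>1"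
  proof
    show "isometry_group (cot_action ` G)" by (rule isometry_group_cot_action[OF assms(1)])
    show "\<forall>g\<in>cot_action ` G. g ` hk_level G \<mu>1 = hk_level G \<mu>1" using assms(3) by blast
    show "smooth_manifold (orbit (cot_action ` G) ` hk_level G \<mu>1) (quotient_atlas (cot_action ` G) (hk_level G \<mu>1))"
      using assms(7) by (simp add: hk_atlas_def)
  qed (rule assms(4))
  have sym: "quotient_symmetry (cot_action ` G) (hk_level G \<mu>1) h" if h: "h \<in> H" for h
  proof unfold_locales
    show "bij h" using assms(9) h by (simp add: isometry_group_def)
    show "dist (h x) (h y) = dist x y" for x y using assms(9) h unfolding isometry_group_def by blast
    show "h ` hk_level G \<mu>1 = hk_level G \<mu>1" using assms(10) h by blast
    show "(\<lambda>g. h \<circ> g \<circ> inv h) ` cot_action ` G = cot_action ` G"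
      using assms(11) h unfolding normalizes_def by blast
  qed
  show ?thesis
    unfolding hk_atlas_def hk_metric_def
  proof (intro conjI ballI allI impI)
    show "h ` orbit (cot_action ` G) x = orbit (cot_action ` G) (h x)" if "h \<in> H" for h x
      by (rule quotient_symmetry.image_orbit[OF sym[OF that]])
    show "acts_isometrically H (\<lambda>h p. h ` p) Q.\<A> (quotient_metric (cot_action ` G) (hk_level G \<mu>1))"
      unfolding acts_isometrically_def
      using quotient_symmetry.isometry_image[OF sym] by (auto simp: image_comp)
    fix \<gamma> assume "one_parameter_subgroup H \<gamma>"
    then have \<gamma>: "\<And>t. \<gamma> t \<in> H" "\<And>s t. \<gamma> (s + t) = \<gamma> s \<circ> \<gamma> t" "\<And>x. continuous_on UNIV (\<lambda>t. \<gamma> t x)"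
      unfolding one_parameter_subgroup_def by auto
    show "\<exists>Y. (\<forall>p\<in>carrier_of Q.\<A>. has_velocity Q.\<A> (\<lambda>t. \<gamma> t ` p) 0 (Y p)) \<and>
           linear_growth Q.\<A> (quotient_metric (cot_action ` G) (hk_level G \<mu>1)) Y"
      using Q.flow_velocity_linear_growth[of \<gamma>, OF sym[OF \<gamma>(1)] \<gamma>(2,3)] by metis
  qed
qed

end
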